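(* Let $\mathbf T>0$, let $k$ be an $r\times r$-matrix valued accelerant on $[-\mathbf T,\mathbf T]$, with possibly a jump discontinuity at the origin, and let $a$ be the corresponding potential. Then $k$ is uniquely determined by $a$, and $k$ can be obtained from $a$ in the following way. Let $U(\tau,\lambda)$ be the matrizant of the Krein system with potential $a$, and put $$F(\lambda)=e^{i\lambda\mathbf T}\begin{bmatrix}I_r&I_r\end{bmatrix}U(\mathbf T,-\lambda)\begin{bmatrix}I_r\\ 0\end{bmatrix},\qquad G(\lambda)=\begin{bmatrix}I_r&I_r\end{bmatrix}U(\mathbf T,-\lambda)\begin{bmatrix}0\\ I_r\end{bmatrix}.$$ Then $F$ and $G$ are entire $r\times r$ matrix functions of the form $$F(\lambda)=I_r+\int_0^{\mathbf T}f(x)e^{i\lambda x}\,dx,\qquad G(\lambda)=I_r+\int_{-\mathbf T}^0g(x)e^{i\lambda x}\,dx,$$ where $f$ and $g$ are continuous $\mathbb C^{r\times r}$-valued functions on $[0,\mathbf T]$ and $[-\mathbf T,0]$, respectively. Moreover, with $F^\sharp(\lambda)=F(\bar\lambda)^*$ and $G^\sharp(\lambda)=G(\bar\lambda)^*$, the resultant operator $\mathbf R(F^\sharp,G^\sharp)$ on $\mathbf L_1^{r\times r}[-\mathbf T,\mathbf T]$ is invertible, and $$k=[\mathbf R(F^\sharp,G^\sharp)]^{-1}q,\qquad q(x)=\begin{cases}f(-x)^*,&-\mathbf T\le x<0,\\ g(-x)^*,&0\le x\le\mathbf T.\end{cases}$$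
   Context: Accelerant: an $r\times r$-matrix valued accelerant on $[-\mathbf T,\mathbf T]$, with possibly a jump discontinuity at the origin, is a function $k:[-\mathbf T,\mathbf T]\to\mathbb C^{r\times r}$ which is hermitian, i.e. $k(-t)=k(t)^*$ (for $t\ne0$), is continuous on $[-\mathbf T,0)$ and $(0,\mathbf T]$ with finite one-sided limits at $0$ (possibly different), and is such that for each $0<\tau\le\mathbf T$ the operator $(T_\tau f)(t)=f(t)-\int_0^\tau k(t-s)f(s)\,ds$, $0\le t\le\tau$, is invertible on the $\mathbb C^r$-valued space $\mathbf L^1[0,\tau]$. The value of $k$ at $0$ is immaterial ($k$ is regarded as an element of $\mathbf L_1^{r\times r}[-\mathbf T,\mathbf T]$). Potential: let $\gamma_\tau(t,s)$ be the resolvent kernel, $\gamma_\tau(t,s)-\int_0^\tau k(t-v)\gamma_\tau(v,s)\,dv=k(t-s)$, $0\le t,s\le\tau$. The corresponding potential is the continuous extension to $[0,\mathbf T]$ of $a(\tau)=\gamma_\tau(0,\tau)$, $0<\tau\le\mathbf T$. Krein system with potential $a$: $$\frac{\partial}{\partial\tau}Y(\tau,\lambda)=Y(\tau,\lambda)\left(i\lambda\begin{bmatrix}I_r&0\\ 0&0\end{bmatrix}+\begin{bmatrix}0&a(\tau)\\ a(\tau)^*&0\end{bmatrix}\right),\quad \tau\in[0,\mathbf T],\ \lambda\in\mathbb C.$$ Its matrizant is the unique $\mathbb C^{2r\times2r}$-valued solution $U(\tau,\lambda)$ with $U(0,\lambda)= I_{2r}$ for all $\lambda$. Resultant operator: for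 $B(\lambda)=I_r+\int_{-\tau}^0e^{i\lambda u}b(u)\,du$ and $D(\lambda)=I_r+\int_0^\tau e^{i\lambda u}d(u)\,du$ with $b\in\mathbf L_1^{r\times r}[-\tau,0]$, $d\in\mathbf L_1^{r\times r}[0,\tau]$ (both extended by zero outside their intervals), $\mathbf R(B,D)$ is the operator on $\mathbf L_1^{r\times r}[-\tau,\tau]$ given by $$(\mathbf R(B,D)\varphi)(u)=\begin{cases}\varphi(u)+\int_{-\tau}^\tau d(u-s)\varphi(s)\,ds,&0\le u\le\tau,\\ \varphi(u)+\int_{-\tau}^\tau b(u-s)\varphi(s)\,ds,&-\tau\le u<0.\end{cases}$$ Here it is applied with $\tau=\mathbf T$, $B=F^\sharp$, $D=G^\sharp$, that is, $b(u)=f(-u)^*$ and $d(u)=g(-u)^*$. *)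

theory Defs
  imports "HOL-Analysis.Analysis"
begin

section \<open>Complex matrices\<close>

definition cscale :: "complex \<Rightarrow> complex^'n^'m \<Rightarrow> complex^'n^'m" where
  "cscale c A = map_matrix (\<lambda>z. c * z) A"

definition ctrans :: "complex^'n^'m \<Rightarrow> complex^'m^'n" where
  "ctrans A = map_matrix cnj (transpose A)"

definition sharp :: "(complex \<Rightarrow> complex^'n^'m) \<Rightarrow> complex \<Rightarrow> complex^'m^'n" where
  "sharp F z = ctrans (F (cnj z))"

text \<open>Block matrices are indexed by sum types, so that a matrix of size $2r \times 2r$ has
  type \<^typ>\<open>complex^('r+'r)^('r+'r)\<close>.\<close>

definition block_row :: "complex^'n^'k \<Rightarrow> complex^'m^'k \<Rightarrow> complex^('n + 'm)^'k" where
  "block_row A B = (\<chi> i j. case j of Inl j' \<Rightarrow> A $ i $ j' | Inr j' \<Rightarrow> B $ i $ j')"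

definition block_col :: "complex^'k^'n \<Rightarrow> complex^'k^'m \<Rightarrow> complex^'k^('n + 'm)" where
  "block_col A B = (\<chi> i. case i of Inl i' \<Rightarrow> A $ i' | Inr i' \<Rightarrow> B $ i')"

definition block2 ::
  "complex^'n^'k \<Rightarrow> complex^'m^'k \<Rightarrow> complex^'n^'l \<Rightarrow> complex^'m^'l \<Rightarrow> complex^('n + 'm)^('k + 'l)"
  where "block2 A B C D = block_col (block_row A B) (block_row C D)"

section \<open>Operators on \<open>L\<^sup>1\<close>\<close>

text \<open>Elements of $L^1(S)$ are represented by functions on the whole line of which only the values
  on the Borel set \<open>S\<close> matter, and equality is equality almost everywhere on \<open>S\<close>. Using Borel
  measurable representatives loses nothing, since every Lebesgue measurable function agrees
  almost everywhere with a Borel measurable one.\<close>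

definition L1 :: "real set \<Rightarrow> (real \<Rightarrow> 'v::{banach, second_countable_topology}) set" where
  "L1 S = {f. set_integrable lborel S f}"

definition L1_norm :: "real set \<Rightarrow> (real \<Rightarrow> 'v::{banach, second_countable_topology}) \<Rightarrow> real" where
  "L1_norm S f = (LINT x:S|lborel. norm (f x))"

text \<open>Linearity together with the norm bound makes the operator respect equality almost
  everywhere.\<close>

definition bounded_L1_operator ::
  "real set \<Rightarrow> ((real \<Rightarrow> 'v::{banach, second_countable_topology}) \<Rightarrow> real \<Rightarrow> 'v) \<Rightarrow> bool" where
  "bounded_L1_operator S A \<longleftrightarrow>
     (\<forall>f\<in>L1 S. A f \<in> L1 S) \<and>
     (\<forall>f\<in>L1 S. \<forall>g\<in>L1 S. \<forall>c::real.
        AE x\<in>S in lborel. A (\<lambda>y. c *\<^sub>R f y + g y) x = c *\<^sub>R A f x + A g x) \<and>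
     (\<exists>C. \<forall>f\<in>L1 S. L1_norm S (A f) \<le> C * L1_norm S f)"

text \<open>\<open>B\<close> is the inverse of \<open>A\<close> in the algebra of bounded operators on $L^1(S)$. Real linearity
  suffices here: the operators \<open>A\<close> considered below are complex linear, and the inverse of a
  complex linear map is complex linear.\<close>

definition L1_inverse ::
  "real set \<Rightarrow> ((real \<Rightarrow> 'v::{banach, second_countable_topology}) \<Rightarrow> real \<Rightarrow> 'v)
     \<Rightarrow> ((real \<Rightarrow> 'v) \<Rightarrow> real \<Rightarrow> 'v) \<Rightarrow> bool" where
  "L1_inverse S A B \<longleftrightarrow>
     bounded_L1_operator S A \<and> bounded_L1_operator S B \<and>
     (\<forall>f\<in>L1 S. AE x\<in>S in lborel. A (B f) x = f x) \<and>
     (\<forall>f\<in>L1 S. AE x\<in>S in lborel. B (A f) x = f x)"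

definition L1_invertible ::
  "real set \<Rightarrow> ((real \<Rightarrow> 'v::{banach, second_countable_topology}) \<Rightarrow> real \<Rightarrow> 'v) \<Rightarrow> bool" where
  "L1_invertible S A \<longleftrightarrow> (\<exists>B. L1_inverse S A B)"

section \<open>Accelerants and potentials\<close>

definition T_op ::
  "(real \<Rightarrow> complex^'r^'r) \<Rightarrow> real \<Rightarrow> (real \<Rightarrow> complex^'r) \<Rightarrow> real \<Rightarrow> complex^'r" where
  "T_op k \<tau> f t = f t - (LINT s:{0..\<tau>}|lborel. k (t - s) *v f s)"

text \<open>Neither \<open>k 0\<close> nor the values of \<open>k\<close> outside \<open>{-T..T}\<close> are constrained.\<close>

definition accelerant :: "real \<Rightarrow> (real \<Rightarrow> complex^'r^'r) \<Rightarrow> bool" where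
  "accelerant T k \<longleftrightarrow>
     (\<forall>t\<in>{-T..T} - {0}. k (- t) = ctrans (k t)) \<and>
     continuous_on {-T..<0} k \<and> continuous_on {0<..T} k \<and>
     (\<exists>l. (k \<longlongrightarrow> l) (at_left 0)) \<and> (\<exists>l. (k \<longlongrightarrow> l) (at_right 0)) \<and>
     (\<forall>\<tau>. 0 < \<tau> \<and> \<tau> \<le> T \<longrightarrow> L1_invertible {0..\<tau>} (T_op k \<tau>))"

text \<open>The equation is imposed pointwise; for fixed \<open>s\<close> it determines \<open>\<gamma> t s\<close> for every \<open>t\<close>, by
  invertibility of the operator \<open>T_op k \<tau>\<close> applied columnwise. The value \<open>k 0\<close> influences only the
  diagonal values \<open>\<gamma> s s\<close>, in particular not \<open>\<gamma> 0 \<tau>\<close> for \<open>\<tau> > 0\<close>.\<close>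

definition resolvent_kernel ::
  "(real \<Rightarrow> complex^'r^'r) \<Rightarrow> real \<Rightarrow> (real \<Rightarrow> real \<Rightarrow> complex^'r^'r) \<Rightarrow> bool" where
  "resolvent_kernel k \<tau> \<gamma> \<longleftrightarrow>
     (\<forall>s\<in>{0..\<tau>}. (\<lambda>v. \<gamma> v s) \<in> L1 {0..\<tau>} \<and>
        (\<forall>t\<in>{0..\<tau>}. \<gamma> t s - (LINT v:{0..\<tau>}|lborel. k (t - v) ** \<gamma> v s) = k (t - s)))"

definition potential :: "real \<Rightarrow> (real \<Rightarrow> complex^'r^'r) \<Rightarrow> (real \<Rightarrow> complex^'r^'r) \<Rightarrow> bool" where
  "potential T k a \<longleftrightarrow>
     continuous_on {0..T} a \<and>
     (\<forall>\<tau>\<in>{0<..T}. \<exists>\<gamma>. resolvent_kernel k \<tau> \<gamma> \<and> a \<tau> = \<gamma> 0 \<tau>)"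

section \<open>The Krein system\<close>

definition matrizant ::
  "real \<Rightarrow> (real \<Rightarrow> complex^'r^'r) \<Rightarrow> (real \<Rightarrow> complex \<Rightarrow> complex^('r + 'r)^('r + 'r)) \<Rightarrow> bool" where
  "matrizant T a U \<longleftrightarrow>
     (\<forall>z. U 0 z = mat 1 \<and>
        (\<forall>\<tau>\<in>{0..T}.
           ((\<lambda>\<tau>. U \<tau> z) has_vector_derivative
              U \<tau> z ** (cscale (\<i> * z) (block2 (mat 1) 0 0 0)
                        + block2 0 (a \<tau>) (ctrans (a \<tau>)) 0))
             (at \<tau> within {0..T})))"

section \<open>The resultant operator\<close>

text \<open>\<open>b\<close> and \<open>d\<close>, extended by zero, are the kernels in the representations
  $B(\lambda) = I + \int_{-\tau}^0 e^{i\lambda u} b(u)\,du$ and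
  $D(\lambda) = I + \int_0^\tau e^{i\lambda u} d(u)\,du$; they are determined by \<open>B\<close> and \<open>D\<close>
  almost everywhere, so that the operator \<open>resultant \<tau> b d\<close> on $L^1[-\tau,\tau]$ is $R(B,D)$.\<close>

definition resultant_kernels ::
  "real \<Rightarrow> (complex \<Rightarrow> complex^'r^'r) \<Rightarrow> (complex \<Rightarrow> complex^'r^'r)
     \<Rightarrow> (real \<Rightarrow> complex^'r^'r) \<Rightarrow> (real \<Rightarrow> complex^'r^'r) \<Rightarrow> bool" where
  "resultant_kernels \<tau> B D b d \<longleftrightarrow>
     b \<in> L1 {-\<tau>..0} \<and> (\<forall>u. u \<notin> {-\<tau>..0} \<longrightarrow> b u = 0) \<and>
     d \<in> L1 {0..\<tau>} \<and> (\<forall>u. u \<notin> {0..\<tau>} \<longrightarrow> d u = 0) \<and>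
     (\<forall>z. B z = mat 1 + (LINT u:{-\<tau>..0}|lborel. cscale (exp (\<i> * z * complex_of_real u)) (b u))) \<and>
     (\<forall>z. D z = mat 1 + (LINT u:{0..\<tau>}|lborel. cscale (exp (\<i> * z * complex_of_real u)) (d u)))"

definition resultant ::
  "real \<Rightarrow> (real \<Rightarrow> complex^'r^'r) \<Rightarrow> (real \<Rightarrow> complex^'r^'r)
     \<Rightarrow> (real \<Rightarrow> complex^'r^'r) \<Rightarrow> real \<Rightarrow> complex^'r^'r" where
  "resultant \<tau> b d \<phi> u =
     (if 0 \<le> u then \<phi> u + (LINT s:{-\<tau>..\<tau>}|lborel. d (u - s) ** \<phi> s)
      else \<phi> u + (LINT s:{-\<tau>..\<tau>}|lborel. b (u - s) ** \<phi> s))"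

end

theory Submission
  imports Defs "HOL-Complex_Analysis.Complex_Analysis"
begin

text \<open>Let $X_\tau$ be the solution of $X_\tau(t) - \int_0^\tau k(t-s) X_\tau(s)\,ds = e^{-i\lambda t} I$.
  Its endpoint values $X_\tau(0)$ and $e^{i\lambda\tau} X_\tau(\tau)$, as functions of $\tau$, solve the
  system adjoint to the Krein system, so at $\tau = T$ they are $F^\sharp(\lambda)$ and
  $G^\sharp(\lambda)$; writing them with the resolvent kernel gives the kernels $f$ and $g$. The
  conservation law of the Krein system is $F F^\sharp = G G^\sharp$ on the real line.

  Write $b$, $d$ for the kernels of $F^\sharp$, $G^\sharp$ and $N = 1 - k$ for the convolution operator.
  The resolvent equations say that $(1+d)N$ and $N(1+f)$ are anticausal and $(1+b)N$ and $N(1+g)$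
  causal, up to lags exceeding $T$, and that $R k = q$. A triangularity argument turns the former into
  an explicit right inverse of the resultant operator $R$. Together with
  $(1+f)(1+b) = (1+g)(1+d)$ they show that a function in the kernel of $R$ satisfies a homogeneous
  Volterra inequality, so that $R$ is injective. Hence $k = R^{-1} q$, and since $F$ and $G$ depend
  only on $a$, so does $k$.\<close>

section \<open>Complex matrices\<close>

text \<open>The obstacle is regularity. The resolvent kernel inherits the jump of \<open>k\<close>
  along its diagonal, so it is split into \<open>k (t - s)\<close> and a continuous part
  \<open>rho\<close>, and no differentiability of the kernel in \<tau> is claimed. Only solution
  values at the origin are differentiated: solutions for two interval lengths differ by the
  resolvent applied to the piece of one of them between the two right endpoints, and dividing by the
  length of that piece yields the derivative. The right endpoint is turned into an origin by
  reflecting the interval; hermitian symmetry then identifies the coefficient of the reflected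
  equation as the adjoint potential. The conservation law is an identity between functions of
  \<lambda>. Uniqueness of Fourier transforms converts it into equality almost everywhere of
  convolution kernels, the form in which injectivity of \<open>R\<close> can use it. Reflection also
  exchanges causal with anticausal and the two halves of the interval, so the inversion and
  injectivity arguments are carried out on one half. Kernels are bounded with compact support, which
  makes operator products hold at every point.\<close>

lemma norm_matrix_sq: "(norm (A :: complex^'n^'m))\<^sup>2 = (\<Sum>i\<in>UNIV. \<Sum>j\<in>UNIV. (norm (A $ i $ j))\<^sup>2)"
  by (simp add: norm_vec_def L2_set_def sum_nonneg)

text \<open>The norm on nested vectors is the Frobenius norm, so Cauchy-Schwarz in each entry gives
  submultiplicativity with constant 1.\<close>

lemma norm_matrix_mult_le:
  fixes A :: "complex^'n^'m" and B :: "complex^'k^'n"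
  shows "norm (A ** B) \<le> norm A * norm B"
proof (rule power2_le_imp_le)
  have entry: "(norm ((A ** B) $ i $ j))\<^sup>2
      \<le> (\<Sum>l\<in>UNIV. (norm (A $ i $ l))\<^sup>2) * (\<Sum>l\<in>UNIV. (norm (B $ l $ j))\<^sup>2)" for i j
  proof -
    have "norm ((A ** B) $ i $ j) \<le> (\<Sum>l\<in>UNIV. norm (A $ i $ l) * norm (B $ l $ j))"
      unfolding matrix_matrix_mult_def by (simp, rule sum_norm_le) (simp add: norm_mult)
    also have "\<dots> \<le> L2_set (\<lambda>l. norm (A $ i $ l)) UNIV * L2_set (\<lambda>l. norm (B $ l $ j)) UNIV"
      using L2_set_mult_ineq[of "\<lambda>l. norm (A $ i $ l)" "\<lambda>l. norm (B $ l $ j)" UNIV] by simp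
    finally have "(norm ((A ** B) $ i $ j))\<^sup>2
        \<le> (L2_set (\<lambda>l. norm (A $ i $ l)) UNIV * L2_set (\<lambda>l. norm (B $ l $ j)) UNIV)\<^sup>2"
      by (intro power_mono) auto
    then show ?thesis by (simp add: power_mult_distrib L2_set_def sum_nonneg)
  qed
  have "(norm (A ** B))\<^sup>2 \<le> (\<Sum>i\<in>UNIV. \<Sum>j\<in>UNIV.
      (\<Sum>l\<in>UNIV. (norm (A $ i $ l))\<^sup>2) * (\<Sum>l\<in>UNIV. (norm (B $ l $ j))\<^sup>2))"
    unfolding norm_matrix_sq by (intro sum_mono entry)
  also have "\<dots> = (norm A)\<^sup>2 * (\<Sum>j\<in>UNIV. \<Sum>l\<in>UNIV. (norm (B $ l $ j))\<^sup>2)"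
    by (simp add: norm_matrix_sq sum_product)
  also have "(\<Sum>j\<in>UNIV. \<Sum>l\<in>UNIV. (norm (B $ l $ j))\<^sup>2) = (norm B)\<^sup>2"
    unfolding norm_matrix_sq by (rule sum.swap)
  finally show "(norm (A ** B))\<^sup>2 \<le> (norm A * norm B)\<^sup>2" by (simp add: power_mult_distrib)
qed simp

interpretation mm: bounded_bilinear "(**) :: complex^'n^'m \<Rightarrow> complex^'k^'n \<Rightarrow> complex^'k^'m"
proof
  show "\<exists>K. \<forall>(A :: complex^'n^'m) (B :: complex^'k^'n). norm (A ** B) \<le> norm A * norm B * K"
    using norm_matrix_mult_le by (intro exI[of _ 1]) auto
qed (simp_all add: matrix_matrix_mult_def vec_eq_iff sum.distrib algebra_simps scaleR_sum_right)

lemma measurable_matrix_mult [measurable]: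
  fixes f :: "'a \<Rightarrow> complex^'n^'m" and g :: "'a \<Rightarrow> complex^'k^'n"
  assumes "f \<in> borel_measurable M" "g \<in> borel_measurable M"
  shows "(\<lambda>x. f x ** g x) \<in> borel_measurable M"
proof (rule borel_measurable_continuous_Pair[OF assms])
  show "continuous_on UNIV (\<lambda>p :: (complex^'n^'m) \<times> (complex^'k^'n). fst p ** snd p)"
    by (intro mm.continuous_on continuous_intros)
qed

lemma cscale_component [simp]: "cscale c A $ i $ j = c * A $ i $ j"
  by (simp add: cscale_def map_matrix_def)

lemma ctrans_component [simp]: "ctrans A $ i $ j = cnj (A $ j $ i)"
  by (simp add: ctrans_def map_matrix_def transpose_def)

lemma ctrans_ctrans [simp]: "ctrans (ctrans A) = A"
  by (simp add: vec_eq_iff)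

lemma ctrans_mult: "ctrans (A ** B) = ctrans B ** ctrans A"
  by (simp add: vec_eq_iff matrix_matrix_mult_def mult.commute)

lemma ctrans_cscale: "ctrans (cscale c A) = cscale (cnj c) (ctrans A)"
  by (simp add: vec_eq_iff)

lemma ctrans_mat1 [simp]: "ctrans (mat 1) = mat 1"
  by (auto simp: vec_eq_iff mat_def)

lemma norm_ctrans [simp]: "norm (ctrans A) = norm A"
proof -
  have "(norm (ctrans A))\<^sup>2 = (norm A)\<^sup>2"
    unfolding norm_matrix_sq by (subst sum.swap) simp
  then show ?thesis by simp
qed

lemma bounded_linear_ctrans: "bounded_linear (ctrans :: complex^'n^'m \<Rightarrow> complex^'m^'n)"
  by (rule bounded_linear_intro[where K = 1]) (simp_all add: vec_eq_iff)

lemma norm_cscale [simp]: "norm (cscale c A) = norm c * norm A"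
proof -
  have "(norm (cscale c A))\<^sup>2 = (norm c * norm A)\<^sup>2"
    unfolding power_mult_distrib norm_matrix_sq by (simp add: norm_mult power_mult_distrib sum_distrib_left)
  then show ?thesis by (simp add: power2_eq_iff_nonneg)
qed

interpretation cscale: bounded_bilinear "cscale :: complex \<Rightarrow> complex^'n^'m \<Rightarrow> complex^'n^'m"
proof
  show "\<exists>K. \<forall>c (A :: complex^'n^'m). norm (cscale c A) \<le> norm c * norm A * K"
    by (intro exI[of _ 1]) auto
qed (simp_all add: vec_eq_iff algebra_simps)

lemma measurable_cscale [measurable]:
  fixes A :: "'a \<Rightarrow> complex^'n^'m"
  assumes "c \<in> borel_measurable M" "A \<in> borel_measurable M"
  shows "(\<lambda>x. cscale (c x) (A x)) \<in> borel_measurable M"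
proof (rule borel_measurable_continuous_Pair[OF assms])
  show "continuous_on UNIV (\<lambda>p :: complex \<times> (complex^'n^'m). cscale (fst p) (snd p))"
    by (intro cscale.continuous_on continuous_intros)
qed

lemma ctrans_add: "ctrans (A + B) = ctrans A + ctrans B"
  and ctrans_diff: "ctrans (A - B) = ctrans A - ctrans B"
  and ctrans_zero [simp]: "ctrans 0 = 0"
  by (simp_all add: vec_eq_iff)

lemma measurable_ctrans [measurable]:
  "A \<in> borel_measurable M \<Longrightarrow> (\<lambda>x. ctrans (A x)) \<in> borel_measurable M"
  using borel_measurable_continuous_on[OF linear_continuous_on[OF bounded_linear_ctrans]] by auto

lemmas [simp] = mm.zero_left mm.zero_right cscale.zero_right

lemma cscale_mult_left: "cscale c A ** B = cscale c (A ** B)"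
  by (simp add: vec_eq_iff matrix_matrix_mult_def sum_distrib_left mult.assoc)

lemma cscale_mult_right: "A ** cscale c B = cscale c (A ** B)"
  by (simp add: vec_eq_iff matrix_matrix_mult_def sum_distrib_left mult.left_commute)

lemma cscale_cscale [simp]: "cscale c (cscale d A) = cscale (c * d) A"
  by (simp add: vec_eq_iff)

lemma cscale_1 [simp]: "cscale 1 A = A"
  by (simp add: vec_eq_iff)

section \<open>Convolution operators\<close>

text \<open>A dominating product of two integrable functions makes \<open>H\<close> integrable along
  every line, not merely along almost every one, so the iterated integrals are genuine integrals at
  all points.\<close>

lemma integral_swap:
  fixes H :: "real \<Rightarrow> real \<Rightarrow> 'v::{banach, second_countable_topology}"
  assumes [measurable]: "(\<lambda>(x, y). H x y) \<in> borel_measurable (borel \<Otimes>\<^sub>M borel)"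
    and c: "integrable lborel c" and d: "integrable lborel d"
    and le: "\<And>x y. norm (H x y) \<le> c x * d y"
  shows "(LINT x|lborel. LINT y|lborel. H x y) = (LINT y|lborel. LINT x|lborel. H x y)"
    and "integrable lborel (\<lambda>x. LINT y|lborel. H x y)"
    and "integrable lborel (\<lambda>y. LINT x|lborel. H x y)"
    and "integrable lborel (\<lambda>x. H x y)"
    and "integrable lborel (\<lambda>y. H x y)"
proof -
  have m[measurable]: "(\<lambda>(x, y). H x y) \<in> borel_measurable (lborel \<Otimes>\<^sub>M lborel)"
    by simp
  have 1: "integrable lborel (\<lambda>y. H x y)" for x
  proof (rule Bochner_Integration.integrable_bound)
    show "integrable lborel (\<lambda>y. c x * d y)" using d by simp
    show "AE y in lborel. norm (H x y) \<le> norm (c x * d y)"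
      using le[of x] by (intro AE_I2) (auto intro: order_trans[OF _ abs_ge_self])
  qed measurable
  have 2: "integrable lborel (\<lambda>x. H x y)" for y
  proof (rule Bochner_Integration.integrable_bound)
    show "integrable lborel (\<lambda>x. c x * d y)" using c by simp
    show "AE x in lborel. norm (H x y) \<le> norm (c x * d y)"
      using le[of _ y] by (intro AE_I2) (auto intro: order_trans[OF _ abs_ge_self])
  qed measurable
  have int: "integrable (lborel \<Otimes>\<^sub>M lborel) (\<lambda>(x, y). H x y)"
  proof (rule lborel_pair.Fubini_integrable)
    have "integrable lborel (\<lambda>x. c x * (LINT y|lborel. d y))" using c by simp
    then show "integrable lborel (\<lambda>x. LINT y|lborel. norm (case (x, y) of (x, y) \<Rightarrow> H x y))"
    proof (rule Bochner_Integration.integrable_bound)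
      show "AE x in lborel. norm (LINT y|lborel. norm (case (x, y) of (x, y) \<Rightarrow> H x y))
          \<le> norm (c x * (LINT y|lborel. d y))"
      proof (intro AE_I2)
        fix x
        have "(LINT y|lborel. norm (H x y)) \<le> (LINT y|lborel. c x * d y)"
          using 1[of x] d le by (intro integral_mono) auto
        then show "norm (LINT y|lborel. norm (case (x, y) of (x, y) \<Rightarrow> H x y))
          \<le> norm (c x * (LINT y|lborel. d y))" by simp
      qed
    qed measurable
  qed (use 1 in auto)
  show "(LINT x|lborel. LINT y|lborel. H x y) = (LINT y|lborel. LINT x|lborel. H x y)"
    using lborel_pair.Fubini_integral[of H] int by simp
  show "integrable lborel (\<lambda>x. LINT y|lborel. H x y)"
    using lborel_pair.integrable_fst'[OF int] by simp
  show "integrable lborel (\<lambda>y. LINT x|lborel. H x y)"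
    using lborel_pair.integrable_snd[of H] int by simp
  show "integrable lborel (\<lambda>x. H x y)" "integrable lborel (\<lambda>y. H x y)"
    using 1 2 by auto
qed

section \<open>Algebra of convolutions with bounded, compactly supported kernels\<close>

definition conv :: "(real \<Rightarrow> complex^'n^'m) \<Rightarrow> (real \<Rightarrow> complex^'k^'n) \<Rightarrow> real \<Rightarrow> complex^'k^'m" where
  "conv c \<phi> u = (LINT s|lborel. c (u - s) ** \<phi> s)"

definition Dop :: "(real \<Rightarrow> complex^'n^'n) \<Rightarrow> (real \<Rightarrow> complex^'k^'n) \<Rightarrow> real \<Rightarrow> complex^'k^'n" where
  "Dop c \<phi> u = \<phi> u + conv c \<phi> u"

definition cutoff :: "real set \<Rightarrow> (real \<Rightarrow> 'v::zero) \<Rightarrow> real \<Rightarrow> 'v" where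
  "cutoff A \<phi> u = (if u \<in> A then \<phi> u else 0)"

text \<open>The class of kernels. Boundedness makes \<open>conv c \<phi>\<close> a convergent
  integral at every point for integrable \<open>\<phi>\<close>, so that operator identities hold
  pointwise. One number serves both as bound and as support radius.\<close>

definition bcs :: "(real \<Rightarrow> 'v::real_normed_vector) \<Rightarrow> bool" where
  "bcs c \<longleftrightarrow> c \<in> borel_measurable borel \<and> (\<exists>S. \<forall>x. norm (c x) \<le> S \<and> (S < \<bar>x\<bar> \<longrightarrow> c x = 0))"

text \<open>The class of arguments: it contains the zero extensions of integrable functions on
  intervals and is mapped into itself by \<open>conv c\<close> for \<open>c\<close> in
  \<open>bcs\<close>.\<close>

definition lcs :: "(real \<Rightarrow> 'v::{banach, second_countable_topology}) \<Rightarrow> bool" where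
  "lcs \<phi> \<longleftrightarrow> integrable lborel \<phi> \<and> (\<exists>S. \<forall>x. S < \<bar>x\<bar> \<longrightarrow> \<phi> x = 0)"

lemma bcsE:
  assumes "bcs c"
  obtains S where "S \<ge> 0" "\<And>x. norm (c x) \<le> S" "\<And>x. S < \<bar>x\<bar> \<Longrightarrow> c x = 0"
proof -
  from assms obtain S where S: "\<And>x. norm (c x) \<le> S" "\<And>x. S < \<bar>x\<bar> \<Longrightarrow> c x = 0"
    unfolding bcs_def by blast
  moreover have "S \<ge> 0" using order_trans[OF norm_ge_zero S(1)] .
  ultimately show ?thesis using that by blast
qed

lemma bcs_measurable: "bcs c \<Longrightarrow> c \<in> borel_measurable borel"
  by (simp add: bcs_def)

lemma lcs_integrable: "lcs \<phi> \<Longrightarrow> integrable lborel \<phi>"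
  by (simp add: lcs_def)

lemma lcs_measurable: "lcs \<phi> \<Longrightarrow> \<phi> \<in> borel_measurable borel"
  using borel_measurable_integrable lcs_integrable by fastforce

lemma integrable_bounded_compact:
  fixes \<phi> :: "real \<Rightarrow> 'v::{banach, second_countable_topology}"
  assumes [measurable]: "\<phi> \<in> borel_measurable borel"
    and "\<And>x. norm (\<phi> x) \<le> S" "\<And>x. S' < \<bar>x\<bar> \<Longrightarrow> \<phi> x = 0"
  shows "integrable lborel \<phi>"
proof (rule Bochner_Integration.integrable_bound)
  show "integrable lborel (\<lambda>x. S * indicator {-S'..S'} x)"
    by (cases "0 \<le> S'") auto
  show "AE x in lborel. norm (\<phi> x) \<le> norm (S * indicator {-S'..S'} x :: real)"
  proof (intro AE_I2)
    fix x show "norm (\<phi> x) \<le> norm (S * indicator {-S'..S'} x :: real)"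
      using assms(2)[of x] assms(3)[of x] by (cases "\<bar>x\<bar> \<le> S'") (auto simp: indicator_def)
  qed
qed simp

lemma bcs_imp_lcs:
  fixes c :: "real \<Rightarrow> 'v::{banach, second_countable_topology}"
  assumes "bcs c" shows "lcs c"
proof -
  from assms obtain S where S: "\<And>x. norm (c x) \<le> S" "\<And>x. S < \<bar>x\<bar> \<Longrightarrow> c x = 0"
    by (rule bcsE) blast
  show ?thesis
    unfolding lcs_def using integrable_bounded_compact[OF bcs_measurable[OF assms] S] S(2) by blast
qed

lemma bcs_add: "bcs c \<Longrightarrow> bcs c' \<Longrightarrow> bcs (\<lambda>x. c x + c' x)"
  for c :: "real \<Rightarrow> 'v::{real_normed_vector, second_countable_topology}"
proof -
  assume c: "bcs c" "bcs c'"
  from c(1) obtain S where S: "S \<ge> 0" "\<And>x. norm (c x) \<le> S" "\<And>x. S < \<bar>x\<bar> \<Longrightarrow> c x = 0"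
    by (rule bcsE) blast
  from c(2) obtain S' where S': "S' \<ge> 0" "\<And>x. norm (c' x) \<le> S'" "\<And>x. S' < \<bar>x\<bar> \<Longrightarrow> c' x = 0"
    by (rule bcsE) blast
  have "norm (c x + c' x) \<le> S + S' \<and> (S + S' < \<bar>x\<bar> \<longrightarrow> c x + c' x = 0)" for x
    using S(1) S'(1) S(2,3)[of x] S'(2,3)[of x] norm_triangle_le[of "c x" "c' x"] by auto
  then show ?thesis
    using bcs_measurable[OF c(1)] bcs_measurable[OF c(2)] unfolding bcs_def by auto
qed

lemma lcs_add: "lcs c \<Longrightarrow> lcs c' \<Longrightarrow> lcs (\<lambda>x. c x + c' x)"
proof -
  assume c: "lcs c" "lcs c'"
  from c(1) obtain S where S: "\<And>x. S < \<bar>x\<bar> \<Longrightarrow> c x = 0" unfolding lcs_def by blast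
  from c(2) obtain S' where S': "\<And>x. S' < \<bar>x\<bar> \<Longrightarrow> c' x = 0" unfolding lcs_def by blast
  have "\<forall>x. max S S' < \<bar>x\<bar> \<longrightarrow> c x + c' x = 0" using S S' by auto
  then show ?thesis using c unfolding lcs_def by blast
qed

lemma lcs_minus: "lcs c \<Longrightarrow> lcs (\<lambda>x. - c x)"
  unfolding lcs_def by auto

lemma lcs_diff: "lcs c \<Longrightarrow> lcs c' \<Longrightarrow> lcs (\<lambda>x. c x - c' x)"
  using lcs_add[of c "\<lambda>x. - c' x"] lcs_minus[of c'] by simp

lemma lcs_scaleR: "lcs c \<Longrightarrow> lcs (\<lambda>x. r *\<^sub>R c x)"
  unfolding lcs_def by auto

lemma cutoff_eq_indicator:
  fixes \<phi> :: "real \<Rightarrow> 'v::real_normed_vector"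
  shows "cutoff A \<phi> = (\<lambda>x. indicator A x *\<^sub>R \<phi> x)"
  by (auto simp: cutoff_def indicator_def)

lemma measurable_cutoff [measurable]:
  fixes \<phi> :: "real \<Rightarrow> 'v::{real_normed_vector, second_countable_topology}"
  assumes [measurable]: "A \<in> sets borel" "\<phi> \<in> borel_measurable borel"
  shows "cutoff A \<phi> \<in> borel_measurable borel"
  unfolding cutoff_eq_indicator by measurable

lemma lcs_cutoff:
  assumes "A \<in> sets borel" "lcs \<phi>" shows "lcs (cutoff A \<phi>)"
proof -
  have "integrable lborel (cutoff A \<phi>)"
    unfolding cutoff_eq_indicator using assms by (intro integrable_mult_indicator) (auto simp: lcs_def)
  moreover obtain S where "\<And>x. S < \<bar>x\<bar> \<Longrightarrow> \<phi> x = 0" using assms unfolding lcs_def by blast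
  ultimately show ?thesis unfolding lcs_def cutoff_def by auto
qed

lemma conv_integrand:
  fixes c :: "real \<Rightarrow> complex^'n^'m" and \<phi> :: "real \<Rightarrow> complex^'k^'n"
  assumes "bcs c" "integrable lborel \<phi>"
  shows "integrable lborel (\<lambda>s. c (u - s) ** \<phi> s)"
proof -
  from assms(1) obtain S where S: "S \<ge> 0" "\<And>x. norm (c x) \<le> S" by (rule bcsE) blast
  note [measurable] = bcs_measurable[OF assms(1)] borel_measurable_integrable[OF assms(2)]
  show ?thesis
  proof (rule Bochner_Integration.integrable_bound)
    show "integrable lborel (\<lambda>s. S * norm (\<phi> s))" using assms(2) by simp
    show "AE s in lborel. norm (c (u - s) ** \<phi> s) \<le> norm (S * norm (\<phi> s))"
    proof (intro AE_I2)
      fix s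
      have "norm (c (u - s) ** \<phi> s) \<le> norm (c (u - s)) * norm (\<phi> s)" by (rule norm_matrix_mult_le)
      also have "\<dots> \<le> S * norm (\<phi> s)" by (intro mult_right_mono S) simp
      finally show "norm (c (u - s) ** \<phi> s) \<le> norm (S * norm (\<phi> s))" using S(1) by simp
    qed
  qed measurable
qed

text \<open>The majorant \<open>h\<close> has to dominate \<open>\<phi>\<close> only where the
  kernel is nonzero, and not at lag zero. Thus a kernel supported on one side of 0 yields an
  integral over an open half line, which is what a Volterra inequality requires.\<close>

lemma conv_norm_le:
  assumes "bcs c" "integrable lborel \<phi>" "integrable lborel h" "\<And>x. norm (c x) \<le> S"
    and h: "\<And>s. 0 \<le> h s" "\<And>s. s \<noteq> u \<Longrightarrow> c (u - s) \<noteq> 0 \<Longrightarrow> norm (\<phi> s) \<le> h s"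
  shows "norm (conv c \<phi> u) \<le> S * (LINT s|lborel. h s)"
proof -
  have "S \<ge> 0" using order_trans[OF norm_ge_zero assms(4)] .
  have "norm (conv c \<phi> u) \<le> (LINT s|lborel. norm (c (u - s) ** \<phi> s))"
    unfolding conv_def by (rule integral_norm_bound)
  also have "\<dots> \<le> (LINT s|lborel. S * h s)"
  proof (rule integral_mono_AE)
    show "integrable lborel (\<lambda>s. norm (c (u - s) ** \<phi> s))"
      using conv_integrand[OF assms(1,2)] by simp
    show "AE s in lborel. norm (c (u - s) ** \<phi> s) \<le> S * h s"
      using AE_lborel_singleton[of u]
    proof eventually_elim
      case (elim s)
      show ?case
      proof (cases "c (u - s) = 0")
        case False
        have "norm (c (u - s) ** \<phi> s) \<le> norm (c (u - s)) * norm (\<phi> s)" by (rule norm_matrix_mult_le)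
        also have "\<dots> \<le> S * h s"
          using elim False \<open>S \<ge> 0\<close> by (intro mult_mono assms(4) h) auto
        finally show ?thesis .
      qed (use \<open>S \<ge> 0\<close> h in simp)
    qed
  qed (use assms in simp)
  finally show ?thesis by simp
qed

lemma measurable_conv [measurable]:
  assumes [measurable]: "c \<in> borel_measurable borel" "\<phi> \<in> borel_measurable borel"
  shows "conv c \<phi> \<in> borel_measurable borel"
  unfolding conv_def[abs_def] by measurable

lemma bcs_conv:
  assumes "bcs c" "lcs \<phi>" shows "bcs (conv c \<phi>)"
proof -
  from assms(1) obtain S where S: "S \<ge> 0" "\<And>x. norm (c x) \<le> S" "\<And>x. S < \<bar>x\<bar> \<Longrightarrow> c x = 0"
    by (rule bcsE) blast
  from assms(2) obtain S' where S': "\<And>x. S' < \<bar>x\<bar> \<Longrightarrow> \<phi> x = 0" unfolding lcs_def by blast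
  define M where "M = max (S + \<bar>S'\<bar>) (S * (LINT s|lborel. norm (\<phi> s)))"
  have "norm (conv c \<phi> u) \<le> S * (LINT s|lborel. norm (\<phi> s))" for u
    using conv_norm_le[OF assms(1) lcs_integrable[OF assms(2)], of "\<lambda>s. norm (\<phi> s)" S u]
      lcs_integrable[OF assms(2)] S by simp
  then have 1: "norm (conv c \<phi> u) \<le> M" for u unfolding M_def by (meson max.coboundedI2)
  have 2: "conv c \<phi> u = 0" if "M < \<bar>u\<bar>" for u
  proof -
    have "c (u - s) ** \<phi> s = 0" for s
    proof (cases "S < \<bar>u - s\<bar>")
      case False
      then have "S' < \<bar>s\<bar>" using that unfolding M_def by linarith
      then show ?thesis using S' by simp
    qed (simp add: S)
    then show ?thesis unfolding conv_def by simp
  qed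
  note [measurable] = bcs_measurable[OF assms(1)] lcs_measurable[OF assms(2)]
  have "conv c \<phi> \<in> borel_measurable borel" by measurable
  then show ?thesis unfolding bcs_def using 1 2 by auto
qed

lemma lcs_conv: "bcs c \<Longrightarrow> lcs \<phi> \<Longrightarrow> lcs (conv c \<phi>)"
  by (rule bcs_imp_lcs[OF bcs_conv])

lemma conv_zero_except:
  assumes "\<And>s. s \<noteq> v \<Longrightarrow> c (u - s) = 0 \<or> \<phi> s = 0"
  shows "conv c \<phi> u = 0"
  unfolding conv_def
proof (rule integral_eq_zero_AE)
  show "AE s in lborel. c (u - s) ** \<phi> s = 0"
    using AE_lborel_singleton[of v] by eventually_elim (use assms in fastforce)
qed

lemma conv_zero: "(\<And>s. s \<noteq> u \<Longrightarrow> c (u - s) = 0 \<or> \<phi> s = 0) \<Longrightarrow> conv c \<phi> u = 0"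
  by (rule conv_zero_except)

text \<open>Supports add under convolution. At the two extreme points of the sum interval a single
  \<open>s\<close> can contribute, a null set, which is why the inequalities for \<open>u\<close>
  are not strict.\<close>

lemma conv_outside:
  assumes c: "\<And>x. c x \<noteq> 0 \<Longrightarrow> p \<le> x \<and> x \<le> q" and \<phi>: "\<And>s. \<phi> s \<noteq> 0 \<Longrightarrow> \<alpha> \<le> s \<and> s \<le> \<beta>"
    and u: "u \<le> \<alpha> + p \<or> \<beta> + q \<le> u"
  shows "conv c \<phi> u = 0"
proof (rule conv_zero_except)
  fix s assume s: "s \<noteq> (if u \<le> \<alpha> + p then \<alpha> else \<beta>)"
  show "c (u - s) = 0 \<or> \<phi> s = 0"
    by (rule ccontr) (use c[of "u - s"] \<phi>[of s] u s in \<open>auto split: if_splits\<close>)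
qed

lemma conv_cong_AE:
  fixes \<phi> \<psi> :: "real \<Rightarrow> complex^'k^'n"
  assumes [measurable]: "c \<in> borel_measurable borel" "\<phi> \<in> borel_measurable borel" "\<psi> \<in> borel_measurable borel"
    and "AE s in lborel. \<phi> s = \<psi> s"
  shows "conv c \<phi> u = conv c \<psi> u"
  unfolding conv_def by (rule integral_cong_AE) (use assms(4) in auto)

lemma conv_add:
  assumes "bcs c" "lcs \<phi>" "lcs \<psi>"
  shows "conv c (\<lambda>x. \<phi> x + \<psi> x) u = conv c \<phi> u + conv c \<psi> u"
  unfolding conv_def mm.add_right
  using assms by (intro Bochner_Integration.integral_add conv_integrand) (auto simp: lcs_def)

lemma conv_diff:
  assumes "bcs c" "lcs \<phi>" "lcs \<psi>"
  shows "conv c (\<lambda>x. \<phi> x - \<psi> x) u = conv c \<phi> u - conv c \<psi> u"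
  unfolding conv_def mm.diff_right
  using assms by (intro Bochner_Integration.integral_diff conv_integrand) (auto simp: lcs_def)

lemma conv_scaleR: "conv c (\<lambda>x. r *\<^sub>R \<phi> x) u = r *\<^sub>R conv c \<phi> u"
  unfolding conv_def mm.scaleR_right by simp

lemma conv_add_left:
  assumes "bcs c" "bcs c'" "lcs \<phi>"
  shows "conv (\<lambda>x. c x + c' x) \<phi> u = conv c \<phi> u + conv c' \<phi> u"
  unfolding conv_def mm.add_left
  using assms by (intro Bochner_Integration.integral_add conv_integrand) (auto simp: lcs_def)

lemma conv_minus_left: "conv (\<lambda>x. - c x) \<phi> u = - conv c \<phi> u"
  unfolding conv_def mm.minus_left by simp

lemma conv_minus_right: "conv c (\<lambda>x. - \<phi> x) u = - conv c \<phi> u"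
  unfolding conv_def mm.minus_right by simp

lemma conv_assoc:
  assumes c: "bcs c" and c': "bcs c'" and \<phi>: "lcs \<phi>"
  shows "conv c (conv c' \<phi>) u = conv (conv c c') \<phi> u"
proof -
  from c' obtain S where S: "S \<ge> 0" "\<And>x. norm (c' x) \<le> S" by (rule bcsE) blast
  note [measurable] = bcs_measurable[OF c] bcs_measurable[OF c'] lcs_measurable[OF \<phi>]
  have ic: "integrable lborel (\<lambda>v. c (u - v))"
    using lborel_integrable_real_affine[OF lcs_integrable[OF bcs_imp_lcs[OF c]], of "-1" u] by simp
  have "conv c (conv c' \<phi>) u = (LINT v|lborel. LINT s|lborel. c (u - v) ** (c' (v - s) ** \<phi> s))"
    unfolding conv_def
    by (subst integral_bounded_linear[OF mm.bounded_linear_right])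
      (use conv_integrand[OF c' lcs_integrable[OF \<phi>]] in auto)
  also have "\<dots> = (LINT s|lborel. LINT v|lborel. c (u - v) ** (c' (v - s) ** \<phi> s))"
  proof (rule integral_swap(1))
    show "integrable lborel (\<lambda>v. norm (c (u - v)))" "integrable lborel (\<lambda>s. S * norm (\<phi> s))"
      using ic lcs_integrable[OF \<phi>] by auto
    show "norm (c (u - v) ** (c' (v - s) ** \<phi> s)) \<le> norm (c (u - v)) * (S * norm (\<phi> s))" for v s
      by (intro order_trans[OF norm_matrix_mult_le] mult_left_mono mult_right_mono S) auto
  qed measurable
  also have "\<dots> = (LINT s|lborel. conv c c' (u - s) ** \<phi> s)"
  proof (rule Bochner_Integration.integral_cong[OF refl])
    fix s
    have "(LINT v|lborel. c (u - v) ** (c' (v - s) ** \<phi> s))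
        = (LINT v|lborel. c (u - s - v) ** (c' v ** \<phi> s))"
      using lborel_integral_real_affine[of 1 "\<lambda>v. c (u - v) ** (c' (v - s) ** \<phi> s)" s]
      by (simp add: algebra_simps)
    also have "\<dots> = (LINT v|lborel. (c (u - s - v) ** c' v) ** \<phi> s)"
      by (simp add: matrix_mul_assoc)
    also have "\<dots> = conv c c' (u - s) ** \<phi> s"
      unfolding conv_def
      by (subst integral_bounded_linear[OF mm.bounded_linear_left])
        (use conv_integrand[OF c lcs_integrable[OF bcs_imp_lcs[OF c']], of "u - s"] in auto)
    finally show "(LINT v|lborel. c (u - v) ** (c' (v - s) ** \<phi> s)) = conv c c' (u - s) ** \<phi> s" .
  qed
  finally show ?thesis by (simp add: conv_def)
qed

lemma conv_mirror: "conv (\<lambda>x. c (- x)) (\<lambda>x. \<phi> (- x)) u = conv c \<phi> (- u)"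
  unfolding conv_def
  by (subst lborel_integral_real_affine[of "-1" _ 0]) (auto simp: add.commute)

text \<open>Adjoints reverse the order of the factors, and the shift by \<open>u\<close> in the
  integral puts a reflection on both. Equations for columns of the resolvent can thereby be read off
  from equations for rows.\<close>

lemma conv_ctrans:
  assumes "bcs c" "lcs \<phi>"
  shows "ctrans (conv c \<phi> u) = conv (\<lambda>x. ctrans (\<phi> (- x))) (\<lambda>x. ctrans (c (- x))) (- u)"
proof -
  have "ctrans (conv c \<phi> u) = (LINT s|lborel. ctrans (\<phi> s) ** ctrans (c (u - s)))"
    unfolding conv_def ctrans_mult[symmetric]
    by (subst integral_bounded_linear[OF bounded_linear_ctrans])
      (use conv_integrand[OF assms(1) lcs_integrable[OF assms(2)]] in auto)
  also have "\<dots> = conv (\<lambda>x. ctrans (\<phi> (- x))) (\<lambda>x. ctrans (c (- x))) (- u)"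
    unfolding conv_def
    by (subst lborel_integral_real_affine[of 1 _ u]) (auto simp: algebra_simps)
  finally show ?thesis .
qed

lemma bcs_mirror: "bcs c \<Longrightarrow> bcs (\<lambda>x. c (- x))"
  unfolding bcs_def by (auto intro: measurable_compose[of uminus])

lemma bcs_minus: "bcs c \<Longrightarrow> bcs (\<lambda>x. - c x)"
  for c :: "real \<Rightarrow> 'v::{real_normed_vector, second_countable_topology}"
  unfolding bcs_def by auto

lemma bcs_ctrans: "bcs c \<Longrightarrow> bcs (\<lambda>x. ctrans (c x))"
  unfolding bcs_def by auto

lemma lcs_mirror:
  assumes "lcs \<phi>" shows "lcs (\<lambda>x. \<phi> (- x))"
proof -
  obtain S where "\<And>x. S < \<bar>x\<bar> \<Longrightarrow> \<phi> x = 0" using assms unfolding lcs_def by blast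
  then have "\<forall>x. S < \<bar>x\<bar> \<longrightarrow> \<phi> (- x) = 0" by simp
  then show ?thesis
    using lborel_integrable_real_affine[of \<phi> "-1" 0] assms unfolding lcs_def by auto
qed

lemma lcs_Dop: "bcs c \<Longrightarrow> lcs \<phi> \<Longrightarrow> lcs (Dop c \<phi>)"
  unfolding Dop_def[abs_def] by (intro lcs_add lcs_conv)

lemma Dop_add: "bcs c \<Longrightarrow> lcs \<phi> \<Longrightarrow> lcs \<psi> \<Longrightarrow> Dop c (\<lambda>x. \<phi> x + \<psi> x) u = Dop c \<phi> u + Dop c \<psi> u"
  unfolding Dop_def by (simp add: conv_add)

lemma Dop_diff: "bcs c \<Longrightarrow> lcs \<phi> \<Longrightarrow> lcs \<psi> \<Longrightarrow> Dop c (\<lambda>x. \<phi> x - \<psi> x) u = Dop c \<phi> u - Dop c \<psi> u"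
  unfolding Dop_def by (simp add: conv_diff)

lemma Dop_scaleR: "Dop c (\<lambda>x. r *\<^sub>R \<phi> x) u = r *\<^sub>R Dop c \<phi> u"
  unfolding Dop_def by (simp add: conv_scaleR scaleR_add_right)

lemma Dop_zero:
  assumes "\<phi> u = 0" "\<And>s. s \<noteq> u \<Longrightarrow> c (u - s) = 0 \<or> \<phi> s = 0"
  shows "Dop c \<phi> u = 0"
  using assms unfolding Dop_def by (simp add: conv_zero)

lemma Dop_Dop:
  assumes "bcs c" "bcs c'" "lcs \<phi>"
  shows "Dop c (Dop c' \<phi>) = Dop (\<lambda>x. c x + c' x + conv c c' x) \<phi>"
proof
  fix u
  have "Dop c (Dop c' \<phi>) u = Dop c' \<phi> u + (conv c \<phi> u + conv c (conv c' \<phi>) u)"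
    unfolding Dop_def[of c] unfolding Dop_def[abs_def] using assms by (simp add: conv_add lcs_conv)
  then show "Dop c (Dop c' \<phi>) u = Dop (\<lambda>x. c x + c' x + conv c c' x) \<phi> u"
    unfolding Dop_def using assms
    by (simp add: conv_add_left bcs_add bcs_conv bcs_imp_lcs conv_assoc)
qed

lemma Dop_mirror: "Dop (\<lambda>x. c (- x)) (\<lambda>x. \<phi> (- x)) u = Dop c \<phi> (- u)"
  unfolding Dop_def by (simp add: conv_mirror)

lemma Dop_cong_AE:
  fixes \<phi> \<psi> :: "real \<Rightarrow> complex^'k^'n"
  assumes "c \<in> borel_measurable borel" "\<phi> \<in> borel_measurable borel" "\<psi> \<in> borel_measurable borel"
    and eq: "AE s in lborel. \<phi> s = \<psi> s"
  shows "AE u in lborel. Dop c \<phi> u = Dop c \<psi> u"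
  using eq by eventually_elim (simp add: Dop_def conv_cong_AE[OF assms])

text \<open>Iterating the hypothesis \<open>n\<close> times bounds the tail integral of \<open>v\<close> at \<open>u\<close> by
  \<open>2\<^sup>-\<^sup>n e\<^sup>2\<^sup>K\<^sup>(\<^sup>S\<^sup>-\<^sup>u\<^sup>)\<close> times the total integral.\<close>

lemma tail_gronwall:
  fixes v :: "real \<Rightarrow> real"
  assumes v: "integrable lborel v" "\<And>u. 0 \<le> v u" "\<And>u. S < u \<Longrightarrow> v u = 0" and K: "K > 0"
    and le: "AE u in lborel. v u \<le> K * (LINT s|lborel. indicator {u<..} s * v s)"
  shows "AE u in lborel. v u = 0"
proof -
  define m where "m u = (LINT s|lborel. indicator {u<..} s * v s)" for u
  have iv: "integrable lborel (\<lambda>s. indicator {u<..} s * v s)" for u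
    using integrable_mult_indicator[OF _ v(1), of "{u<..}"] by simp
  define I where "I = (LINT s|lborel. v s)"
  have m_zero: "m u = 0" if "S \<le> u" for u
    unfolding m_def using that v(3) by (intro integral_eq_zero_AE AE_I2) (auto simp: indicator_def)
  have I0: "0 \<le> I" unfolding I_def using v(2) by simp
  have bound: "m u \<le> I / 2 ^ n * exp (2 * K * (S - u))" if "u \<le> S" for u n
    using that
  proof (induction n arbitrary: u)
    case 0
    have "m u \<le> I"
      unfolding m_def I_def using iv v by (intro integral_mono) (auto simp: indicator_def)
    also have "\<dots> \<le> I * exp (2 * K * (S - u))"
      using I0 0 K by (simp add: mult_le_cancel_left1)
    finally show ?case by simp
  next
    case (Suc n)
    \<comment> \<open>The exponential has rate \<open>2 * K\<close>: integrating it divides by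
      \<open>2 * K\<close>, so that one use of the hypothesis, which costs a factor
      \<open>K\<close>, halves the bound.\<close>
    define J where "J = K * (I / 2 ^ n)"
    have "J \<ge> 0" unfolding J_def using K I0 by simp
    have has: "((\<lambda>s. J * exp (2 * K * (S - s))) has_integral
        J / (2 * K) * exp (2 * K * (S - u)) - J / (2 * K)) {u..S}"
    proof -
      have "((\<lambda>s. J * exp (2 * K * (S - s))) has_integral
        (- J / (2 * K) * exp (2 * K * (S - S))) - (- J / (2 * K) * exp (2 * K * (S - u)))) {u..S}"
        by (rule fundamental_theorem_of_calculus[OF Suc.prems])
          (use K in \<open>auto intro!: derivative_eq_intros
            simp: has_real_derivative_iff_has_vector_derivative[symmetric]\<close>)
      then show ?thesis by simp
    qed
    have nn: "integrable lborel (\<lambda>s. indicator {u..S} s * (J * exp (2 * K * (S - s))))"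
    proof -
      have "continuous_on {u..S} (\<lambda>s. J * exp (2 * K * (S - s)))" by (intro continuous_intros)
      from borel_integrable_compact[OF compact_Icc this] show ?thesis by simp
    qed
    have eq: "(LINT s|lborel. indicator {u..S} s * (J * exp (2 * K * (S - s))))
        = J / (2 * K) * exp (2 * K * (S - u)) - J / (2 * K)"
      using set_borel_integral_eq_integral(2)[of "{u..S}" "\<lambda>s. J * exp (2 * K * (S - s))"] nn
        integral_unique[OF has]
      unfolding set_integrable_def set_lebesgue_integral_def by simp
    have "m u \<le> (LINT s|lborel. indicator {u..S} s * (J * exp (2 * K * (S - s))))"
      unfolding m_def
    proof (rule integral_mono_AE[OF iv nn])
      show "AE s in lborel. indicator {u<..} s * v s \<le> indicator {u..S} s * (J * exp (2 * K * (S - s)))"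
        using le
      proof eventually_elim
        case (elim s)
        show ?case
        proof (cases "u < s \<and> s \<le> S")
          case True
          then have "v s \<le> K * m s" using elim by (simp add: m_def)
          also have "\<dots> \<le> K * (I / 2 ^ n * exp (2 * K * (S - s)))"
            using Suc.IH[of s] True K by (intro mult_left_mono) auto
          finally show ?thesis using True by (simp add: J_def mult.assoc)
        qed (use v(3)[of s] \<open>J \<ge> 0\<close> in \<open>auto simp: indicator_def\<close>)
      qed
    qed
    also have "\<dots> \<le> J / (2 * K) * exp (2 * K * (S - u))"
      unfolding eq using \<open>J \<ge> 0\<close> K by simp
    also have "J / (2 * K) = I / 2 ^ Suc n" using K by (simp add: J_def)
    finally show ?case .
  qed
  have "m u = 0" for u
  proof (cases "u \<le> S")
    case True
    have "m u \<le> 0"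
    proof (rule LIMSEQ_le_const)
      show "(\<lambda>n. I / 2 ^ n * exp (2 * K * (S - u))) \<longlonglongrightarrow> 0"
        by real_asymp
    qed (use bound[OF True] in auto)
    moreover have "0 \<le> m u" unfolding m_def using v(2) by (intro integral_nonneg_AE) auto
    ultimately show ?thesis by simp
  qed (use m_zero in auto)
  then have "AE u in lborel. v u \<le> 0" using le by (simp add: m_def)
  then show ?thesis by eventually_elim (use v(2) in \<open>auto intro: antisym\<close>)
qed

lemma cutoff_add: "cutoff A (\<lambda>x. \<phi> x + \<psi> x) = (\<lambda>x. cutoff A \<phi> x + (cutoff A \<psi> x :: 'v::monoid_add))"
  by (auto simp: cutoff_def)

lemma cutoff_diff: "cutoff A (\<lambda>x. \<phi> x - \<psi> x) = (\<lambda>x. cutoff A \<phi> x - (cutoff A \<psi> x :: 'v::group_add))"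
  by (auto simp: cutoff_def)

lemma cutoff_mirror: "cutoff (uminus ` S) (\<lambda>x. \<psi> (- x)) = (\<lambda>x. cutoff S \<psi> (- x))"
  by (force simp: cutoff_def)

lemma Dop_mirror_fun: "Dop (\<lambda>x. c (- x)) (\<lambda>x. \<psi> (- x)) = (\<lambda>u. Dop c \<psi> (- u))"
  by (simp add: Dop_mirror fun_eq_iff)

section \<open>Inversion of the resultant operator\<close>

text \<open>Think of \<open>n\<close> as minus the accelerant and of \<open>1 + f\<close>, \<open>1 + b\<close>, \<dots> as convolution operators. The
  four relations with \<open>n\<close> say that \<open>(1 + d)(1 + n)\<close>, \<open>(1 + n)(1 + f)\<close> are anticausal and
  \<open>(1 + b)(1 + n)\<close>, \<open>(1 + n)(1 + g)\<close> causal, up to time lags exceeding \<open>T\<close>. The endpoint \<open>0\<close> may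
  belong to either half of the interval, so that the data are stable under reflection.\<close>

locale resultant_data =
  fixes T :: real and f g b d n :: "real \<Rightarrow> complex^'r^'r" and A C :: "real set"
  assumes T: "T > 0"
    and bcs: "bcs f" "bcs g" "bcs b" "bcs d" "bcs n"
    and supp: "\<And>x. f x \<noteq> 0 \<Longrightarrow> 0 \<le> x \<and> x \<le> T" "\<And>x. d x \<noteq> 0 \<Longrightarrow> 0 \<le> x \<and> x \<le> T"
      "\<And>x. g x \<noteq> 0 \<Longrightarrow> - T \<le> x \<and> x \<le> 0" "\<And>x. b x \<noteq> 0 \<Longrightarrow> - T \<le> x \<and> x \<le> 0"
    and AC: "A \<union> C = {-T..T}" "A \<inter> C = {}" "A \<subseteq> {-T..0}" "C \<subseteq> {0..T}"
    and AC_borel: "A \<in> sets borel" "C \<in> sets borel"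
    and dn: "\<And>x. 0 < x \<Longrightarrow> x \<le> T \<Longrightarrow> d x + n x + conv d n x = 0"
    and bn: "\<And>x. - T \<le> x \<Longrightarrow> x < 0 \<Longrightarrow> b x + n x + conv b n x = 0"
    and nf: "\<And>x. 0 < x \<Longrightarrow> x \<le> T \<Longrightarrow> n x + f x + conv n f x = 0"
    and ng: "\<And>x. - T \<le> x \<Longrightarrow> x < 0 \<Longrightarrow> n x + g x + conv n g x = 0"
    and fb: "AE x in lborel. f x + b x + conv f b x = g x + d x + conv g d x"
begin

text \<open>Reversing the line exchanges past and future, hence \<open>f\<close> with
  \<open>g\<close>, \<open>b\<close> with \<open>d\<close> and \<open>A\<close> with
  \<open>C\<close>. Results about the right half thus transfer to the left half.\<close>

lemma mirror:
  "resultant_data T (\<lambda>x. g (- x)) (\<lambda>x. f (- x)) (\<lambda>x. d (- x)) (\<lambda>x. b (- x)) (\<lambda>x. n (- x))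
     (uminus ` C) (uminus ` A)"
proof
  have img: "x \<in> uminus ` S \<longleftrightarrow> - x \<in> S" for x :: real and S by force
  show "0 < T" by (rule T)
  show "bcs (\<lambda>x. g (- x))" "bcs (\<lambda>x. f (- x))" "bcs (\<lambda>x. d (- x))" "bcs (\<lambda>x. b (- x))"
    "bcs (\<lambda>x. n (- x))" using bcs by (auto intro: bcs_mirror)
  show "uminus ` C \<union> uminus ` A = {- T..T}"
    using AC(1) by (simp add: Un_commute[of A] flip: image_Un)
  show "uminus ` C \<inter> uminus ` A = {}" using AC(2) by auto
  show "uminus ` C \<subseteq> {-T..0}" "uminus ` A \<subseteq> {0..T}" using AC(3,4) by auto
  have "uminus ` S = uminus -` S" for S :: "real set" by (auto simp: img)
  then show "uminus ` C \<in> sets borel" "uminus ` A \<in> sets borel"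
    using AC_borel by (auto intro: measurable_sets_borel[where M = borel])
  show "g (- x) \<noteq> 0 \<Longrightarrow> 0 \<le> x \<and> x \<le> T" "b (- x) \<noteq> 0 \<Longrightarrow> 0 \<le> x \<and> x \<le> T"
    "f (- x) \<noteq> 0 \<Longrightarrow> -T \<le> x \<and> x \<le> 0" "d (- x) \<noteq> 0 \<Longrightarrow> -T \<le> x \<and> x \<le> 0" for x
    using supp[of "- x"] by auto
  have "AE x in lborel. f (- x) + b (- x) + conv f b (- x) = g (- x) + d (- x) + conv g d (- x)"
    using AE_borel_affine[of "-1" "\<lambda>x. f x + b x + conv f b x = g x + d x + conv g d x" 0] fb
      bcs_measurable[OF bcs(1)] bcs_measurable[OF bcs(2)] bcs_measurable[OF bcs(3)]
      bcs_measurable[OF bcs(4)] by simp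
  then show "AE x in lborel. g (- x) + d (- x) + conv (\<lambda>x. g (- x)) (\<lambda>x. d (- x)) x
      = f (- x) + b (- x) + conv (\<lambda>x. f (- x)) (\<lambda>x. b (- x)) x"
    by (simp add: conv_mirror eq_commute)
qed (use dn bn nf ng in \<open>auto simp: conv_mirror\<close>)

section \<open>An explicit right inverse of the resultant operator\<close>

definition om :: "(real \<Rightarrow> complex^'r^'r) \<Rightarrow> real \<Rightarrow> complex^'r^'r" where
  "om \<phi> u = Dop f (cutoff A \<phi>) u - Dop g (cutoff C \<phi>) u"

text \<open>With \<open>\<Gamma>\<close> the resolvent, \<open>inv_op\<close> is \<open>(1 + \<Gamma>)\<^bsup>-1\<^esup>\<close> on each half of the interval composed with the
  adjoint of the resultant operator, up to signs. Only the values of \<open>n\<close> on \<open>[-T, T]\<close> enter.\<close>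

definition inv_op :: "(real \<Rightarrow> complex^'r^'r) \<Rightarrow> real \<Rightarrow> complex^'r^'r" where
  "inv_op \<phi> u = cutoff A (Dop n (cutoff A (om \<phi>))) u - cutoff C (Dop n (cutoff C (om \<phi>))) u"

abbreviation "DN \<equiv> \<lambda>x. d x + n x + conv d n x"
abbreviation "NF \<equiv> \<lambda>x. n x + f x + conv n f x"
abbreviation "NG \<equiv> \<lambda>x. n x + g x + conv n g x"

lemma bcs_prods: "bcs DN" "bcs NF" "bcs NG"
  using bcs by (auto intro!: bcs_add bcs_conv bcs_imp_lcs)

lemma lcs_om: "lcs \<phi> \<Longrightarrow> lcs (om \<phi>)"
  unfolding om_def[abs_def] using bcs AC_borel by (intro lcs_diff lcs_Dop lcs_cutoff) auto

lemma lcs_inv_op: "lcs \<phi> \<Longrightarrow> lcs (inv_op \<phi>)"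
  unfolding inv_op_def[abs_def] using bcs AC_borel by (intro lcs_diff lcs_Dop lcs_cutoff lcs_om) auto

lemma om_add: "lcs \<phi> \<Longrightarrow> lcs \<psi> \<Longrightarrow> om (\<lambda>x. \<phi> x + \<psi> x) = (\<lambda>x. om \<phi> x + om \<psi> x)"
  unfolding om_def[abs_def] cutoff_add using bcs AC_borel
  by (simp add: Dop_add lcs_cutoff fun_eq_iff algebra_simps)

lemma inv_op_add:
  assumes "lcs \<phi>" "lcs \<psi>"
  shows "inv_op (\<lambda>x. \<phi> x + \<psi> x) = (\<lambda>x. inv_op \<phi> x + inv_op \<psi> x)"
proof -
  have "Dop n (cutoff S (om (\<lambda>x. \<phi> x + \<psi> x)))
      = (\<lambda>u. Dop n (cutoff S (om \<phi>)) u + Dop n (cutoff S (om \<psi>)) u)" if "S \<in> sets borel" for S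
    using assms that bcs(5) by (simp add: om_add cutoff_add Dop_add lcs_cutoff lcs_om fun_eq_iff)
  then show ?thesis
    unfolding inv_op_def[abs_def] using AC_borel by (simp add: cutoff_add algebra_simps)
qed

lemma om_supp: "u \<notin> {-T..T} \<Longrightarrow> om \<phi> u = 0"
proof -
  assume u: "u \<notin> {-T..T}"
  have "Dop f (cutoff A \<phi>) u = 0"
  proof (rule Dop_zero)
    show "f (u - s) = 0 \<or> cutoff A \<phi> s = 0" for s
      by (rule ccontr) (use supp(1)[of "u - s"] AC(3) u in \<open>force simp: cutoff_def subset_eq split: if_splits\<close>)
  qed (use u AC in \<open>auto simp: cutoff_def\<close>)
  moreover have "Dop g (cutoff C \<phi>) u = 0"
  proof (rule Dop_zero)
    show "g (u - s) = 0 \<or> cutoff C \<phi> s = 0" for s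
      by (rule ccontr) (use supp(3)[of "u - s"] AC(4) u in \<open>force simp: cutoff_def subset_eq split: if_splits\<close>)
  qed (use u AC in \<open>auto simp: cutoff_def\<close>)
  ultimately show ?thesis by (simp add: om_def)
qed

lemma om_split: "om \<phi> = (\<lambda>x. cutoff A (om \<phi>) x + cutoff C (om \<phi>) x)"
proof
  fix x
  show "om \<phi> x = cutoff A (om \<phi>) x + cutoff C (om \<phi>) x"
  proof (cases "x \<in> {-T..T}")
    case True
    then show ?thesis using AC(1,2) by (auto simp: cutoff_def simp del: atLeastAtMost_iff)
  next
    case False
    then show ?thesis using om_supp[OF False, of \<phi>] by (simp add: cutoff_def)
  qed
qed

text \<open>This is what \<open>om\<close> is made for: applying \<open>1 + n\<close> to it produces
  the triangular products \<open>NF\<close> and \<open>NG\<close>, each acting on the half of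
  \<open>\<phi>\<close> that belongs to it.\<close>

lemma N_om: "lcs \<phi> \<Longrightarrow> Dop n (om \<phi>) u = Dop NF (cutoff A \<phi>) u - Dop NG (cutoff C \<phi>) u"
  unfolding om_def[abs_def] using bcs AC_borel by (simp add: Dop_diff lcs_Dop lcs_cutoff Dop_Dop)

text \<open>The kernel \<open>d\<close> lives on \<open>[0, T]\<close>, so at a point of
  \<open>C\<close> it reads inputs between \<open>u - T\<close> and \<open>u\<close> only, and these
  lie inside the interval.\<close>

lemma D_window:
  assumes "u \<in> C" "lcs \<xi>"
  shows "Dop d (cutoff (A \<union> C) \<xi>) u = Dop d \<xi> u"
proof -
  have "conv d (cutoff (A \<union> C) \<xi>) u = conv d \<xi> u"
    unfolding conv_def
  proof (rule Bochner_Integration.integral_cong[OF refl])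
    fix s
    show "d (u - s) ** cutoff (A \<union> C) \<xi> s = d (u - s) ** \<xi> s"
    proof (cases "d (u - s) = 0")
      case False
      then have "s \<in> A \<union> C" using supp(2)[of "u - s"] assms(1) AC(1,4) by fastforce
      then show ?thesis by (simp add: cutoff_def)
    qed simp
  qed
  then show ?thesis using assms(1) by (simp add: Dop_def cutoff_def)
qed

text \<open>Adding and subtracting one mixed term, in which the two cutoffs around
  \<open>1 + n\<close> belong to different halves, completes one of the two pieces of
  \<open>inv_op\<close> to the full window and the other to \<open>1 + n\<close> applied to all of
  \<open>om \<phi>\<close>. By \<open>D_window\<close> the factor \<open>1 + d\<close> then meets
  \<open>1 + n\<close> directly, giving \<open>DN\<close>, while \<open>N_om\<close> evaluates the
  rest. The two expressions differ in which piece is completed to the window.\<close>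

lemma D_inv_op:
  assumes "u \<in> C" "lcs \<phi>"
  shows "Dop d (inv_op \<phi>) u = Dop DN (cutoff A (om \<phi>)) u
      - Dop d (cutoff C (\<lambda>x. Dop NF (cutoff A \<phi>) x - Dop NG (cutoff C \<phi>) x)) u" (is ?th1)
    and "Dop d (inv_op \<phi>) u = Dop d (cutoff A (\<lambda>x. Dop NF (cutoff A \<phi>) x - Dop NG (cutoff C \<phi>) x)) u
      - Dop DN (cutoff C (om \<phi>)) u" (is ?th2)
proof -
  note l = lcs_om[OF assms(2)] lcs_cutoff[OF AC_borel(1) lcs_om[OF assms(2)]]
    lcs_cutoff[OF AC_borel(2) lcs_om[OF assms(2)]]
  have sum: "Dop n (om \<phi>) x = Dop n (cutoff A (om \<phi>)) x + Dop n (cutoff C (om \<phi>)) x" for x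
    using Dop_add[OF bcs(5) l(2,3)] by (simp flip: om_split)
  have eq: "(\<lambda>x. Dop NF (cutoff A \<phi>) x - Dop NG (cutoff C \<phi>) x) = Dop n (om \<phi>)"
    using N_om[OF assms(2)] by auto
  have 1: "inv_op \<phi> = (\<lambda>x. cutoff (A \<union> C) (Dop n (cutoff A (om \<phi>))) x - cutoff C (Dop n (om \<phi>)) x)"
    unfolding inv_op_def using AC(2) by (auto simp: cutoff_def sum fun_eq_iff)
  have 2: "inv_op \<phi> = (\<lambda>x. cutoff A (Dop n (om \<phi>)) x - cutoff (A \<union> C) (Dop n (cutoff C (om \<phi>))) x)"
    unfolding inv_op_def using AC(2) by (auto simp: cutoff_def sum fun_eq_iff)
  have sets: "A \<union> C \<in> sets borel" using AC_borel by auto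
  show ?th1
    unfolding 1 eq using bcs l AC_borel sets assms(1)
    by (simp add: Dop_diff lcs_cutoff lcs_Dop D_window Dop_Dop)
  show ?th2
    unfolding 2 eq using bcs l AC_borel sets assms(1)
    by (simp add: Dop_diff lcs_cutoff lcs_Dop D_window Dop_Dop)
qed

text \<open>In the first expression of \<open>D_inv_op\<close> every product that could reach
  \<open>u\<close> does so at a lag where \<open>DN\<close>, \<open>NF\<close> or \<open>NG\<close>
  vanishes, or else reads \<open>\<phi>\<close> at an early time, where it is zero. What survives is
  the identity part of \<open>NG\<close> at \<open>u\<close> itself, with two minus signs.\<close>

lemma D_inv_op_late:
  assumes u: "0 < u" "u \<in> C" and \<phi>: "lcs \<phi>"
    and z: "\<And>s. s \<in> A \<Longrightarrow> s < u - T \<Longrightarrow> \<phi> s = 0" "\<And>s. s \<in> C \<Longrightarrow> s < u \<Longrightarrow> \<phi> s = 0"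
  shows "Dop d (inv_op \<phi>) u = \<phi> u"
proof -
  have A: "s \<in> A \<Longrightarrow> -T \<le> s \<and> s \<le> 0" and C: "s \<in> C \<Longrightarrow> 0 \<le> s \<and> s \<le> T" for s using AC by auto
  have disj: "s \<in> A \<Longrightarrow> s \<notin> C" for s using AC by auto
  have uA: "u \<notin> A" using u disj by auto
  have a: "Dop DN (cutoff A (om \<phi>)) u = 0"
  proof (rule Dop_zero)
    fix s assume "s \<noteq> u"
    show "DN (u - s) = 0 \<or> cutoff A (om \<phi>) s = 0"
    proof (rule ccontr)
      assume H: "\<not> ?thesis"
      then have s: "s \<in> A" by (auto simp: cutoff_def split: if_splits)
      \<comment> \<open>A nonzero value of \<open>DN\<close> at a positive lag means that the lag
        exceeds \<open>T\<close>. From such an \<open>s\<close>, neither \<open>f\<close> nor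
        \<open>g\<close> reaches a point where \<open>\<phi>\<close> is nonzero.\<close>
      then have "u - s > T" using H dn[of "u - s"] u A[OF s] by force
      have "Dop f (cutoff A \<phi>) s = 0"
      proof (rule Dop_zero)
        show "f (s - t) = 0 \<or> cutoff A \<phi> t = 0" for t
          by (rule ccontr) (use supp(1)[of "s - t"] z(1)[of t] \<open>u - s > T\<close> in \<open>auto simp: cutoff_def split: if_splits\<close>)
      qed (use z(1) \<open>u - s > T\<close> in \<open>auto simp: cutoff_def\<close>)
      moreover have "Dop g (cutoff C \<phi>) s = 0"
      proof (rule Dop_zero)
        show "g (s - t) = 0 \<or> cutoff C \<phi> t = 0" for t
          by (rule ccontr) (use supp(3)[of "s - t"] z(2)[of t] \<open>u - s > T\<close> in \<open>auto simp: cutoff_def split: if_splits\<close>)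
      qed (use disj s in \<open>auto simp: cutoff_def\<close>)
      ultimately have "om \<phi> s = 0" by (simp add: om_def)
      then show False using H by (auto simp: cutoff_def split: if_splits)
    qed
  qed (use uA in \<open>simp add: cutoff_def\<close>)
  have e2: "Dop NF (cutoff A \<phi>) s = 0" if s: "s \<in> C" "s \<le> u" for s
  proof (rule Dop_zero)
    fix t assume "t \<noteq> s"
    then show "NF (s - t) = 0 \<or> cutoff A \<phi> t = 0"
      using nf[of "s - t"] A[of t] C[OF s(1)] z(1)[of t] s by (cases "t < u - T") (auto simp: cutoff_def)
  qed (use s disj in \<open>auto simp: cutoff_def\<close>)
  \<comment> \<open>Inputs before \<open>s\<close> vanish by assumption, and inputs after
    \<open>s\<close> meet \<open>NG\<close> at a lag in \<open>[-T, 0)\<close>. Only the identity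
    part of \<open>Dop NG\<close> is left.\<close>
  have e3: "conv NG (cutoff C \<phi>) s = 0" if s: "s \<in> C" "s \<le> u" for s
  proof (rule conv_zero)
    fix t assume "t \<noteq> s"
    then show "NG (s - t) = 0 \<or> cutoff C \<phi> t = 0"
      using ng[of "s - t"] C[of t] C[OF s(1)] z(2)[of t] s by (cases "t < s") (auto simp: cutoff_def)
  qed
  have "conv d (cutoff C (\<lambda>x. Dop NF (cutoff A \<phi>) x - Dop NG (cutoff C \<phi>) x)) u = 0"
  proof (rule conv_zero)
    fix s assume "s \<noteq> u"
    show "d (u - s) = 0 \<or> cutoff C (\<lambda>x. Dop NF (cutoff A \<phi>) x - Dop NG (cutoff C \<phi>) x) s = 0"
    proof (cases "d (u - s) = 0")
      case False
      then have "s < u" using supp(2)[of "u - s"] \<open>s \<noteq> u\<close> by auto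
      then show ?thesis using e2[of s] e3[of s] z(2)[of s] by (auto simp: cutoff_def Dop_def[of NG])
    qed simp
  qed
  then have "Dop d (cutoff C (\<lambda>x. Dop NF (cutoff A \<phi>) x - Dop NG (cutoff C \<phi>) x)) u = - \<phi> u"
    using e2[of u] e3[of u] u by (simp add: Dop_def[of d] cutoff_def[of C] Dop_def[of NG])
  then show ?thesis using D_inv_op(1)[OF u(2) \<phi>] a by simp
qed

text \<open>Complementary to the late case, with the second expression of \<open>D_inv_op\<close>:
  inputs that are all early are annihilated by the vanishing of \<open>NF\<close> and
  \<open>NG\<close> on the part of \<open>A\<close> seen by \<open>d\<close>, and by that of
  \<open>DN\<close> on \<open>C\<close>.\<close>

lemma D_inv_op_early:
  assumes u: "0 < u" "u \<in> C" and \<phi>: "lcs \<phi>"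
    and z: "\<And>s. s \<in> A \<Longrightarrow> u - T \<le> s \<Longrightarrow> \<phi> s = 0" "\<And>s. s \<in> C \<Longrightarrow> u \<le> s \<Longrightarrow> \<phi> s = 0"
  shows "Dop d (inv_op \<phi>) u = 0"
proof -
  have A: "s \<in> A \<Longrightarrow> -T \<le> s \<and> s \<le> 0" and C: "s \<in> C \<Longrightarrow> 0 \<le> s \<and> s \<le> T" for s using AC by auto
  have disj: "s \<in> A \<Longrightarrow> s \<notin> C" for s using AC by auto
  have uA: "u \<notin> A" using u disj by auto
  have "Dop d (cutoff A (\<lambda>x. Dop NF (cutoff A \<phi>) x - Dop NG (cutoff C \<phi>) x)) u = 0"
  proof (rule Dop_zero)
    fix s assume "s \<noteq> u"
    show "d (u - s) = 0 \<or> cutoff A (\<lambda>x. Dop NF (cutoff A \<phi>) x - Dop NG (cutoff C \<phi>) x) s = 0"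
    proof (rule ccontr)
      assume H: "\<not> ?thesis"
      then have s: "s \<in> A" and "u - T \<le> s" using supp(2)[of "u - s"] by (auto simp: cutoff_def split: if_splits)
      have "Dop NF (cutoff A \<phi>) s = 0"
      proof (rule Dop_zero)
        fix t assume "t \<noteq> s"
        then show "NF (s - t) = 0 \<or> cutoff A \<phi> t = 0"
          using nf[of "s - t"] A[of t] A[OF s] z(1)[of t] \<open>u - T \<le> s\<close> by (cases "t < s") (auto simp: cutoff_def)
      qed (use z(1) \<open>u - T \<le> s\<close> in \<open>auto simp: cutoff_def\<close>)
      \<comment> \<open>An input \<open>t\<close> in \<open>C\<close> comes before \<open>u\<close>,
        and \<open>s\<close> is at least \<open>u - T\<close>; therefore the lag
        \<open>s - t\<close> lies in \<open>[-T, 0]\<close>, and at nonzero lags there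
        \<open>NG\<close> vanishes.\<close>
      moreover have "Dop NG (cutoff C \<phi>) s = 0"
      proof (rule Dop_zero)
        fix t assume "t \<noteq> s"
        then show "NG (s - t) = 0 \<or> cutoff C \<phi> t = 0"
          using ng[of "s - t"] C[of t] A[OF s] z(2)[of t] \<open>u - T \<le> s\<close> by (cases "u \<le> t") (auto simp: cutoff_def)
      qed (use s disj in \<open>auto simp: cutoff_def\<close>)
      ultimately show False using H by (auto simp: cutoff_def split: if_splits)
    qed
  qed (use uA in \<open>simp add: cutoff_def\<close>)
  moreover have om0: "om \<phi> s = 0" if s: "s \<in> C" "u \<le> s" for s
  proof -
    have "Dop f (cutoff A \<phi>) s = 0"
    proof (rule Dop_zero)
      show "f (s - t) = 0 \<or> cutoff A \<phi> t = 0" for t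
        by (rule ccontr) (use supp(1)[of "s - t"] z(1)[of t] s in \<open>auto simp: cutoff_def split: if_splits\<close>)
    qed (use s disj in \<open>auto simp: cutoff_def\<close>)
    moreover have "Dop g (cutoff C \<phi>) s = 0"
    proof (rule Dop_zero)
      show "g (s - t) = 0 \<or> cutoff C \<phi> t = 0" for t
        by (rule ccontr) (use supp(3)[of "s - t"] z(2)[of t] s in \<open>auto simp: cutoff_def split: if_splits\<close>)
    qed (use s z in \<open>auto simp: cutoff_def\<close>)
    ultimately show ?thesis by (simp add: om_def)
  qed
  have "Dop DN (cutoff C (om \<phi>)) u = 0"
  proof (rule Dop_zero)
    fix s assume "s \<noteq> u"
    show "DN (u - s) = 0 \<or> cutoff C (om \<phi>) s = 0"
      using dn[of "u - s"] C[of s] C[OF u(2)] om0[of s] \<open>s \<noteq> u\<close> by (cases "s < u") (auto simp: cutoff_def)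
  qed (use om0[of u] u in \<open>simp add: cutoff_def\<close>)
  ultimately show ?thesis using D_inv_op(2)[OF u(2) \<phi>] by simp
qed

text \<open>By the second expression in \<open>D_inv_op\<close>, the values of \<open>\<phi>\<close> at times in \<open>A\<close> before \<open>u - T\<close> and in \<open>C\<close>
  before \<open>u\<close> contribute nothing; by the first one, the remaining values contribute only \<open>\<phi> u\<close>.\<close>

lemma D_inv_op_eq:
  assumes u: "0 < u" "u \<in> C" and \<phi>: "lcs \<phi>"
  shows "Dop d (inv_op \<phi>) u = \<phi> u"
proof -
  define E where "E = (A \<inter> {..<u - T}) \<union> (C \<inter> {..<u})"
  have E: "E \<in> sets borel" unfolding E_def using AC_borel by auto
  define \<phi>1 where "\<phi>1 = cutoff E \<phi>"
  define \<phi>2 where "\<phi>2 = cutoff (- E) \<phi>"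
  have l: "lcs \<phi>1" "lcs \<phi>2" unfolding \<phi>1_def \<phi>2_def using E \<phi> by (auto intro!: lcs_cutoff)
  have \<phi>_eq: "\<phi> = (\<lambda>x. \<phi>1 x + \<phi>2 x)" by (auto simp: \<phi>1_def \<phi>2_def cutoff_def)
  have disj: "s \<in> A \<Longrightarrow> s \<notin> C" for s using AC by auto
  have "Dop d (inv_op \<phi>1) u = 0"
    by (rule D_inv_op_early[OF u l(1)]) (use disj in \<open>auto simp: \<phi>1_def cutoff_def E_def\<close>)
  moreover have "Dop d (inv_op \<phi>2) u = \<phi>2 u"
    by (rule D_inv_op_late[OF u l(2)]) (auto simp: \<phi>2_def cutoff_def E_def)
  moreover have "\<phi>1 u = 0" using u disj by (auto simp: \<phi>1_def cutoff_def E_def)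
  ultimately show ?thesis
    using l bcs unfolding \<phi>_eq by (simp add: inv_op_add Dop_add lcs_inv_op)
qed

section \<open>Injectivity of the resultant operator\<close>

lemma FB_GD:
  fixes \<psi> :: "real \<Rightarrow> complex^'r^'r"
  assumes \<psi>: "lcs \<psi>"
  shows "Dop f (Dop b \<psi>) u = Dop g (Dop d \<psi>) u"
proof -
  have bd: "bcs (\<lambda>x. f x + b x + conv f b x)" "bcs (\<lambda>x. g x + d x + conv g d x)"
    using bcs by (auto intro!: bcs_add bcs_conv bcs_imp_lcs)
  note [measurable] = bcs_measurable[OF bd(1)] bcs_measurable[OF bd(2)] lcs_measurable[OF \<psi>]
  \<comment> \<open>The kernels agree almost everywhere only. A reflected translate of a null set is
    null, so after integration against \<open>\<psi>\<close> the identity holds for every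
    \<open>u\<close>.\<close>
  have "AE s in lborel. f (u - s) + b (u - s) + conv f b (u - s)
      = g (u - s) + d (u - s) + conv g d (u - s)"
    using AE_borel_affine[of "-1" "\<lambda>x. f x + b x + conv f b x = g x + d x + conv g d x" u] fb by auto
  then have "conv (\<lambda>x. f x + b x + conv f b x) \<psi> u = conv (\<lambda>x. g x + d x + conv g d x) \<psi> u"
    unfolding conv_def[of _ \<psi>] by (intro integral_cong_AE) auto
  then show ?thesis using bcs \<psi> by (simp add: Dop_Dop) (simp add: Dop_def)
qed

text \<open>Without the cutoffs this is \<open>FB_GD\<close>, so the parts cut away have to be
  invisible at \<open>u\<close>. Outside \<open>A\<close>, the function \<open>Dop b \<phi>\<close>
  lives at or below \<open>-T\<close>, and \<open>f\<close> moves it forward by at most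
  \<open>T\<close>. Outside \<open>C\<close>, the function \<open>Dop d \<phi>\<close> lives on the
  nonpositive axis, and \<open>g\<close> moves it backward.\<close>

lemma half_cancel:
  fixes \<phi> :: "real \<Rightarrow> complex^'r^'r"
  assumes \<phi>: "lcs \<phi>" "\<And>s. \<phi> s \<noteq> 0 \<Longrightarrow> s \<in> A" and u: "0 < u"
  shows "Dop f (cutoff A (Dop b \<phi>)) u = Dop g (cutoff C (Dop d \<phi>)) u"
proof -
  have AC': "s \<in> A \<or> s \<in> C" if "-T \<le> s" "s \<le> T" for s using AC that by auto
  have A: "s \<in> A \<Longrightarrow> -T \<le> s \<and> s \<le> 0" and C: "s \<in> C \<Longrightarrow> 0 \<le> s \<and> s \<le> T" for s using AC by auto
  have \<phi>A: "-T \<le> s \<and> s \<le> 0" if "\<phi> s \<noteq> 0" for s by (rule A[OF \<phi>(2)[OF that]])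
  define X where "X s = Dop b \<phi> s - cutoff A (Dop b \<phi>) s" for s
  define Y where "Y s = Dop d \<phi> s - cutoff C (Dop d \<phi>) s" for s
  have X: "- 2 * T \<le> s \<and> s \<le> - T" if "X s \<noteq> 0" for s
  proof -
    have s: "s \<notin> A" "conv b \<phi> s \<noteq> 0"
      using that \<phi>(2)[of s] by (auto simp: X_def cutoff_def Dop_def split: if_splits)
    then have "-T + -T < s \<and> s < 0 + 0"
      using conv_outside[OF supp(4) \<phi>A, where u = s] by (meson not_le)
    then show ?thesis using s(1) AC'[of s] C[of s] T by force
  qed
  have Y: "- T \<le> s \<and> s \<le> 0" if "Y s \<noteq> 0" for s
  proof (cases "\<phi> s = 0")
    case True
    have s: "s \<notin> C" "conv d \<phi> s \<noteq> 0"
      using that True by (auto simp: Y_def cutoff_def Dop_def split: if_splits)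
    then have "-T + 0 < s \<and> s < 0 + T"
      using conv_outside[OF supp(2) \<phi>A, where u = s] by (meson not_le)
    then show ?thesis using s(1) AC'[of s] A[of s] by force
  qed (rule \<phi>A)
  have "Dop f X u = 0"
    unfolding Dop_def using X[of u] u T conv_outside[OF supp(1) X, where u = u] by force
  moreover have "Dop g Y u = 0"
    unfolding Dop_def using Y[of u] u T conv_outside[OF supp(3) Y, where u = u] by force
  ultimately show ?thesis
    unfolding X_def[abs_def] Y_def[abs_def] using bcs \<phi>(1) AC_borel FB_GD[OF \<phi>(1), of u]
    by (simp add: Dop_diff lcs_Dop lcs_cutoff)
qed

end

context resultant_data
begin

interpretation M: resultant_data T "\<lambda>x. g (- x)" "\<lambda>x. f (- x)" "\<lambda>x. d (- x)" "\<lambda>x. b (- x)"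
  "\<lambda>x. n (- x)" "uminus ` C" "uminus ` A"
  by (rule mirror)

lemma B_inv_op_eq:
  assumes u: "u < 0" "u \<in> A" and \<phi>: "lcs \<phi>"
  shows "Dop b (inv_op \<phi>) u = \<phi> u"
proof -
  have cut_minus: "cutoff S (\<lambda>x. - \<psi> x) = (\<lambda>x. - cutoff S \<psi> x)" for S and \<psi> :: "real \<Rightarrow> complex^'r^'r"
    by (auto simp: cutoff_def)
  have Dop_minus: "Dop c (\<lambda>x. - \<psi> x) = (\<lambda>x. - Dop c \<psi> x)" for c and \<psi> :: "real \<Rightarrow> complex^'r^'r"
    by (auto simp: Dop_def conv_minus_right)
  \<comment> \<open>Reflection swaps the two terms of \<open>om\<close>, hence the minus sign. The
    two terms of \<open>inv_op\<close> are swapped as well, so there the signs cancel.\<close>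
  have om: "M.om (\<lambda>x. \<phi> (- x)) = (\<lambda>x. - om \<phi> (- x))"
    unfolding M.om_def[abs_def] om_def cutoff_mirror[of C \<phi>] cutoff_mirror[of A \<phi>]
      Dop_mirror_fun[of g "cutoff C \<phi>"] Dop_mirror_fun[of f "cutoff A \<phi>"] by auto
  have "M.inv_op (\<lambda>x. \<phi> (- x)) = (\<lambda>x. inv_op \<phi> (- x))"
    unfolding M.inv_op_def[abs_def] om inv_op_def
      cutoff_mirror[of C "\<lambda>x. - om \<phi> x"] Dop_mirror_fun[of n "cutoff C (\<lambda>x. - om \<phi> x)"]
      cutoff_mirror[of C "Dop n (cutoff C (\<lambda>x. - om \<phi> x))"]
      cutoff_mirror[of A "\<lambda>x. - om \<phi> x"] Dop_mirror_fun[of n "cutoff A (\<lambda>x. - om \<phi> x)"]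
      cutoff_mirror[of A "Dop n (cutoff A (\<lambda>x. - om \<phi> x))"]
    by (simp add: cut_minus Dop_minus)
  moreover have "Dop (\<lambda>x. b (- x)) (M.inv_op (\<lambda>x. \<phi> (- x))) (- u) = \<phi> (- (- u))"
    by (rule M.D_inv_op_eq) (use u \<phi> in \<open>auto intro: lcs_mirror\<close>)
  ultimately show ?thesis by (simp add: Dop_mirror_fun)
qed

lemma half_cancel_left:
  fixes \<phi> :: "real \<Rightarrow> complex^'r^'r"
  assumes \<phi>: "lcs \<phi>" "\<And>s. \<phi> s \<noteq> 0 \<Longrightarrow> s \<in> C" and u: "u < 0"
  shows "Dop f (cutoff A (Dop b \<phi>)) u = Dop g (cutoff C (Dop d \<phi>)) u"
proof -
  have "s \<in> uminus ` C" if "\<phi> (- s) \<noteq> 0" for s using \<phi>(2)[OF that] by force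
  from M.half_cancel[OF lcs_mirror[OF \<phi>(1)] this, of "- u"] show ?thesis
    using u by (simp add: Dop_mirror_fun[of _ \<phi>] cutoff_mirror[of _ "Dop _ \<phi>"]
        Dop_mirror[of _ "cutoff _ (Dop _ \<phi>)"])
qed

lemma integrable_tail:
  assumes "lcs \<phi>" shows "integrable lborel (\<lambda>s. indicator {u<..} s * norm (\<phi> s))"
  using integrable_mult_indicator[OF _ integrable_norm[OF lcs_integrable[OF assms]], of "{u<..}"] by simp

text \<open>The identity \<open>FB_GD\<close> relates the restrictions of \<open>Dop b\<close> and
  \<open>Dop d\<close> of the left part of \<open>\<phi>\<close>. Multiplication by
  \<open>1 + n\<close> makes this relation triangular, so that the value of the left part at
  \<open>u\<close> is controlled by its values after \<open>u\<close>; \<open>tail_gronwall\<close>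
  concludes.\<close>

lemma inj_left:
  fixes \<phi> :: "real \<Rightarrow> complex^'r^'r"
  assumes \<phi>: "lcs \<phi>"
    and zb: "AE u in lborel. u \<in> A \<longrightarrow> Dop b \<phi> u = 0"
    and zd: "AE u in lborel. u \<in> C \<longrightarrow> Dop d \<phi> u = 0"
    and sup: "\<And>u. u \<notin> {-T..T} \<Longrightarrow> \<phi> u = 0"
  shows "AE u in lborel. u \<in> A \<longrightarrow> \<phi> u = 0"
proof -
  have A: "s \<in> A \<Longrightarrow> -T \<le> s \<and> s \<le> 0" and C: "s \<in> C \<Longrightarrow> 0 \<le> s \<and> s \<le> T" for s using AC by auto
  have disj: "s \<in> A \<Longrightarrow> s \<notin> C" for s using AC by auto
  have AC': "s \<in> A \<or> s \<in> C" if "-T \<le> s" "s \<le> T" for s using AC that by auto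
  define \<phi>1 where "\<phi>1 = cutoff A \<phi>"
  define \<phi>2 where "\<phi>2 = cutoff C \<phi>"
  have l: "lcs \<phi>1" "lcs \<phi>2" unfolding \<phi>1_def \<phi>2_def using \<phi> AC_borel by (auto intro: lcs_cutoff)
  have \<phi>_eq: "\<phi> = (\<lambda>x. \<phi>1 x + \<phi>2 x)"
    using sup AC' disj by (auto simp: \<phi>1_def \<phi>2_def cutoff_def fun_eq_iff)
  have p1: "\<phi>1 s \<noteq> 0 \<Longrightarrow> s \<in> A" and p2: "\<phi>2 s \<noteq> 0 \<Longrightarrow> s \<in> C" for s
    by (auto simp: \<phi>1_def \<phi>2_def cutoff_def split: if_splits)
  define \<xi> where "\<xi> = cutoff A (Dop b \<phi>1)"
  define \<zeta> where "\<zeta> = cutoff C (Dop d \<phi>1)"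
  define \<xi>' where "\<xi>' = cutoff A (Dop b \<phi>2)"
  define \<zeta>' where "\<zeta>' = cutoff C (Dop d \<phi>2)"
  have l2: "lcs \<xi>" "lcs \<zeta>" "lcs \<xi>'" "lcs \<zeta>'"
    unfolding \<xi>_def \<zeta>_def \<xi>'_def \<zeta>'_def using l bcs AC_borel by (auto intro!: lcs_cutoff lcs_Dop)
  have eq\<xi>: "AE u in lborel. \<xi> u = - \<xi>' u" using zb
    by eventually_elim (use bcs l in \<open>auto simp: \<xi>_def \<xi>'_def \<phi>_eq cutoff_def Dop_add eq_neg_iff_add_eq_0\<close>)
  have eq\<zeta>: "AE u in lborel. \<zeta> u = - \<zeta>' u" using zd
    by eventually_elim (use bcs l in \<open>auto simp: \<zeta>_def \<zeta>'_def \<phi>_eq cutoff_def Dop_add eq_neg_iff_add_eq_0\<close>)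
  \<comment> \<open>To the right of 0 this vanishes by \<open>half_cancel\<close> for
    \<open>\<phi>1\<close>. To the left, membership of \<open>\<phi>\<close> in the kernel of the
    operator allows \<open>\<xi>\<close> and \<open>\<zeta>\<close> to be replaced by
    \<open>- \<xi>'\<close> and \<open>- \<zeta>'\<close>, and \<open>half_cancel_left\<close> for
    \<open>\<phi>2\<close> applies.\<close>
  define \<theta> where "\<theta> u = Dop f \<xi> u - Dop g \<zeta> u" for u
  have \<theta>_right: "\<theta> u = 0" if "0 < u" for u
    using half_cancel[OF l(1) p1 that] by (simp add: \<theta>_def \<xi>_def \<zeta>_def)
  have \<theta>_left: "Dop f \<xi>' u - Dop g \<zeta>' u = 0" if "u < 0" for u
    using half_cancel_left[OF l(2) p2 that] by (simp add: \<xi>'_def \<zeta>'_def)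
  have neg: "Dop c (\<lambda>x. - \<psi> x) u = - Dop c \<psi> u" for c u and \<psi> :: "real \<Rightarrow> complex^'r^'r"
    by (simp add: Dop_def conv_minus_right)
  have \<theta>_zero: "AE u in lborel. \<theta> u = 0"
  proof -
    have "AE u in lborel. Dop f \<xi> u = Dop f (\<lambda>x. - \<xi>' x) u"
      using l2 bcs eq\<xi> by (intro Dop_cong_AE) (auto intro: lcs_measurable bcs_measurable)
    moreover have "AE u in lborel. Dop g \<zeta> u = Dop g (\<lambda>x. - \<zeta>' x) u"
      using l2 bcs eq\<zeta> by (intro Dop_cong_AE) (auto intro: lcs_measurable bcs_measurable)
    ultimately show ?thesis
      using AE_lborel_singleton[of 0]
    proof eventually_elim
      case (elim u)
      show ?case
      proof (cases "0 < u")
        case False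
        then have "Dop f \<xi>' u - Dop g \<zeta>' u = 0" using elim(3) by (intro \<theta>_left) auto
        then show ?thesis using elim(1,2) by (simp add: \<theta>_def neg)
      qed (rule \<theta>_right)
    qed
  qed
  \<comment> \<open>Composition with \<open>1 + n\<close> replaces \<open>f\<close>, which looks
    into the past, by \<open>NF\<close>, which up to lag \<open>T\<close> looks only into the
    future.\<close>
  have "AE u in lborel. Dop n (Dop f \<xi>) u = Dop n (Dop g \<zeta>) u"
    using \<theta>_zero bcs(5) lcs_measurable[OF lcs_Dop[OF bcs(1) l2(1)]]
      lcs_measurable[OF lcs_Dop[OF bcs(2) l2(2)]]
    by (intro Dop_cong_AE) (auto intro: bcs_measurable simp: \<theta>_def)
  then have main: "AE u in lborel. Dop NF \<xi> u = Dop NG \<zeta> u"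
    using bcs l2 by (simp add: Dop_Dop)
  obtain S1 where S1: "S1 \<ge> 0" "\<And>x. norm (b x) \<le> S1" using bcs(3) by (rule bcsE) blast
  obtain S2 where S2: "S2 \<ge> 0" "\<And>x. norm (d x) \<le> S2" using bcs(4) by (rule bcsE) blast
  obtain S3 where S3: "S3 \<ge> 0" "\<And>x. norm (NF x) \<le> S3" using bcs_prods(2) by (rule bcsE) blast
  obtain S4 where S4: "S4 \<ge> 0" "\<And>x. norm (NG x) \<le> S4" using bcs_prods(3) by (rule bcsE) blast
  define m where "m u = (LINT s|lborel. indicator {u<..} s * norm (\<phi>1 s))" for u
  note it = integrable_tail[OF l(1)]
  have m0: "m u \<ge> 0" for u unfolding m_def by (intro Bochner_Integration.integral_nonneg) auto
  have mono: "m s \<le> m u" if "u \<le> s" for u s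
    unfolding m_def using it that by (intro integral_mono) (auto simp: indicator_def)
  have cb: "norm (conv b \<phi>1 u) \<le> S1 * m u" for u
    unfolding m_def
  proof (rule conv_norm_le[OF bcs(3) lcs_integrable[OF l(1)] it S1(2)])
    fix s assume "s \<noteq> u" "b (u - s) \<noteq> 0"
    then show "norm (\<phi>1 s) \<le> indicator {u<..} s * norm (\<phi>1 s)" using supp(4)[of "u - s"] by auto
  qed auto
  \<comment> \<open>The kernel \<open>d\<close> reaches back by at most \<open>T\<close>, so beyond
    \<open>v + T\<close> it sees only values of \<open>\<phi>1\<close> after
    \<open>v\<close>.\<close>
  have cd: "norm (conv d \<phi>1 u) \<le> S2 * m v" if "v < u - T" for u v
    unfolding m_def
  proof (rule conv_norm_le[OF bcs(4) lcs_integrable[OF l(1)] it S2(2)])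
    fix s assume "s \<noteq> u" "d (u - s) \<noteq> 0"
    then show "norm (\<phi>1 s) \<le> indicator {v<..} s * norm (\<phi>1 s)" using supp(2)[of "u - s"] that by auto
  qed auto
  have icc: "integrable lborel (\<lambda>s. c * indicator {v..T} s)" "(LINT s|lborel. c * indicator {v..T} s) \<le> c * (2 * T)"
    if "-T \<le> v" "c \<ge> 0" for c v :: real
    using that T by (cases "v \<le> T"; auto intro!: mult_left_mono)+
  have c\<xi>: "norm (conv NF \<xi> u) \<le> S3 * (m u + S1 * m u * (2 * T))" if u: "u \<in> A" for u
  proof -
    have i2: "integrable lborel (\<lambda>s. indicator {u<..} s * norm (\<phi>1 s) + S1 * m u * indicator {u..T} s)"
      using it icc(1)[of u "S1 * m u"] A[OF u] S1 m0[of u] by (intro Bochner_Integration.integrable_add) auto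
    have "norm (conv NF \<xi> u) \<le> S3 * (LINT s|lborel. indicator {u<..} s * norm (\<phi>1 s) + S1 * m u * indicator {u..T} s)"
    proof (rule conv_norm_le[OF bcs_prods(2) lcs_integrable[OF l2(1)] i2 S3(2)])
      show "0 \<le> indicator {u<..} s * norm (\<phi>1 s) + S1 * m u * indicator {u..T} s" for s
        using S1 m0 by simp
      fix s assume s: "s \<noteq> u" "NF (u - s) \<noteq> 0"
      show "norm (\<xi> s) \<le> indicator {u<..} s * norm (\<phi>1 s) + S1 * m u * indicator {u..T} s"
      proof (cases "s \<in> A")
        case True
        \<comment> \<open>Both points lie in \<open>A\<close>, so their distance is at most
          \<open>T\<close>, and \<open>NF\<close> vanishes at lags in \<open>(0, T]\<close>.\<close>
        then have us: "u < s" using s nf[of "u - s"] A[OF u] A[of s] by force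
        have "norm (\<xi> s) \<le> norm (\<phi>1 s) + norm (conv b \<phi>1 s)"
          using True by (simp add: \<xi>_def cutoff_def Dop_def norm_triangle_ineq)
        also have "\<dots> \<le> norm (\<phi>1 s) + S1 * m u"
          using cb[of s] mult_left_mono[OF mono[of u s] S1(1)] us by simp
        finally show ?thesis using us A[OF True] T by simp
      qed (use S1 m0[of u] in \<open>simp add: \<xi>_def cutoff_def\<close>)
    qed
    also have "(LINT s|lborel. indicator {u<..} s * norm (\<phi>1 s) + S1 * m u * indicator {u..T} s)
        = m u + (LINT s|lborel. S1 * m u * indicator {u..T} s)"
      unfolding m_def[of u, symmetric] using it icc(1)[of u "S1 * m u"] A[OF u] S1 m0[of u]
      by (subst Bochner_Integration.integral_add) (auto simp: m_def)
    also have "\<dots> \<le> m u + S1 * m u * (2 * T)"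
      using icc(2)[of u "S1 * m u"] A[OF u] S1 m0[of u] by simp
    finally show ?thesis using S3(1) by (simp add: mult_left_mono)
  qed
  have c\<zeta>: "norm (conv NG \<zeta> u) \<le> S4 * (S2 * m u * (2 * T))" if u: "u \<in> A" for u
  proof -
    have i2: "integrable lborel (\<lambda>s. S2 * m u * indicator {u..T} s)"
      using icc(1)[of u "S2 * m u"] A[OF u] S2 m0[of u] by auto
    have "norm (conv NG \<zeta> u) \<le> S4 * (LINT s|lborel. S2 * m u * indicator {u..T} s)"
    proof (rule conv_norm_le[OF bcs_prods(3) lcs_integrable[OF l2(2)] i2 S4(2)])
      show "0 \<le> S2 * m u * indicator {u..T} s" for s using S2 m0 by simp
      fix s assume s: "s \<noteq> u" "NG (u - s) \<noteq> 0"
      show "norm (\<zeta> s) \<le> S2 * m u * indicator {u..T} s"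
      proof (cases "s \<in> C")
        case True
        \<comment> \<open>Since \<open>s\<close> is to the right of \<open>u\<close> and
          \<open>NG\<close> vanishes at lags in \<open>[-T, 0)\<close>, the distance exceeds
          \<open>T\<close>. This compensates exactly the reach of \<open>d\<close> in
          \<open>cd\<close>.\<close>
        then have us: "u < s - T" using s ng[of "u - s"] A[OF u] C[OF True] by force
        have "\<phi>1 s = 0" using p1[of s] True disj by auto
        then have "norm (\<zeta> s) = norm (conv d \<phi>1 s)"
          using True by (simp add: \<zeta>_def cutoff_def Dop_def)
        also have "\<dots> \<le> S2 * m u" using cd[OF us] .
        finally show ?thesis using us C[OF True] T by simp
      qed (use S2 m0[of u] in \<open>simp add: \<zeta>_def cutoff_def\<close>)
    qed
    also have "\<dots> \<le> S4 * (S2 * m u * (2 * T))"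
      using icc(2)[of u "S2 * m u"] A[OF u] S2 S4 m0[of u] by (intro mult_left_mono) auto
    finally show ?thesis .
  qed
  \<comment> \<open>Collects the bounds of \<open>conv b \<phi>1\<close>,
    \<open>conv NF \<xi>\<close> and \<open>conv NG \<zeta>\<close>; the factor \<open>2 * T\<close>
    bounds the length of \<open>[u, T]\<close>, and the last summand makes \<open>K\<close>
    positive.\<close>
  define K where "K = S1 + S3 * (1 + S1 * (2 * T)) + S4 * (S2 * (2 * T)) + 1"
  have "AE u in lborel. norm (\<phi>1 u) \<le> K * (LINT s|lborel. indicator {u<..} s * norm (\<phi>1 s))"
    using main
  proof eventually_elim
    case (elim u)
    show ?case
    proof (cases "u \<in> A")
      case True
      have "Dop NG \<zeta> u = conv NG \<zeta> u" using disj[OF True] by (simp add: Dop_def \<zeta>_def cutoff_def)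
      moreover have "Dop NF \<xi> u = \<phi>1 u + conv b \<phi>1 u + conv NF \<xi> u"
        using True by (simp add: Dop_def[of NF]) (simp add: \<xi>_def cutoff_def Dop_def)
      ultimately have "\<phi>1 u = conv NG \<zeta> u - conv b \<phi>1 u - conv NF \<xi> u"
        using elim by (simp add: algebra_simps)
      then have "norm (\<phi>1 u) \<le> norm (conv NG \<zeta> u) + norm (conv b \<phi>1 u) + norm (conv NF \<xi> u)"
        using norm_triangle_ineq4[of "conv NG \<zeta> u - conv b \<phi>1 u" "conv NF \<xi> u"]
          norm_triangle_ineq4[of "conv NG \<zeta> u" "conv b \<phi>1 u"] by simp
      also have "\<dots> \<le> S4 * (S2 * m u * (2 * T)) + S1 * m u + S3 * (m u + S1 * m u * (2 * T))"
        by (intro add_mono c\<xi> c\<zeta> cb True)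
      also have "\<dots> \<le> K * m u" using m0[of u] by (simp add: K_def algebra_simps)
      finally show ?thesis by (simp add: m_def)
    next
      case False
      then have "\<phi>1 u = 0" using p1 by blast
      moreover have "0 \<le> K" unfolding K_def using S1(1) S2(1) S3(1) S4(1) T by (simp add: )
      ultimately show ?thesis using m0[of u] by (simp add: m_def)
    qed
  qed
  then have "AE u in lborel. norm (\<phi>1 u) = 0"
  proof (rule tail_gronwall[rotated -1])
    show "integrable lborel (\<lambda>u. norm (\<phi>1 u))" using lcs_integrable[OF l(1)] by simp
    show "norm (\<phi>1 u) = 0" if "0 < u" for u using p1[of u] A[of u] that by auto
    show "K > 0" unfolding K_def using S1(1) S2(1) S3(1) S4(1) T by (intro add_nonneg_pos) auto
  qed auto
  then show ?thesis by eventually_elim (auto simp: \<phi>1_def cutoff_def)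
qed

end

context resultant_data
begin

interpretation M: resultant_data T "\<lambda>x. g (- x)" "\<lambda>x. f (- x)" "\<lambda>x. d (- x)" "\<lambda>x. b (- x)"
  "\<lambda>x. n (- x)" "uminus ` C" "uminus ` A"
  by (rule mirror)

lemma inj:
  fixes \<phi> :: "real \<Rightarrow> complex^'r^'r"
  assumes \<phi>: "lcs \<phi>"
    and zb: "AE u in lborel. u \<in> A \<longrightarrow> Dop b \<phi> u = 0"
    and zd: "AE u in lborel. u \<in> C \<longrightarrow> Dop d \<phi> u = 0"
    and sup: "\<And>u. u \<notin> {-T..T} \<Longrightarrow> \<phi> u = 0"
  shows "AE u in lborel. \<phi> u = 0"
proof -
  have flip: "AE u in lborel. P (- u)" if "AE u in lborel. P u" "Measurable.pred borel P" for P :: "real \<Rightarrow> bool"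
    using AE_borel_affine[of "-1" P 0] that by simp
  have img: "x \<in> uminus ` S \<longleftrightarrow> - x \<in> S" for x :: real and S by force
  note [measurable] = AC_borel lcs_measurable[OF \<phi>] lcs_measurable[OF lcs_Dop[OF bcs(3) \<phi>]]
    lcs_measurable[OF lcs_Dop[OF bcs(4) \<phi>]]
  have 1: "AE u in lborel. u \<in> A \<longrightarrow> \<phi> u = 0" by (rule inj_left[OF assms])
  have "AE u in lborel. u \<in> uminus ` C \<longrightarrow> \<phi> (- u) = 0"
  proof (rule M.inj_left)
    show "lcs (\<lambda>x. \<phi> (- x))" using \<phi> by (rule lcs_mirror)
    show "AE u in lborel. u \<in> uminus ` C \<longrightarrow> Dop (\<lambda>x. d (- x)) (\<lambda>x. \<phi> (- x)) u = 0"
      unfolding Dop_mirror img by (rule flip[OF zd]) measurable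
    show "AE u in lborel. u \<in> uminus ` A \<longrightarrow> Dop (\<lambda>x. b (- x)) (\<lambda>x. \<phi> (- x)) u = 0"
      unfolding Dop_mirror img by (rule flip[OF zb]) measurable
    show "\<phi> (- u) = 0" if "u \<notin> {-T..T}" for u using sup[of "- u"] that by auto
  qed
  then have "AE u in lborel. - u \<in> uminus ` C \<longrightarrow> \<phi> (- (- u)) = 0"
    unfolding img by (rule flip) measurable
  then have 2: "AE u in lborel. u \<in> C \<longrightarrow> \<phi> u = 0" unfolding img by simp
  show ?thesis using 1 2 by eventually_elim (use sup AC(1) in blast)
qed

end

section \<open>Boundedness of the operators in the integral norm\<close>

lemma set_integrable_iff_cutoff: "set_integrable lborel S \<phi> \<longleftrightarrow> integrable lborel (cutoff S \<phi>)"
  by (simp add: set_integrable_def cutoff_eq_indicator)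

lemma set_integral_eq_cutoff: "(LINT x:S|lborel. \<phi> x) = (LINT x|lborel. cutoff S \<phi> x)"
  by (simp add: set_lebesgue_integral_def cutoff_eq_indicator)

lemma L1_iff_lcs: "\<phi> \<in> L1 {a..b} \<longleftrightarrow> lcs (cutoff {a..b} \<phi>)"
proof -
  have "\<forall>x. max \<bar>a\<bar> \<bar>b\<bar> < \<bar>x\<bar> \<longrightarrow> cutoff {a..b} \<phi> x = 0" by (auto simp: cutoff_def)
  then have "\<exists>S. \<forall>x. S < \<bar>x\<bar> \<longrightarrow> cutoff {a..b} \<phi> x = 0" by blast
  then show ?thesis unfolding L1_def lcs_def by (simp add: set_integrable_iff_cutoff)
qed

lemma L1_norm_eq: "L1_norm S \<phi> = (LINT x|lborel. norm (cutoff S \<phi> x))"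
  unfolding L1_norm_def set_lebesgue_integral_def
  by (rule Bochner_Integration.integral_cong) (auto simp: cutoff_def indicator_def)

lemma Dop_L1_bound:
  fixes c :: "real \<Rightarrow> complex^'r^'r"
  assumes c: "bcs c" and T: "T > 0"
  obtains K where "K \<ge> 0" "\<And>\<phi> :: real \<Rightarrow> complex^'k^'r. lcs \<phi> \<Longrightarrow>
      (LINT x|lborel. norm (cutoff {-T..T} (Dop c \<phi>) x)) \<le> K * (LINT x|lborel. norm (\<phi> x))"
proof -
  obtain S where S: "S \<ge> 0" "\<And>x. norm (c x) \<le> S" using c by (rule bcsE) blast
  \<comment> \<open>The convolution is bounded by \<open>S\<close> times the integral norm of
    \<open>\<phi>\<close>, and it is integrated over an interval of length
    \<open>2 * T\<close>.\<close>
  show ?thesis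
  proof (rule that[of "1 + 2 * T * S"])
    fix \<phi> :: "real \<Rightarrow> complex^'k^'r" assume \<phi>: "lcs \<phi>"
    note i = lcs_integrable[OF \<phi>]
    define I where "I = (LINT x|lborel. norm (\<phi> x))"
    have le: "norm (conv c \<phi> u) \<le> S * I" for u
      unfolding I_def by (rule conv_norm_le[OF c i _ S(2)]) (use i in auto)
    have "(LINT x|lborel. norm (cutoff {-T..T} (Dop c \<phi>) x))
        \<le> (LINT x|lborel. norm (\<phi> x) + S * I * indicator {-T..T} x)"
    proof (rule integral_mono)
      show "integrable lborel (\<lambda>x. norm (cutoff {-T..T} (Dop c \<phi>) x))"
        using lcs_integrable[OF lcs_cutoff[OF _ lcs_Dop[OF c \<phi>], of "{-T..T}"]] by simp
      show "integrable lborel (\<lambda>x. norm (\<phi> x) + S * I * indicator {- T..T} x)" using i T by simp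
      show "norm (cutoff {-T..T} (Dop c \<phi>) x) \<le> norm (\<phi> x) + S * I * indicator {-T..T} x" for x
        using le[of x] norm_triangle_ineq[of "\<phi> x" "conv c \<phi> x"] by (auto simp: cutoff_def Dop_def)
    qed
    also have "\<dots> = (1 + 2 * T * S) * I" using i T by (simp add: I_def algebra_simps)
    finally show "(LINT x|lborel. norm (cutoff {-T..T} (Dop c \<phi>) x))
        \<le> (1 + 2 * T * S) * (LINT x|lborel. norm (\<phi> x))" by (simp add: I_def)
  qed (use S T in simp)
qed

lemma norm_cutoff_mono:
  fixes \<phi> :: "real \<Rightarrow> 'v::{banach, second_countable_topology}"
  assumes "lcs \<phi>" "A \<subseteq> B" "A \<in> sets borel" "B \<in> sets borel"
  shows "(LINT x|lborel. norm (cutoff A \<phi> x)) \<le> (LINT x|lborel. norm (cutoff B \<phi> x))"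
proof (rule integral_mono)
  show "norm (cutoff A \<phi> x) \<le> norm (cutoff B \<phi> x)" for x using assms(2) by (auto simp: cutoff_def)
qed (use lcs_integrable[OF lcs_cutoff[OF assms(3,1)]] lcs_integrable[OF lcs_cutoff[OF assms(4,1)]] in auto)

text \<open>Passes from representatives with arbitrary values off the interval to their zero
  extensions: all estimates are made for \<open>Q\<close> on \<open>lcs\<close> functions, and
  \<open>R\<close> depends on its argument through the cutoff alone.\<close>

lemma bounded_L1_operatorI:
  fixes Q :: "(real \<Rightarrow> 'v::{banach, second_countable_topology}) \<Rightarrow> real \<Rightarrow> 'v"
  assumes lcs: "\<And>\<phi>. lcs \<phi> \<Longrightarrow> lcs (cutoff {a..b} (Q \<phi>))"
    and lin: "\<And>\<phi> \<psi> r u. lcs \<phi> \<Longrightarrow> lcs \<psi> \<Longrightarrow> u \<in> {a..b} \<Longrightarrow> Q (\<lambda>x. r *\<^sub>R \<phi> x + \<psi> x) u = r *\<^sub>R Q \<phi> u + Q \<psi> u"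
    and bd: "\<And>\<phi>. lcs \<phi> \<Longrightarrow>
      (LINT x|lborel. norm (cutoff {a..b} (Q \<phi>) x)) \<le> K * (LINT x|lborel. norm (\<phi> x))"
    and R: "\<And>\<phi> u. u \<in> {a..b} \<Longrightarrow> R \<phi> u = Q (cutoff {a..b} \<phi>) u"
  shows "bounded_L1_operator {a..b} R"
proof -
  have cR: "cutoff {a..b} (R \<phi>) = cutoff {a..b} (Q (cutoff {a..b} \<phi>))" for \<phi>
    using R by (auto simp: cutoff_def)
  have cl: "cutoff {a..b} (\<lambda>y. r *\<^sub>R \<phi> y + \<psi> y) = (\<lambda>x. r *\<^sub>R cutoff {a..b} \<phi> x + cutoff {a..b} \<psi> x)"
    for r and \<phi> \<psi> :: "real \<Rightarrow> 'v" by (auto simp: cutoff_def)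
  show ?thesis
    unfolding bounded_L1_operator_def L1_iff_lcs L1_norm_eq cR Ball_def
    using lcs bd by (auto simp: R cl lin intro!: exI[of _ K])
qed

context resultant_data
begin

lemma om_scaleR: "om (\<lambda>x. r *\<^sub>R \<phi> x) = (\<lambda>x. r *\<^sub>R om \<phi> x)"
proof -
  have "cutoff S (\<lambda>x. r *\<^sub>R \<phi> x) = (\<lambda>x. r *\<^sub>R cutoff S \<phi> x)" for S by (auto simp: cutoff_def)
  then show ?thesis unfolding om_def[abs_def] by (simp add: Dop_scaleR scaleR_diff_right)
qed

lemma inv_op_scaleR: "inv_op (\<lambda>x. r *\<^sub>R \<phi> x) = (\<lambda>x. r *\<^sub>R inv_op \<phi> x)"
proof -
  have c: "cutoff S (\<lambda>x. r *\<^sub>R \<psi> x) = (\<lambda>x. r *\<^sub>R cutoff S \<psi> x)" for S and \<psi> :: "real \<Rightarrow> complex^'r^'r"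
    by (auto simp: cutoff_def)
  have "Dop n (\<lambda>x. r *\<^sub>R \<psi> x) = (\<lambda>x. r *\<^sub>R Dop n \<psi> x)" for \<psi> :: "real \<Rightarrow> complex^'r^'r"
    by (simp add: Dop_scaleR fun_eq_iff)
  then show ?thesis unfolding inv_op_def[abs_def] om_scaleR c by (simp add: c scaleR_diff_right)
qed

lemma inv_op_L1_bound:
  obtains K where "\<And>\<phi>. lcs \<phi> \<Longrightarrow>
      (LINT x|lborel. norm (cutoff {-T..T} (inv_op \<phi>) x)) \<le> K * (LINT x|lborel. norm (\<phi> x))"
proof -
  let ?N = "\<lambda>\<phi> :: real \<Rightarrow> complex^'r^'r. LINT x|lborel. norm (\<phi> x)"
  have triangle: "?N (cutoff {-T..T} (\<lambda>x. \<phi> x - \<psi> x)) \<le> ?N (cutoff {-T..T} \<phi>) + ?N (cutoff {-T..T} \<psi>)"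
    if "lcs \<phi>" "lcs \<psi>" for \<phi> \<psi>
  proof -
    note i = lcs_integrable[OF lcs_cutoff[OF _ that(1), of "{-T..T}"]] lcs_integrable[OF lcs_cutoff[OF _ that(2), of "{-T..T}"]]
    have "?N (cutoff {-T..T} (\<lambda>x. \<phi> x - \<psi> x)) \<le> (LINT x|lborel. norm (cutoff {-T..T} \<phi> x) + norm (cutoff {-T..T} \<psi> x))"
      unfolding cutoff_diff using i by (intro integral_mono norm_triangle_ineq4) auto
    also have "\<dots> = ?N (cutoff {-T..T} \<phi>) + ?N (cutoff {-T..T} \<psi>)" using i by simp
    finally show ?thesis .
  qed
  have cc: "?N (cutoff A \<phi>) \<le> ?N \<phi>" "?N (cutoff C \<phi>) \<le> ?N \<phi>" if "lcs \<phi>" for \<phi>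
    using norm_cutoff_mono[OF that, of _ UNIV] AC_borel by (auto simp: cutoff_def[of UNIV])
  obtain Kf where Kf: "Kf \<ge> 0" "\<And>\<phi> :: real \<Rightarrow> complex^'r^'r. lcs \<phi> \<Longrightarrow> ?N (cutoff {-T..T} (Dop f \<phi>)) \<le> Kf * ?N \<phi>"
    using Dop_L1_bound[OF bcs(1) T] by blast
  obtain Kg where Kg: "Kg \<ge> 0" "\<And>\<phi> :: real \<Rightarrow> complex^'r^'r. lcs \<phi> \<Longrightarrow> ?N (cutoff {-T..T} (Dop g \<phi>)) \<le> Kg * ?N \<phi>"
    using Dop_L1_bound[OF bcs(2) T] by blast
  obtain Kn where Kn: "Kn \<ge> 0" "\<And>\<phi> :: real \<Rightarrow> complex^'r^'r. lcs \<phi> \<Longrightarrow> ?N (cutoff {-T..T} (Dop n \<phi>)) \<le> Kn * ?N \<phi>"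
    using Dop_L1_bound[OF bcs(5) T] by blast
  show ?thesis
  proof (rule that)
    fix \<phi> :: "real \<Rightarrow> complex^'r^'r" assume \<phi>: "lcs \<phi>"
    note l = lcs_cutoff[OF AC_borel(1) \<phi>] lcs_cutoff[OF AC_borel(2) \<phi>]
    have "om \<phi> = cutoff {-T..T} (\<lambda>x. Dop f (cutoff A \<phi>) x - Dop g (cutoff C \<phi>) x)"
      using om_supp[of _ \<phi>]
      by (simp add: cutoff_def[of "{-T..T}"] om_def fun_eq_iff del: atLeastAtMost_iff)
    then have "?N (om \<phi>) \<le> ?N (cutoff {-T..T} (Dop f (cutoff A \<phi>))) + ?N (cutoff {-T..T} (Dop g (cutoff C \<phi>)))"
      using triangle[of "Dop f (cutoff A \<phi>)" "Dop g (cutoff C \<phi>)"] l bcs by (simp add: lcs_Dop)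
    also have "\<dots> \<le> Kf * ?N (cutoff A \<phi>) + Kg * ?N (cutoff C \<phi>)" using Kf Kg l by (intro add_mono) auto
    also have "\<dots> \<le> Kf * ?N \<phi> + Kg * ?N \<phi>" using Kf Kg cc[OF \<phi>] by (intro add_mono mult_left_mono) auto
    finally have om: "?N (om \<phi>) \<le> (Kf + Kg) * ?N \<phi>" by (simp add: algebra_simps)
    have piece: "?N (cutoff {-T..T} (cutoff S (Dop n (cutoff S (om \<phi>))))) \<le> Kn * ?N (om \<phi>)"
      if S: "S = A \<or> S = C" for S
    proof -
      have Sb: "S \<in> sets borel" and ST: "S \<subseteq> {-T..T}" using S AC_borel AC by auto
      have l: "lcs (Dop n (cutoff S (om \<phi>)))" using Sb bcs \<phi> by (intro lcs_Dop lcs_cutoff lcs_om)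
      have "cutoff {-T..T} (cutoff S (Dop n (cutoff S (om \<phi>)))) = cutoff S (Dop n (cutoff S (om \<phi>)))"
        using ST by (auto simp: cutoff_def fun_eq_iff subset_eq)
      then have "?N (cutoff {-T..T} (cutoff S (Dop n (cutoff S (om \<phi>)))))
          \<le> ?N (cutoff {-T..T} (Dop n (cutoff S (om \<phi>))))"
        using norm_cutoff_mono[OF l ST Sb] by simp
      also have "\<dots> \<le> Kn * ?N (cutoff S (om \<phi>))" using Sb \<phi> by (intro Kn lcs_cutoff lcs_om)
      also have "\<dots> \<le> Kn * ?N (om \<phi>)" using cc[OF lcs_om[OF \<phi>]] S Kn(1) by (auto intro: mult_left_mono)
      finally show ?thesis .
    qed
    have "?N (cutoff {-T..T} (inv_op \<phi>)) \<le> Kn * ?N (om \<phi>) + Kn * ?N (om \<phi>)"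
      unfolding inv_op_def[abs_def]
      using triangle[of "cutoff A (Dop n (cutoff A (om \<phi>)))" "cutoff C (Dop n (cutoff C (om \<phi>)))"]
        piece[OF disjI1[OF refl]] piece[OF disjI2[OF refl]] \<phi> AC_borel bcs
      by (simp add: lcs_cutoff lcs_Dop lcs_om)
    also have "\<dots> \<le> 2 * Kn * ((Kf + Kg) * ?N \<phi>)" using om Kn(1) by (simp add: mult_left_mono)
    finally show "?N (cutoff {-T..T} (inv_op \<phi>)) \<le> (2 * Kn * (Kf + Kg)) * ?N \<phi>" by (simp add: mult.assoc)
  qed
qed

end

section \<open>The two-sided inverse of the resultant operator\<close>

lemma resultant_eq:
  fixes \<phi> :: "real \<Rightarrow> complex^'r^'r"
  assumes "u \<in> {-T..T}"
  shows "resultant T b d \<phi> u =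
    (if 0 \<le> u then Dop d (cutoff {-T..T} \<phi>) u else Dop b (cutoff {-T..T} \<phi>) u)"
proof -
  have "(LINT s:{-T..T}|lborel. c (u - s) ** \<phi> s) = conv c (cutoff {-T..T} \<phi>) u"
    for c :: "real \<Rightarrow> complex^'r^'r"
    unfolding conv_def set_lebesgue_integral_def
    by (rule Bochner_Integration.integral_cong) (auto simp: cutoff_def indicator_def)
  then show ?thesis using assms by (simp add: resultant_def Dop_def cutoff_def[of _ \<phi> u])
qed

lemma AE_inside_iff:
  fixes T :: real
  shows "(AE x\<in>{-T..T} in lborel. P x) \<longleftrightarrow> (AE x in lborel. x \<in> {-T<..<T} \<and> x \<noteq> 0 \<longrightarrow> P x)"
proof
  assume "AE x\<in>{-T..T} in lborel. P x"
  then show "AE x in lborel. x \<in> {-T<..<T} \<and> x \<noteq> 0 \<longrightarrow> P x" by eventually_elim auto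
next
  assume "AE x in lborel. x \<in> {-T<..<T} \<and> x \<noteq> 0 \<longrightarrow> P x"
  then show "AE x\<in>{-T..T} in lborel. P x"
    using AE_lborel_singleton[of T] AE_lborel_singleton[of "-T"] AE_lborel_singleton[of 0]
    by eventually_elim auto
qed

text \<open>A right inverse of an injective operator is its inverse: if \<open>\<kappa>\<close>
  solves the equation with right side \<open>\<psi>\<close>, then
  \<open>inv_op \<psi> - \<kappa>\<close> lies in the kernel. The second claim is stated separately
  because it is the form in which an accelerant is recovered.\<close>

lemma (in resultant_data) resultant_inverse:
  assumes A: "A = {-T..<0}" and C: "C = {0..T}"
  shows "L1_inverse {-T..T} (resultant T b d) (\<lambda>\<phi>. inv_op (cutoff {-T..T} \<phi>))" (is ?inv)
    and "lcs \<psi> \<Longrightarrow> lcs \<kappa> \<Longrightarrow> (\<And>x. x \<notin> {-T..T} \<Longrightarrow> \<kappa> x = 0) \<Longrightarrow>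
      AE x\<in>{-T..T} in lborel. resultant T b d \<kappa> x = \<psi> x \<Longrightarrow> AE x in lborel. inv_op \<psi> x = \<kappa> x"
proof -
  let ?I = "{-T..T}"
  define R where "R \<phi> u = (if 0 \<le> u then Dop d \<phi> u else Dop b \<phi> u)" for \<phi> :: "real \<Rightarrow> complex^'r^'r" and u
  have R_eq: "R \<phi> = (\<lambda>u. cutoff {0..} (Dop d \<phi>) u + cutoff {..<0} (Dop b \<phi>) u)" for \<phi>
    by (auto simp: R_def cutoff_def)
  have lR: "lcs (R \<phi>)" if "lcs \<phi>" for \<phi>
    unfolding R_eq using that bcs by (intro lcs_add lcs_cutoff lcs_Dop) auto
  have inv_supp: "inv_op \<phi> u = 0" if "u \<notin> ?I" for \<phi> u
  proof -
    have "u \<notin> A" "u \<notin> C" using that A C T by auto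
    then show ?thesis by (simp add: inv_op_def cutoff_def[of _ "Dop n _"])
  qed
  have Rinv: "AE x\<in>?I in lborel. R (inv_op \<phi>) x = \<phi> x" if "lcs \<phi>" for \<phi>
    unfolding AE_inside_iff
  proof (intro AE_I2 impI)
    fix x assume x: "x \<in> {-T<..<T} \<and> x \<noteq> 0"
    show "R (inv_op \<phi>) x = \<phi> x"
    proof (cases "0 < x")
      case True
      then show ?thesis using D_inv_op_eq[of x \<phi>] x that C by (simp add: R_def)
    next
      case False
      then show ?thesis using B_inv_op_eq[of x \<phi>] x that A by (simp add: R_def)
    qed
  qed
  have solve: "AE x in lborel. inv_op \<psi> x = \<kappa> x"
    if "lcs \<psi>" "lcs \<kappa>" "\<And>x. x \<notin> ?I \<Longrightarrow> \<kappa> x = 0" "AE x\<in>?I in lborel. R \<kappa> x = \<psi> x" for \<psi> \<kappa>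
  proof -
    have l: "lcs (\<lambda>x. inv_op \<psi> x - \<kappa> x)" using that by (intro lcs_diff lcs_inv_op)
    have *: "AE x\<in>?I in lborel. R (\<lambda>x. inv_op \<psi> x - \<kappa> x) x = 0"
      using Rinv[OF that(1)] that(4)
      by eventually_elim (use bcs that(1,2) in \<open>auto simp: R_def Dop_diff lcs_inv_op split: if_splits\<close>)
    have "AE x in lborel. inv_op \<psi> x - \<kappa> x = 0"
    proof (rule inj[OF l])
      show "AE u in lborel. u \<in> A \<longrightarrow> Dop b (\<lambda>x. inv_op \<psi> x - \<kappa> x) u = 0"
        using * by eventually_elim (use T in \<open>auto simp: R_def A\<close>)
      show "AE u in lborel. u \<in> C \<longrightarrow> Dop d (\<lambda>x. inv_op \<psi> x - \<kappa> x) u = 0"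
        using * by eventually_elim (use T in \<open>auto simp: R_def C\<close>)
    qed (use that(3) inv_supp in auto)
    then show ?thesis by simp
  qed
  have res: "resultant T b d \<phi> u = R (cutoff ?I \<phi>) u" if "u \<in> ?I" for \<phi> u
    by (simp add: R_def resultant_eq[OF that])
  have cut_id: "cutoff ?I \<phi> = \<phi>" if "\<And>x. x \<notin> ?I \<Longrightarrow> \<phi> x = 0" for \<phi> :: "real \<Rightarrow> complex^'r^'r"
    using that by (auto simp: cutoff_def fun_eq_iff)
  have I: "?I \<in> sets borel" by simp
  show "AE x in lborel. inv_op \<psi> x = \<kappa> x"
    if "lcs \<psi>" "lcs \<kappa>" "\<And>x. x \<notin> ?I \<Longrightarrow> \<kappa> x = 0" "AE x\<in>?I in lborel. resultant T b d \<kappa> x = \<psi> x"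
  proof (rule solve[OF that(1,2,3)])
    show "AE x\<in>?I in lborel. R \<kappa> x = \<psi> x"
      using that(4) by eventually_elim (use cut_id[OF that(3)] in \<open>auto simp: res\<close>)
  qed
  obtain Kd where Kd: "Kd \<ge> 0" "\<And>\<phi> :: real \<Rightarrow> complex^'r^'r. lcs \<phi> \<Longrightarrow>
      (LINT x|lborel. norm (cutoff ?I (Dop d \<phi>) x)) \<le> Kd * (LINT x|lborel. norm (\<phi> x))"
    using Dop_L1_bound[OF bcs(4) T] by blast
  obtain Kb where Kb: "Kb \<ge> 0" "\<And>\<phi> :: real \<Rightarrow> complex^'r^'r. lcs \<phi> \<Longrightarrow>
      (LINT x|lborel. norm (cutoff ?I (Dop b \<phi>) x)) \<le> Kb * (LINT x|lborel. norm (\<phi> x))"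
    using Dop_L1_bound[OF bcs(3) T] by blast
  obtain Ki where Ki: "\<And>\<phi>. lcs \<phi> \<Longrightarrow>
      (LINT x|lborel. norm (cutoff ?I (inv_op \<phi>) x)) \<le> Ki * (LINT x|lborel. norm (\<phi> x))"
    using inv_op_L1_bound by blast
  have b1: "bounded_L1_operator ?I (resultant T b d)"
  proof (rule bounded_L1_operatorI[where Q = R and K = "Kd + Kb"])
    fix \<phi> :: "real \<Rightarrow> complex^'r^'r" assume \<phi>: "lcs \<phi>"
    show "lcs (cutoff ?I (R \<phi>))" using lR[OF \<phi>] by (intro lcs_cutoff) auto
    note i = lcs_integrable[OF lcs_cutoff[OF I lcs_Dop[OF bcs(4) \<phi>]]]
      lcs_integrable[OF lcs_cutoff[OF I lcs_Dop[OF bcs(3) \<phi>]]]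
    have "(LINT x|lborel. norm (cutoff ?I (R \<phi>) x))
        \<le> (LINT x|lborel. norm (cutoff ?I (Dop d \<phi>) x) + norm (cutoff ?I (Dop b \<phi>) x))"
    proof (rule integral_mono)
      show "norm (cutoff ?I (R \<phi>) x) \<le> norm (cutoff ?I (Dop d \<phi>) x) + norm (cutoff ?I (Dop b \<phi>) x)" for x
        by (simp add: R_def cutoff_def)
    qed (use i lcs_integrable[OF lcs_cutoff[OF I lR[OF \<phi>]]] in auto)
    also have "\<dots> \<le> (Kd + Kb) * (LINT x|lborel. norm (\<phi> x))"
      using Kd(2)[OF \<phi>] Kb(2)[OF \<phi>] i by (simp add: algebra_simps)
    finally show "(LINT x|lborel. norm (cutoff ?I (R \<phi>) x)) \<le> (Kd + Kb) * (LINT x|lborel. norm (\<phi> x))" .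
  next
    show "R (\<lambda>x. r *\<^sub>R \<phi> x + \<psi> x) u = r *\<^sub>R R \<phi> u + R \<psi> u" if "lcs \<phi>" "lcs \<psi>" for \<phi> \<psi> r u
      using that bcs by (simp add: R_def Dop_add lcs_scaleR Dop_scaleR)
  qed (rule res)
  have b2: "bounded_L1_operator ?I (\<lambda>\<phi>. inv_op (cutoff ?I \<phi>))"
  proof (rule bounded_L1_operatorI[where Q = inv_op and K = Ki])
    show "inv_op (\<lambda>x. r *\<^sub>R \<phi> x + \<psi> x) u = r *\<^sub>R inv_op \<phi> u + inv_op \<psi> u" if "lcs \<phi>" "lcs \<psi>" for \<phi> \<psi> r u
      using that by (simp add: inv_op_add inv_op_scaleR lcs_scaleR)
  qed (use Ki in \<open>auto intro!: lcs_cutoff lcs_inv_op\<close>)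
  have r1: "AE x\<in>?I in lborel. resultant T b d (inv_op (cutoff ?I \<phi>)) x = \<phi> x" if "\<phi> \<in> L1 ?I" for \<phi>
  proof -
    have "AE x\<in>?I in lborel. R (inv_op (cutoff ?I \<phi>)) x = cutoff ?I \<phi> x"
      using that by (intro Rinv) (simp add: L1_iff_lcs)
    then show ?thesis
      by eventually_elim (use cut_id[OF inv_supp] in \<open>auto simp: res cutoff_def[of _ \<phi>]\<close>)
  qed
  have r2: "AE x\<in>?I in lborel. inv_op (cutoff ?I (resultant T b d \<phi>)) x = \<phi> x" if "\<phi> \<in> L1 ?I" for \<phi>
  proof -
    have l: "lcs (cutoff ?I \<phi>)" using that by (simp add: L1_iff_lcs)
    have eq: "cutoff ?I (resultant T b d \<phi>) = cutoff ?I (R (cutoff ?I \<phi>))"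
      using res by (auto simp: cutoff_def[of "?I"])
    have "AE x in lborel. inv_op (cutoff ?I (R (cutoff ?I \<phi>))) x = cutoff ?I \<phi> x"
    proof (rule solve[OF _ l])
      show "lcs (cutoff ?I (R (cutoff ?I \<phi>)))" by (intro lcs_cutoff lR l) simp
      show "cutoff ?I \<phi> x = 0" if "x \<notin> ?I" for x using that by (auto simp: cutoff_def)
      show "AE x\<in>?I in lborel. R (cutoff ?I \<phi>) x = cutoff ?I (R (cutoff ?I \<phi>)) x"
        by (simp add: cutoff_def[of ?I "R _"])
    qed
    then show ?thesis unfolding eq by eventually_elim (auto simp: cutoff_def[of _ \<phi>])
  qed
  show ?inv unfolding L1_inverse_def using b1 b2 r1 r2 by blast
qed

section \<open>Uniqueness of Fourier transforms\<close>

inductive trig_poly :: "(real \<Rightarrow> complex) \<Rightarrow> bool" where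
  exp: "trig_poly (\<lambda>x. c * exp (\<i> * complex_of_real (t * x)))"
| add: "trig_poly p \<Longrightarrow> trig_poly q \<Longrightarrow> trig_poly (\<lambda>x. p x + q x)"

text \<open>Real functions that are trigonometric polynomials form an algebra separating the points
  of the interval, so Stone-Weierstrass approximates \<open>\<phi>\<close> uniformly, and
  integration against \<open>h\<close> annihilates the approximants.\<close>

lemma trig_dense:
  assumes h: "integrable lborel h" "\<And>x. x \<notin> {-L..L} \<Longrightarrow> h x = 0" and L: "L > 0"
    and zero: "\<And>t :: real. (LINT x|lborel. h x * exp (\<i> * of_real (t * x))) = (0 :: complex)"
    and \<phi>: "continuous_on {-L..L} (\<phi> :: real \<Rightarrow> real)"
  shows "(LINT x|lborel. h x * of_real (\<phi> x)) = 0"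
proof -
  have E_exp: "trig_poly (\<lambda>x. c * exp (\<i> * of_real (t * x)))" for c t
    by (rule trig_poly.intros)
  have E_mult: "trig_poly (\<lambda>x. p x * q x)" if p: "trig_poly p" and q: "trig_poly q" for p q
    using p
  proof induction
    case (exp c t)
    show ?case using q
    proof induction
      case (exp d s)
      have "(\<lambda>x. c * exp (\<i> * complex_of_real (t * x)) * (d * exp (\<i> * complex_of_real (s * x))))
          = (\<lambda>x. (c * d) * exp (\<i> * complex_of_real ((t + s) * x)))"
        by (simp add: fun_eq_iff exp_add[symmetric] algebra_simps)
      then show ?case by (simp only: trig_poly.exp)
    qed (simp add: distrib_left trig_poly.add)
  qed (simp add: distrib_right trig_poly.add)
  have E_cont: "continuous_on S p" if "trig_poly p" for p S
    using that by induction (auto intro!: continuous_intros)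
  have hp: "integrable lborel (\<lambda>x. h x * cutoff {-L..L} p x)" if pc: "continuous_on {-L..L} p" for p
  proof -
    obtain B where B: "\<And>x. x \<in> {-L..L} \<Longrightarrow> norm (p x) \<le> B"
      using compact_imp_bounded[OF compact_continuous_image[OF pc compact_Icc]] unfolding bounded_iff by blast
    have [measurable]: "cutoff {-L..L} p \<in> borel_measurable borel"
      unfolding cutoff_eq_indicator using borel_measurable_continuous_on_indicator[OF _ pc] by simp
    have [measurable]: "h \<in> borel_measurable borel" using borel_measurable_integrable[OF h(1)] by simp
    show ?thesis
    proof (rule Bochner_Integration.integrable_bound)
      show "integrable lborel (\<lambda>x. \<bar>B\<bar> * norm (h x))" using h(1) by simp
      show "AE x in lborel. norm (h x * cutoff {-L..L} p x) \<le> norm (\<bar>B\<bar> * norm (h x))"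
      proof (intro AE_I2)
        fix x
        have "norm (cutoff {-L..L} p x) \<le> \<bar>B\<bar>" using B[of x] by (auto simp: cutoff_def)
        then show "norm (h x * cutoff {-L..L} p x) \<le> norm (\<bar>B\<bar> * norm (h x))"
          by (simp add: norm_mult mult.commute[of "norm (h x)"] mult_right_mono)
      qed
    qed measurable
  qed
  have cut: "h x * cutoff {-L..L} p x = h x * p x" for p x using h(2)[of x] by (auto simp: cutoff_def)
  note hp = hp[unfolded cut]
  have E_zero: "(LINT x|lborel. h x * p x) = 0" if "trig_poly p" for p
    using that
  proof induction
    case (exp c t)
    then show ?case using zero[of t] by (simp add: mult.left_commute[of _ c])
  next
    case (add p q)
    then show ?case using hp[OF E_cont, of p] hp[OF E_cont, of q] by (simp add: distrib_left)
  qed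
  define R where "R = {g :: real \<Rightarrow> real. trig_poly (\<lambda>x. of_real (g x))}"
  interpret function_ring_on R "{-L..L}"
  proof
    show "continuous_on {-L..L} g" if gR: "g \<in> R" for g
    proof -
      have "trig_poly (\<lambda>x. of_real (g x))" using gR by (simp add: R_def)
      from continuous_on_Re[OF E_cont[OF this]] show ?thesis by simp
    qed
    show "(\<lambda>x. g x + k x) \<in> R" if "g \<in> R" "k \<in> R" for g k
      using trig_poly.add that by (simp add: R_def)
    show "(\<lambda>x. g x * k x) \<in> R" if "g \<in> R" "k \<in> R" for g k
      using E_mult that by (simp add: R_def)
    show "(\<lambda>x. c) \<in> R" for c using E_exp[of "of_real c" 0] by (simp add: R_def)
    fix x y :: real assume xy: "x \<in> {-L..L}" "y \<in> {-L..L}" "x \<noteq> y"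
    \<comment> \<open>With this frequency \<open>t * x\<close> ranges over \<open>[-1, 1]\<close>,
      where sine is injective; a single function separates all pairs of points.\<close>
    define t where "t = 1 / L"
    have "(\<lambda>x. 1 / (2 * \<i>) * exp (\<i> * of_real (t * x)) + - 1 / (2 * \<i>) * exp (\<i> * of_real (- t * x)))
        = (\<lambda>x. of_real (sin (t * x)))"
      by (simp add: fun_eq_iff sin_exp_eq sin_of_real[symmetric] field_simps)
    then have "trig_poly (\<lambda>x. of_real (sin (t * x)))"
      using trig_poly.add[OF E_exp[of "1 / (2 * \<i>)" t] E_exp[of "- 1 / (2 * \<i>)" "- t"]] by simp
    moreover have "sin (t * x) \<noteq> sin (t * y)"
    proof
      assume *: "sin (t * x) = sin (t * y)"
      have b: "\<bar>t * z\<bar> \<le> pi / 2" if "z \<in> {-L..L}" for z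
      proof -
        have "\<bar>t * z\<bar> \<le> 1" using that L by (auto simp: t_def abs_mult)
        then show ?thesis using pi_ge_two by linarith
      qed
      have "t * x = t * y"
        using sin_inj_pi[of "t * x" "t * y"] * b[OF xy(1)] b[OF xy(2)] by (auto simp: abs_le_iff)
      then show False using xy(3) L by (simp add: t_def)
    qed
    ultimately show "\<exists>f\<in>R. f x \<noteq> f y" by (intro bexI[of _ "\<lambda>x. sin (t * x)"]) (auto simp: R_def)
  qed simp
  define I where "I = (LINT x|lborel. norm (h x))"
  have "norm (LINT x|lborel. h x * of_real (\<phi> x)) \<le> e * I" if e: "e > 0" for e
  proof -
    obtain g where g: "g \<in> R" "\<And>x. x \<in> {-L..L} \<Longrightarrow> \<bar>\<phi> x - g x\<bar> < e"
      using Stone_Weierstrass_basic[OF \<phi> e] by blast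
    have cg: "continuous_on {-L..L} (\<lambda>x. complex_of_real (g x))"
      by (rule E_cont) (use g(1) in \<open>simp add: R_def\<close>)
    have c\<phi>: "continuous_on {-L..L} (\<lambda>x. complex_of_real (\<phi> x))" by (intro continuous_intros \<phi>)
    have "(LINT x|lborel. h x * of_real (\<phi> x)) = (LINT x|lborel. h x * of_real (\<phi> x)) - (LINT x|lborel. h x * of_real (g x))"
      using E_zero[of "\<lambda>x. of_real (g x)"] g(1) by (simp add: R_def)
    also have "\<dots> = (LINT x|lborel. h x * of_real (\<phi> x) - h x * of_real (g x))"
      using hp[OF cg] hp[OF c\<phi>] by simp
    also have "norm \<dots> \<le> (LINT x|lborel. norm (h x * of_real (\<phi> x) - h x * of_real (g x)))"
      by (rule integral_norm_bound)
    also have "\<dots> \<le> (LINT x|lborel. e * norm (h x))"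
    proof (rule integral_mono)
      show "norm (h x * of_real (\<phi> x) - h x * of_real (g x)) \<le> e * norm (h x)" for x
      proof (cases "x \<in> {-L..L}")
        case True
        have "norm (h x * of_real (\<phi> x) - h x * of_real (g x)) = norm (h x) * \<bar>\<phi> x - g x\<bar>"
          by (simp add: norm_mult flip: right_diff_distrib of_real_diff)
        then show ?thesis using g(2)[OF True] by (simp add: mult.commute[of e] mult_left_mono)
      qed (simp add: h(2))
    qed (use hp[OF cg] hp[OF c\<phi>] h in auto)
    finally show ?thesis by (simp add: I_def)
  qed
  note le = this
  define N where "N = norm (LINT x|lborel. h x * of_real (\<phi> x))"
  have I: "I \<ge> 0" by (simp add: I_def)
  have "N = 0"
  proof (rule ccontr)
    assume "N \<noteq> 0"
    then have N: "N > 0" by (simp add: N_def)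
    \<comment> \<open>The tolerance \<open>N / (I + 1)\<close> makes the bound strictly smaller than
      \<open>N\<close>, also when \<open>I = 0\<close>.\<close>
    have "N \<le> N / (I + 1) * I" using le[of "N / (I + 1)"] N I by (simp add: N_def[symmetric])
    then have "N * (I + 1) \<le> N * I" using I by (simp add: field_simps)
    then show False using N by (simp add: algebra_simps)
  qed
  then show ?thesis by (simp add: N_def)
qed

text \<open>Testing against \<open>\<bar>x\<bar> cnj (h x)\<close>, which is continuous even if \<open>h\<close> jumps at \<open>0\<close>.\<close>

lemma fourier_unique:
  assumes h: "h \<in> borel_measurable borel" "\<And>x. norm (h x) \<le> B" "\<And>x. x \<notin> {-L..L} \<Longrightarrow> h x = 0" and L: "L > 0"
    and cont: "\<And>x. x \<in> {-L..L} \<Longrightarrow> x \<noteq> 0 \<Longrightarrow> continuous (at x within {-L..L}) h"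
    and zero: "\<And>t :: real. (LINT x|lborel. h x * exp (\<i> * of_real (t * x))) = (0 :: complex)"
    and x: "x \<noteq> 0"
  shows "h x = 0"
proof -
  have hL: "h x = 0" if "L < \<bar>x\<bar>" for x by (rule h(3)) (use that in auto)
  have hi: "integrable lborel h"
    by (rule integrable_bounded_compact[OF h(1,2) hL])
  have c: "continuous_on {-L..L} (\<lambda>x. of_real \<bar>x\<bar> * h x)"
    unfolding continuous_on_eq_continuous_within
  proof
    fix x assume x: "x \<in> {-L..L}"
    show "continuous (at x within {-L..L}) (\<lambda>x. of_real \<bar>x\<bar> * h x)"
    proof (cases "x = 0")
      case True
      have "((\<lambda>x. of_real \<bar>x\<bar> * h x) \<longlongrightarrow> 0) (at 0 within {-L..L})"
      proof (rule Lim_null_comparison)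
        show "\<forall>\<^sub>F x in at 0 within {-L..L}. norm (of_real \<bar>x\<bar> * h x) \<le> \<bar>x\<bar> * B"
          using h(2) by (intro always_eventually allI) (simp add: norm_mult mult_left_mono)
        have "((\<lambda>x. \<bar>x\<bar> * B) \<longlongrightarrow> \<bar>0\<bar> * B) (at 0 within {-L..L})" by (intro tendsto_intros)
        then show "((\<lambda>x. \<bar>x\<bar> * B) \<longlongrightarrow> 0) (at 0 within {-L..L})" by simp
      qed
      then show ?thesis using True by (simp add: continuous_within)
    next
      case False
      then show ?thesis using cont[OF x] by (intro continuous_intros)
    qed
  qed
  have "(LINT x|lborel. h x * of_real (Re (of_real \<bar>x\<bar> * h x))) = 0"
    by (rule trig_dense[OF hi h(3) L zero continuous_on_Re[OF c]])
  moreover have "(LINT x|lborel. h x * of_real (Im (of_real \<bar>x\<bar> * h x))) = 0"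
    by (rule trig_dense[OF hi h(3) L zero continuous_on_Im[OF c]])
  moreover have "integrable lborel (\<lambda>x. h x * of_real (Re (of_real \<bar>x\<bar> * h x)))"
    "integrable lborel (\<lambda>x. h x * of_real (Im (of_real \<bar>x\<bar> * h x)))"
  proof -
    have [measurable]: "h \<in> borel_measurable borel" by (rule h)
    have *: "norm (h x * of_real (P (of_real \<bar>x\<bar> * h x))) \<le> B * (L * B)"
      if "\<And>z. \<bar>P z\<bar> \<le> norm z" for P :: "complex \<Rightarrow> real" and x
    proof (cases "x \<in> {-L..L}")
      case True
      have B: "B \<ge> 0" using order_trans[OF norm_ge_zero h(2)] .
      have "\<bar>P (of_real \<bar>x\<bar> * h x)\<bar> \<le> norm (of_real \<bar>x\<bar> * h x)" by (rule that)
      also have "\<dots> \<le> L * B" unfolding norm_mult using h(2)[of x] True B by (intro mult_mono) auto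
      finally show ?thesis unfolding norm_mult using h(2)[of x] B by (intro mult_mono) auto
    qed (use h(3) order_trans[OF norm_ge_zero h(2)] L in simp)
    show "integrable lborel (\<lambda>x. h x * of_real (Re (of_real \<bar>x\<bar> * h x)))"
      by (rule integrable_bounded_compact[of _ "B * (L * B)" L])
        (use *[of Re, OF abs_Re_le_cmod] hL in \<open>auto intro!: borel_measurable_times\<close>)
    show "integrable lborel (\<lambda>x. h x * of_real (Im (of_real \<bar>x\<bar> * h x)))"
      by (rule integrable_bounded_compact[of _ "B * (L * B)" L])
        (use *[of Im, OF abs_Im_le_cmod] hL in \<open>auto intro!: borel_measurable_times\<close>)
  qed
  \<comment> \<open>Density is available for real test functions, so the complex conjugate is
    assembled from real part minus \<open>\<i>\<close> times imaginary part.\<close>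
  ultimately have "(LINT x|lborel. h x * of_real (Re (of_real \<bar>x\<bar> * h x)) - \<i> * (h x * of_real (Im (of_real \<bar>x\<bar> * h x)))) = 0"
    and i: "integrable lborel (\<lambda>x. h x * of_real (Re (of_real \<bar>x\<bar> * h x)) - \<i> * (h x * of_real (Im (of_real \<bar>x\<bar> * h x))))"
    by simp_all
  moreover have eq: "h x * of_real (Re (of_real \<bar>x\<bar> * h x)) - \<i> * (h x * of_real (Im (of_real \<bar>x\<bar> * h x)))
      = of_real (\<bar>x\<bar> * (norm (h x))\<^sup>2)" for x
    by (simp add: complex_eq_iff cmod_power2 algebra_simps power2_eq_square[of "Re _"] power2_eq_square[of "Im _"])
  ultimately have "(LINT x|lborel. \<bar>x\<bar> * (norm (h x))\<^sup>2) = 0"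
    by (metis (no_types, lifting) of_real_eq_0_iff integral_complex_of_real Bochner_Integration.integral_cong)
  moreover have "integrable lborel (\<lambda>x. \<bar>x\<bar> * (norm (h x))\<^sup>2)"
    using i unfolding eq by (simp only: complex_of_real_integrable_eq)
  ultimately have ae: "AE x in lborel. \<bar>x\<bar> * (norm (h x))\<^sup>2 = 0"
    by (subst (asm) integral_nonneg_eq_0_iff_AE) auto
  show "h x = 0"
  proof (rule ccontr)
    assume nz: "h x \<noteq> 0"
    then have xL: "x \<in> {-L..L}" using h(3) by blast
    have "continuous (at x within {-L..L}) h" using cont[OF xL x] .
    then obtain e where e: "e > 0" "\<And>y. y \<in> {-L..L} \<Longrightarrow> dist y x < e \<Longrightarrow> dist (h y) (h x) < norm (h x)"
      unfolding continuous_within_eps_delta using nz by (metis zero_less_norm_iff)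
    have hy: "h y \<noteq> 0" if "y \<in> {-L..L}" "dist y x < e" for y
      using e(2)[OF that] by (auto simp: dist_norm)
    \<comment> \<open>Clipped to the interval, because \<open>x\<close> may be one of its endpoints,
      where continuity is one-sided.\<close>
    define a where "a = max (-L) (x - e / 2)"
    define c where "c = min L (x + e / 2)"
    have ac: "a < c" unfolding a_def c_def using xL e L by auto
    have "AE y in lborel. y \<notin> {a..c}"
      using ae AE_lborel_singleton[of 0]
    proof eventually_elim
      case (elim y)
      show ?case
      proof
        assume "y \<in> {a..c}"
        then have "y \<in> {-L..L}" "dist y x < e" using e(1) by (auto simp: a_def c_def dist_real_def)
        then show False using hy elim by auto
      qed
    qed
    then have "emeasure lborel {a..c} = 0"
      by (subst (asm) AE_iff_measurable[of "{a..c}"]) auto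
    then show False using ac by simp
  qed
qed

section \<open>Resolvent kernels of convolution operators on intervals\<close>

lemma lcs_cutoff_continuous:
  fixes x :: "real \<Rightarrow> complex^'n^'m"
  assumes "continuous_on {a..b} x" shows "lcs (cutoff {a..b} x)"
proof -
  have "\<forall>s. max \<bar>a\<bar> \<bar>b\<bar> < \<bar>s\<bar> \<longrightarrow> cutoff {a..b} x s = 0" by (auto simp: cutoff_def)
  moreover have "integrable lborel (cutoff {a..b} x)"
    unfolding cutoff_eq_indicator by (rule borel_integrable_compact[OF compact_Icc assms])
  ultimately show ?thesis unfolding lcs_def by blast
qed

lemma AE_finite_shift:
  fixes Z :: "real set"
  assumes "finite Z" shows "AE v in lborel. t - v \<notin> Z"
proof -
  have "AE v in lborel. v \<notin> (\<lambda>z. t - z) ` Z"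
    using assms by (intro AE_not_in finite_imp_null_set_lborel) simp
  then show ?thesis by eventually_elim (metis (no_types, lifting) diff_diff_eq2 add_diff_cancel_left' imageI)
qed

text \<open>For fixed \<open>t\<close> the integrand is affected by discontinuities of
  \<open>c\<close> only at the finitely many \<open>v\<close> with \<open>t - v\<close> in
  \<open>Z\<close>, so dominated convergence applies. Jumps of the kernel are smoothed by the
  integration.\<close>

lemma conv_continuous:
  assumes c: "bcs c" "finite Z" "\<And>x. x \<notin> Z \<Longrightarrow> isCont c x" and \<phi>: "lcs \<phi>"
  shows "continuous_on S (conv c \<phi>)"
proof -
  obtain M where M: "M \<ge> 0" "\<And>x. norm (c x) \<le> M" using c(1) by (rule bcsE) blast
  note [measurable] = bcs_measurable[OF c(1)] lcs_measurable[OF \<phi>]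
  have "continuous_on UNIV (conv c \<phi>)"
    unfolding continuous_on_sequentially comp_def
  proof (intro allI ballI impI, elim conjE)
    fix X :: "nat \<Rightarrow> real" and t assume X: "X \<longlonglongrightarrow> t"
    show "(\<lambda>n. conv c \<phi> (X n)) \<longlonglongrightarrow> conv c \<phi> t"
      unfolding conv_def
    proof (rule integral_dominated_convergence)
      show "integrable lborel (\<lambda>v. M * norm (\<phi> v))" using lcs_integrable[OF \<phi>] by simp
      show "AE v in lborel. (\<lambda>n. c (X n - v) ** \<phi> v) \<longlonglongrightarrow> c (t - v) ** \<phi> v"
        using AE_finite_shift[OF c(2), of t]
      proof eventually_elim
        case (elim v)
        have "(\<lambda>n. c (X n - v)) \<longlonglongrightarrow> c (t - v)"
          by (rule isCont_tendsto_compose[OF c(3)[OF elim]]) (intro tendsto_intros X)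
        then show ?case by (intro mm.tendsto tendsto_const)
      qed
      show "AE v in lborel. norm (c (X n - v) ** \<phi> v) \<le> M * norm (\<phi> v)" for n
        by (intro AE_I2 order_trans[OF norm_matrix_mult_le] mult_right_mono M) auto
    qed measurable
  qed
  then show ?thesis by (rule continuous_on_subset) simp
qed

text \<open>Extension by zero adds possible jumps at \<open>T\<close> and \<open>-T\<close> to the
  one at 0. The last two assumptions express invertibility of 1 minus the integral operator in the
  supremum norm on continuous matrix functions. The first of them bounds \<open>x\<close> by its
  defect, so it serves for continuity of the resolvent in a parameter as well as for
  uniqueness.\<close>

locale jump_kernel =
  fixes T :: real and k :: "real \<Rightarrow> complex^'r^'r"
  assumes T: "T > 0" and k_bcs: "bcs k"
    and k_out: "\<And>x. T < \<bar>x\<bar> \<Longrightarrow> k x = 0"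
    and k_cont: "\<And>x. x \<notin> {0, T, -T} \<Longrightarrow> isCont k x"
    and k_left: "continuous_on {-T..<0} k" and k_right: "continuous_on {0<..T} k"
    and apriori: "\<And>\<tau>. \<tau> \<in> {0..T} \<Longrightarrow> \<exists>C. \<forall>x B. continuous_on {0..\<tau>} x \<longrightarrow>
      (\<forall>t\<in>{0..\<tau>}. norm (x t - conv k (cutoff {0..\<tau>} x) t :: complex^'r^'r) \<le> B) \<longrightarrow>
      (\<forall>t\<in>{0..\<tau>}. norm (x t) \<le> C * B)"
    and solvable: "\<And>\<tau> \<phi>. \<tau> \<in> {0..T} \<Longrightarrow> continuous_on {0..\<tau>} \<phi> \<Longrightarrow>
      \<exists>x :: real \<Rightarrow> complex^'r^'r. continuous_on {0..\<tau>} x \<and>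
        (\<forall>t\<in>{0..\<tau>}. x t = \<phi> t + conv k (cutoff {0..\<tau>} x) t)"
begin

abbreviation Kop :: "real \<Rightarrow> (real \<Rightarrow> complex^'r^'r) \<Rightarrow> real \<Rightarrow> complex^'r^'r" where
  "Kop \<tau> x \<equiv> conv k (cutoff {0..\<tau>} x)"

abbreviation reg :: "real \<Rightarrow> (real \<Rightarrow> complex^'r^'r) \<Rightarrow> bool" where
  "reg \<tau> x \<equiv> lcs (cutoff {0..\<tau>} x)"

lemma Kop_continuous: "reg \<tau> x \<Longrightarrow> continuous_on S (Kop \<tau> x)"
  by (rule conv_continuous[OF k_bcs, of "{0, T, -T}"]) (use k_cont in auto)

lemma Kop_cong: "(\<And>v. v \<in> {0..\<tau>} \<Longrightarrow> x v = y v) \<Longrightarrow> Kop \<tau> x = Kop \<tau> y"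
  by (rule arg_cong[of _ _ "conv k"]) (auto simp: cutoff_def)

lemma Kop_add: "reg \<tau> x \<Longrightarrow> reg \<tau> y \<Longrightarrow> Kop \<tau> (\<lambda>v. x v + y v) t = Kop \<tau> x t + Kop \<tau> y t"
  by (simp add: cutoff_add conv_add k_bcs)

lemma Kop_diff: "reg \<tau> x \<Longrightarrow> reg \<tau> y \<Longrightarrow> Kop \<tau> (\<lambda>v. x v - y v) t = Kop \<tau> x t - Kop \<tau> y t"
  by (simp add: cutoff_diff conv_diff k_bcs)

lemma reg_add: "reg \<tau> x \<Longrightarrow> reg \<tau> y \<Longrightarrow> reg \<tau> (\<lambda>v. x v + y v)"
  by (simp add: cutoff_add lcs_add)

lemma reg_diff: "reg \<tau> x \<Longrightarrow> reg \<tau> y \<Longrightarrow> reg \<tau> (\<lambda>v. x v - y v)"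
  by (simp add: cutoff_diff lcs_diff)

lemma reg_k_shift: "reg \<tau> (\<lambda>v. k (v - s))"
proof -
  have "lcs k" by (rule bcs_imp_lcs[OF k_bcs])
  then obtain S where S: "\<And>x. S < \<bar>x\<bar> \<Longrightarrow> k x = 0" and i: "integrable lborel k" unfolding lcs_def by blast
  have "k (x - s) = 0" if "S + \<bar>s\<bar> < \<bar>x\<bar>" for x by (rule S) (use that in linarith)
  then have "lcs (\<lambda>v. k (v - s))"
    unfolding lcs_def using lborel_integrable_real_affine[OF i, of 1 "- s"] by (auto simp: add.commute)
  then show ?thesis by (intro lcs_cutoff) simp
qed

lemma uniq:
  assumes \<tau>: "\<tau> \<in> {0..T}" and x: "reg \<tau> x" "\<And>t. t \<in> {0..\<tau>} \<Longrightarrow> x t = Kop \<tau> x t" and t: "t \<in> {0..\<tau>}"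
  shows "x t = 0"
proof -
  have "continuous_on {0..\<tau>} x"
    by (rule continuous_on_eq[OF Kop_continuous[OF x(1)]]) (rule x(2)[symmetric])
  moreover obtain C where "\<forall>x B. continuous_on {0..\<tau>} x \<longrightarrow>
      (\<forall>t\<in>{0..\<tau>}. norm (x t - Kop \<tau> x t) \<le> B) \<longrightarrow> (\<forall>t\<in>{0..\<tau>}. norm (x t) \<le> C * B)"
    using apriori[OF \<tau>] by blast
  moreover have "\<forall>t\<in>{0..\<tau>}. norm (x t - Kop \<tau> x t) \<le> 0" using x(2) by simp
  ultimately have "norm (x t) \<le> C * 0" using t by blast
  then show ?thesis by simp
qed

lemma uniq_all:
  assumes \<tau>: "\<tau> \<in> {0..T}" and x: "reg \<tau> x" "\<And>t. x t = Kop \<tau> x t"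
  shows "x t = 0"
proof -
  have "Kop \<tau> x = Kop \<tau> (\<lambda>_. 0)" by (rule Kop_cong) (rule uniq[OF \<tau> x(1)], rule x(2))
  then show ?thesis using x(2)[of t] by (simp add: conv_def cutoff_def)
qed

text \<open>The second iterated kernel. It is jointly continuous although \<open>k\<close> jumps,
  and it is the right-hand side of the equation for the continuous part of the resolvent.\<close>

definition kap :: "real \<Rightarrow> real \<Rightarrow> real \<Rightarrow> complex^'r^'r" where
  "kap \<tau> t s = Kop \<tau> (\<lambda>v. k (v - s)) t"

lemma kap_continuous: "continuous_on S (\<lambda>p. kap \<tau> (fst p) (snd p))"
proof -
  obtain M where M: "M \<ge> 0" "\<And>x. norm (k x) \<le> M" using k_bcs by (rule bcsE) blast
  note [measurable] = bcs_measurable[OF k_bcs]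
  have "continuous_on UNIV (\<lambda>p. kap \<tau> (fst p) (snd p))"
    unfolding continuous_on_sequentially comp_def
  proof (intro allI ballI impI, elim conjE)
    fix X :: "nat \<Rightarrow> real \<times> real" and p assume X: "X \<longlonglongrightarrow> p"
    show "(\<lambda>n. kap \<tau> (fst (X n)) (snd (X n))) \<longlonglongrightarrow> kap \<tau> (fst p) (snd p)"
      unfolding kap_def conv_def
    proof (rule integral_dominated_convergence)
      show "integrable lborel (\<lambda>v. M * M * indicator {0..\<tau>} v)" by (cases "0 \<le> \<tau>") auto
      show "AE v in lborel. (\<lambda>n. k (fst (X n) - v) ** cutoff {0..\<tau>} (\<lambda>v. k (v - snd (X n))) v)
          \<longlonglongrightarrow> k (fst p - v) ** cutoff {0..\<tau>} (\<lambda>v. k (v - snd p)) v"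
        using AE_finite_shift[of "{0, T, -T}" "fst p", simplified finite_insert finite.emptyI, OF TrueI]
          AE_finite_shift[of "{0, T, -T}" "snd p", simplified finite_insert finite.emptyI, OF TrueI]
      proof eventually_elim
        case (elim v)
        have "(\<lambda>n. k (fst (X n) - v)) \<longlonglongrightarrow> k (fst p - v)"
          by (rule isCont_tendsto_compose[OF k_cont]) (use elim in \<open>auto intro!: tendsto_intros X\<close>)
        moreover have "(\<lambda>n. k (v - snd (X n))) \<longlonglongrightarrow> k (v - snd p)"
          by (rule isCont_tendsto_compose[OF k_cont]) (use elim in \<open>auto intro!: tendsto_intros X\<close>)
        ultimately show ?case
          by (cases "v \<in> {0..\<tau>}") (auto simp: cutoff_def intro!: mm.tendsto)
      qed
      show "AE v in lborel. norm (k (fst (X n) - v) ** cutoff {0..\<tau>} (\<lambda>v. k (v - snd (X n))) v)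
          \<le> M * M * indicator {0..\<tau>} v" for n
      proof (intro AE_I2 order_trans[OF norm_matrix_mult_le])
        fix v
        show "norm (k (fst (X n) - v)) * norm (cutoff {0..\<tau>} (\<lambda>v. k (v - snd (X n))) v) \<le> M * M * indicator {0..\<tau>} v"
          using M by (auto simp: cutoff_def intro!: mult_mono)
      qed
    qed (unfold cutoff_eq_indicator, measurable)
  qed
  then show ?thesis by (rule continuous_on_subset) simp
qed

lemma kap_continuous1: "continuous_on S (\<lambda>t. kap \<tau> t s)"
proof -
  have "continuous_on S (\<lambda>t. (t, s))" by (intro continuous_on_Pair continuous_on_id continuous_on_const)
  from continuous_on_compose2[OF kap_continuous[of UNIV] this] show ?thesis by simp
qed

text \<open>\<open>gam \<tau>\<close> is the resolvent kernel, extended from \<open>[0, \<tau>]\<^sup>2\<close> to the plane by its own equation, and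
  \<open>rho \<tau>\<close> is its continuous part.\<close>

definition sol :: "real \<Rightarrow> real \<Rightarrow> real \<Rightarrow> complex^'r^'r" where
  "sol \<tau> s = (SOME x. continuous_on {0..\<tau>} x \<and> (\<forall>t\<in>{0..\<tau>}. x t = kap \<tau> t s + Kop \<tau> x t))"

definition rho :: "real \<Rightarrow> real \<Rightarrow> real \<Rightarrow> complex^'r^'r" where
  "rho \<tau> t s = kap \<tau> t s + Kop \<tau> (sol \<tau> s) t"

definition gam :: "real \<Rightarrow> real \<Rightarrow> real \<Rightarrow> complex^'r^'r" where
  "gam \<tau> t s = k (t - s) + rho \<tau> t s"

lemma sol:
  assumes "\<tau> \<in> {0..T}"
  shows "continuous_on {0..\<tau>} (sol \<tau> s)" "t \<in> {0..\<tau>} \<Longrightarrow> sol \<tau> s t = kap \<tau> t s + Kop \<tau> (sol \<tau> s) t"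
  using someI_ex[OF solvable[OF assms kap_continuous1[of _ \<tau> s]]] unfolding sol_def[symmetric] by auto

lemma rho_eq:
  assumes "\<tau> \<in> {0..T}"
  shows "rho \<tau> t s = kap \<tau> t s + Kop \<tau> (\<lambda>v. rho \<tau> v s) t"
proof -
  have "Kop \<tau> (sol \<tau> s) = Kop \<tau> (\<lambda>v. rho \<tau> v s)"
    by (rule Kop_cong) (simp add: rho_def sol(2)[OF assms])
  then show ?thesis by (simp add: rho_def)
qed

lemma rho_continuous1:
  assumes "\<tau> \<in> {0..T}" shows "continuous_on S (\<lambda>t. rho \<tau> t s)"
  unfolding rho_def
  by (intro continuous_on_add kap_continuous1 Kop_continuous lcs_cutoff_continuous sol assms)

lemma reg_rho: "\<tau> \<in> {0..T} \<Longrightarrow> reg \<tau> (\<lambda>v. rho \<tau> v s)"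
  by (intro lcs_cutoff_continuous rho_continuous1)

lemma reg_gam: "\<tau> \<in> {0..T} \<Longrightarrow> reg \<tau> (\<lambda>v. gam \<tau> v s)"
  unfolding gam_def by (intro reg_add reg_k_shift reg_rho)

lemma gam_eq:
  assumes "\<tau> \<in> {0..T}"
  shows "gam \<tau> t s = k (t - s) + Kop \<tau> (\<lambda>v. gam \<tau> v s) t"
  unfolding gam_def using rho_eq[OF assms, of t s] Kop_add[OF reg_k_shift reg_rho[OF assms], of s s t]
  by (simp add: kap_def)

lemma Kop_norm_le:
  assumes "\<tau> \<ge> 0" "reg \<tau> x" "\<And>v. v \<in> {0..\<tau>} \<Longrightarrow> norm (x v) \<le> B" "\<And>x. norm (k x) \<le> M"
  shows "norm (Kop \<tau> x t) \<le> M * (B * \<tau>)"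
proof -
  have B: "B \<ge> 0" using order_trans[OF norm_ge_zero assms(3)[of 0]] assms(1) by simp
  have "norm (Kop \<tau> x t) \<le> M * (LINT v|lborel. B * indicator {0..\<tau>} v)"
  proof (rule conv_norm_le[OF k_bcs lcs_integrable[OF assms(2)] _ assms(4)])
    show "integrable lborel (\<lambda>v. B * indicator {0..\<tau>} v)" using assms(1) by simp
    show "norm (cutoff {0..\<tau>} x s) \<le> B * indicator {0..\<tau>} s" for s
      using assms(3)[of s] by (simp add: cutoff_def indicator_def)
  qed (use B in simp)
  then show ?thesis using assms(1) by simp
qed

text \<open>For two values of the second variable, the difference of the columns solves the equation
  whose right side is the difference of \<open>kap\<close>. Uniform continuity of \<open>kap\<close>
  and the a priori bound make it small uniformly on \<open>[0, \<tau>]\<close>; the equation itself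
  carries this to other \<open>t\<close>. Continuity in the first variable at fixed
  \<open>s0\<close> completes the argument.\<close>

lemma rho_continuous:
  assumes \<tau>: "\<tau> \<in> {0..T}"
  shows "continuous_on S (\<lambda>p. rho \<tau> (fst p) (snd p))"
proof -
  obtain M where M: "M \<ge> 0" "\<And>x. norm (k x) \<le> M" using k_bcs by (rule bcsE) blast
  obtain C where C: "\<forall>x B. continuous_on {0..\<tau>} x \<longrightarrow>
      (\<forall>t\<in>{0..\<tau>}. norm (x t - Kop \<tau> x t) \<le> B) \<longrightarrow> (\<forall>t\<in>{0..\<tau>}. norm (x t) \<le> C * B)"
    using apriori[OF \<tau>] by blast
  have "isCont (\<lambda>p. rho \<tau> (fst p) (snd p)) (t0, s0)" for t0 s0
    unfolding continuous_at_eps_delta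
  proof (intro allI impI)
    fix e :: real assume e: "e > 0"
    \<comment> \<open>By \<open>Kop_norm_le\<close> the equation turns a defect \<open>e'\<close>
      into a deviation of at most \<open>K * e'\<close>, which the next choice makes equal to
      \<open>e / 4\<close>.\<close>
    define K where "K = 1 + M * (\<bar>C\<bar> * \<tau>)"
    have K: "K > 0" unfolding K_def using M \<tau> by (auto intro!: add_pos_nonneg)
    define e' where "e' = e / (4 * K)"
    have e': "e' > 0" using e K by (simp add: e'_def)
    define D where "D = {min 0 (t0 - 1)..max \<tau> (t0 + 1)} \<times> {s0 - 1..s0 + 1}"
    have "uniformly_continuous_on D (\<lambda>p. kap \<tau> (fst p) (snd p))"
      unfolding D_def by (intro compact_uniformly_continuous kap_continuous compact_Times compact_Icc)
    then obtain d1 where d1: "d1 > 0" "\<And>p q. p \<in> D \<Longrightarrow> q \<in> D \<Longrightarrow> dist p q < d1 \<Longrightarrow>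
        dist (kap \<tau> (fst p) (snd p)) (kap \<tau> (fst q) (snd q)) < e'"
      unfolding uniformly_continuous_on_def using e' by metis
    have "isCont (\<lambda>t. rho \<tau> t s0) t0"
      using rho_continuous1[OF \<tau>, of UNIV s0] by (simp add: continuous_on_eq_continuous_at)
    then obtain d2 where d2: "d2 > 0" "\<And>t. dist t t0 < d2 \<Longrightarrow> dist (rho \<tau> t s0) (rho \<tau> t0 s0) < e / 2"
      unfolding continuous_at_eps_delta using e by (meson half_gt_zero)
    show "\<exists>d>0. \<forall>p. dist p (t0, s0) < d \<longrightarrow>
        dist (rho \<tau> (fst p) (snd p)) (rho \<tau> (fst (t0, s0)) (snd (t0, s0))) < e"
    proof (intro exI[of _ "min 1 (min d1 d2)"] conjI allI impI)
      fix p assume p: "dist p (t0, s0) < min 1 (min d1 d2)"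
      obtain t s where ts: "p = (t, s)" by (cases p)
      have dt: "dist t t0 < min 1 (min d1 d2)" "dist s s0 < min 1 (min d1 d2)"
        using p dist_fst_le[of p "(t0, s0)"] dist_snd_le[of p "(t0, s0)"] by (auto simp: ts)
      have near: "norm (kap \<tau> v s - kap \<tau> v s0) \<le> e'" if "v \<in> {min 0 (t0 - 1)..max \<tau> (t0 + 1)}" for v
        using d1(2)[of "(v, s)" "(v, s0)"] that dt
        by (auto simp: D_def dist_Pair_Pair dist_norm less_imp_le)
      have x: "norm (rho \<tau> v s - rho \<tau> v s0) \<le> \<bar>C\<bar> * e'" if "v \<in> {0..\<tau>}" for v
      proof -
        have "norm (rho \<tau> v s - rho \<tau> v s0) \<le> C * e'"
        proof (rule C[rule_format, OF _ _ that])
          show "continuous_on {0..\<tau>} (\<lambda>v. rho \<tau> v s - rho \<tau> v s0)"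
            by (intro continuous_on_diff rho_continuous1 \<tau>)
          show "norm (rho \<tau> t s - rho \<tau> t s0 - Kop \<tau> (\<lambda>v. rho \<tau> v s - rho \<tau> v s0) t) \<le> e'"
            if "t \<in> {0..\<tau>}" for t
            using near[of t] that le_max_iff_disj[of t \<tau>] min_le_iff_disj[of 0 _ t] rho_eq[OF \<tau>, of t s] rho_eq[OF \<tau>, of t s0]
            by (simp add: Kop_diff reg_rho[OF \<tau>] algebra_simps)
        qed
        also have "\<dots> \<le> \<bar>C\<bar> * e'" using e' by (intro mult_right_mono) auto
        finally show ?thesis .
      qed
      have "rho \<tau> t s - rho \<tau> t s0 = (kap \<tau> t s - kap \<tau> t s0) + Kop \<tau> (\<lambda>v. rho \<tau> v s - rho \<tau> v s0) t"
        using rho_eq[OF \<tau>, of t s] rho_eq[OF \<tau>, of t s0] by (simp add: Kop_diff reg_rho[OF \<tau>] algebra_simps)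
      also have "norm \<dots> \<le> e' + M * (\<bar>C\<bar> * e' * \<tau>)"
      proof (intro order_trans[OF norm_triangle_ineq] add_mono near Kop_norm_le)
        show "t \<in> {min 0 (t0 - 1)..max \<tau> (t0 + 1)}" using dt by (auto simp: dist_real_def)
        show "reg \<tau> (\<lambda>v. rho \<tau> v s - rho \<tau> v s0)" by (intro reg_diff reg_rho \<tau>)
      qed (use \<tau> x M in auto)
      also have "\<dots> = K * e'" by (simp add: K_def algebra_simps)
      also have "\<dots> < e / 2" using e K by (simp add: e'_def)
      finally have "dist (rho \<tau> t s) (rho \<tau> t s0) < e / 2" by (simp add: dist_norm)
      moreover have "dist (rho \<tau> t s0) (rho \<tau> t0 s0) < e / 2" using d2(2) dt by simp
      ultimately show "dist (rho \<tau> (fst p) (snd p)) (rho \<tau> (fst (t0, s0)) (snd (t0, s0))) < e"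
        unfolding ts using dist_triangle[of "rho \<tau> t s" "rho \<tau> t0 s0" "rho \<tau> t s0"] by simp
    qed (use d1 d2 in auto)
  qed
  then show ?thesis by (intro continuous_at_imp_continuous_on) auto
qed

section \<open>Solving the integral equation with the resolvent kernel\<close>

lemma measurable_gam [measurable]:
  assumes "\<tau> \<in> {0..T}"
  shows "(\<lambda>(t, s). gam \<tau> t s) \<in> borel_measurable (borel \<Otimes>\<^sub>M borel)"
proof -
  note [measurable] = bcs_measurable[OF k_bcs]
  have "(\<lambda>p. rho \<tau> (fst p) (snd p)) \<in> borel_measurable borel"
    by (intro borel_measurable_continuous_onI rho_continuous assms)
  then have [measurable]: "(\<lambda>p. rho \<tau> (fst p) (snd p)) \<in> borel_measurable (borel \<Otimes>\<^sub>M borel)"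
    by (simp add: borel_prod)
  show ?thesis unfolding gam_def split_beta by measurable
qed

lemma gam_bounded:
  assumes "\<tau> \<in> {0..T}"
  obtains G where "G \<ge> 0" "\<And>t s. t \<in> {-L..L} \<Longrightarrow> s \<in> {-L..L} \<Longrightarrow> norm (gam \<tau> t s) \<le> G"
proof -
  obtain M where M: "M \<ge> 0" "\<And>x. norm (k x) \<le> M" using k_bcs by (rule bcsE) blast
  have "bounded ((\<lambda>p. rho \<tau> (fst p) (snd p)) ` ({-L..L} \<times> {-L..L}))"
    by (intro compact_imp_bounded compact_continuous_image rho_continuous assms compact_Times compact_Icc)
  then obtain B where B: "B > 0" "\<And>t s. t \<in> {-L..L} \<Longrightarrow> s \<in> {-L..L} \<Longrightarrow> norm (rho \<tau> t s) \<le> B"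
    unfolding bounded_pos by auto
  show ?thesis
  proof (rule that[of "M + B"])
    show "norm (gam \<tau> t s) \<le> M + B" if "t \<in> {-L..L}" "s \<in> {-L..L}" for t s
      unfolding gam_def by (intro order_trans[OF norm_triangle_ineq] add_mono M B that)
  qed (use M B in simp)
qed

text \<open>The resolvent as an integral operator on functions whose support may leave
  \<open>[0, \<tau>]\<close>; the extension of \<open>gam\<close> to the plane makes this
  meaningful, and the comparison of different interval lengths relies on it.\<close>

definition Gint :: "real \<Rightarrow> (real \<Rightarrow> complex^'r^'r) \<Rightarrow> real \<Rightarrow> complex^'r^'r" where
  "Gint \<tau> D t = (LINT s|lborel. gam \<tau> t s ** D s)"

lemma Gint_integrable:
  assumes \<tau>: "\<tau> \<in> {0..T}" and D: "lcs D"
  shows "integrable lborel (\<lambda>s. gam \<tau> t s ** D s)"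
proof -
  obtain S where S: "\<And>x. S < \<bar>x\<bar> \<Longrightarrow> D x = 0" using D unfolding lcs_def by blast
  obtain G where G: "G \<ge> 0" "\<And>t' s. t' \<in> {-max \<bar>t\<bar> S..max \<bar>t\<bar> S} \<Longrightarrow> s \<in> {-max \<bar>t\<bar> S..max \<bar>t\<bar> S} \<Longrightarrow> norm (gam \<tau> t' s) \<le> G"
    using gam_bounded[OF \<tau>] by blast
  note [measurable] = lcs_measurable[OF D] measurable_gam[OF \<tau>]
  show ?thesis
  proof (rule Bochner_Integration.integrable_bound)
    show "integrable lborel (\<lambda>s. G * norm (D s))" using lcs_integrable[OF D] by simp
    show "AE s in lborel. norm (gam \<tau> t s ** D s) \<le> norm (G * norm (D s))"
    proof (intro AE_I2)
      fix s
      show "norm (gam \<tau> t s ** D s) \<le> norm (G * norm (D s))"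
      proof (cases "S < \<bar>s\<bar>")
        case False
        then have "norm (gam \<tau> t s) \<le> G" by (intro G) (auto simp: max_def)
        then have "norm (gam \<tau> t s) * norm (D s) \<le> G * norm (D s)" by (rule mult_right_mono) simp
        then show ?thesis using norm_matrix_mult_le[of "gam \<tau> t s" "D s"] G(1) by simp
      qed (simp add: S)
    qed
  qed measurable
qed

text \<open>The resolvent equation \<open>gam_eq\<close> integrated against \<open>D s\<close>, with
  the order of integration exchanged.\<close>

lemma Kop_Gint:
  assumes \<tau>: "\<tau> \<in> {0..T}" and D: "lcs D"
  shows "reg \<tau> (Gint \<tau> D)" "Kop \<tau> (Gint \<tau> D) t = Gint \<tau> D t - conv k D t"
proof -
  obtain M where M: "M \<ge> 0" "\<And>x. norm (k x) \<le> M" using k_bcs by (rule bcsE) blast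
  obtain S where S: "\<And>x. S < \<bar>x\<bar> \<Longrightarrow> D x = 0" using D unfolding lcs_def by blast
  obtain G where G: "G \<ge> 0" "\<And>t' s. t' \<in> {-max T S..max T S} \<Longrightarrow> s \<in> {-max T S..max T S} \<Longrightarrow> norm (gam \<tau> t' s) \<le> G"
    using gam_bounded[OF \<tau>] by blast
  note [measurable] = lcs_measurable[OF D] measurable_gam[OF \<tau>] bcs_measurable[OF k_bcs]
  have cD: "cutoff {0..\<tau>} (Gint \<tau> D) v = (LINT s|lborel. indicator {0..\<tau>} v *\<^sub>R (gam \<tau> v s ** D s))" for v
    by (simp add: cutoff_def Gint_def indicator_def)
  have bd: "norm (indicator {0..\<tau>} v *\<^sub>R (gam \<tau> v s ** D s)) \<le> G * indicator {0..\<tau>} v * norm (D s)" for v s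
  proof (cases "v \<in> {0..\<tau>} \<and> \<not> S < \<bar>s\<bar>")
    case True
    then have "norm (gam \<tau> v s) \<le> G" using \<tau> by (intro G) (auto simp: max_def)
    then have "norm (gam \<tau> v s) * norm (D s) \<le> G * norm (D s)" by (rule mult_right_mono) simp
    then show ?thesis using norm_matrix_mult_le[of "gam \<tau> v s" "D s"] True by simp
  qed (use G(1) S in \<open>auto simp: indicator_def\<close>)
  have iG: "integrable lborel (\<lambda>v. G * indicator {0..\<tau>} v)" using \<tau> by auto
  have "integrable lborel (cutoff {0..\<tau>} (Gint \<tau> D))"
    unfolding cD[abs_def]
    by (rule integral_swap(2)[OF _ iG _ bd]) (use lcs_integrable[OF D] in \<open>auto, measurable\<close>)
  moreover have "\<forall>s. \<tau> < \<bar>s\<bar> \<longrightarrow> cutoff {0..\<tau>} (Gint \<tau> D) s = 0" by (auto simp: cutoff_def)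
  ultimately show "reg \<tau> (Gint \<tau> D)" unfolding lcs_def by blast
  have "Kop \<tau> (Gint \<tau> D) t = (LINT v|lborel. LINT s|lborel. k (t - v) ** (indicator {0..\<tau>} v *\<^sub>R (gam \<tau> v s ** D s)))"
    unfolding conv_def cD
    by (subst integral_bounded_linear[OF mm.bounded_linear_right]) (use Gint_integrable[OF \<tau> D] in auto)
  also have "\<dots> = (LINT s|lborel. LINT v|lborel. k (t - v) ** (indicator {0..\<tau>} v *\<^sub>R (gam \<tau> v s ** D s)))"
  proof (rule integral_swap(1))
    show "integrable lborel (\<lambda>v. M * (G * indicator {0..\<tau>} v))" "integrable lborel (\<lambda>s. norm (D s))"
      using iG lcs_integrable[OF D] by auto
    show "norm (k (t - v) ** (indicator {0..\<tau>} v *\<^sub>R (gam \<tau> v s ** D s)))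
        \<le> M * (G * indicator {0..\<tau>} v) * norm (D s)" for v s
      unfolding mult.assoc[of M]
      by (intro order_trans[OF norm_matrix_mult_le] mult_mono M bd) (use M in auto)
  qed measurable
  also have "\<dots> = (LINT s|lborel. gam \<tau> t s ** D s - k (t - s) ** D s)"
  proof (rule Bochner_Integration.integral_cong[OF refl])
    fix s
    have "(LINT v|lborel. k (t - v) ** (indicator {0..\<tau>} v *\<^sub>R (gam \<tau> v s ** D s)))
        = (LINT v|lborel. (k (t - v) ** cutoff {0..\<tau>} (\<lambda>v. gam \<tau> v s) v) ** D s)"
      by (rule Bochner_Integration.integral_cong) (auto simp: cutoff_def indicator_def matrix_mul_assoc)
    also have "\<dots> = Kop \<tau> (\<lambda>v. gam \<tau> v s) t ** D s"
      unfolding conv_def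
      by (subst integral_bounded_linear[OF mm.bounded_linear_left])
        (use conv_integrand[OF k_bcs lcs_integrable[OF reg_gam[OF \<tau>]]] in auto)
    also have "\<dots> = gam \<tau> t s ** D s - k (t - s) ** D s"
      using gam_eq[OF \<tau>, of t s] by (simp add: mm.diff_left[symmetric])
    finally show "(LINT v|lborel. k (t - v) ** (indicator {0..\<tau>} v *\<^sub>R (gam \<tau> v s ** D s)))
        = gam \<tau> t s ** D s - k (t - s) ** D s" .
  qed
  also have "\<dots> = Gint \<tau> D t - conv k D t"
    unfolding Gint_def conv_def
    by (intro Bochner_Integration.integral_diff Gint_integrable[OF \<tau> D] conv_integrand k_bcs lcs_integrable[OF D])
  finally show "Kop \<tau> (Gint \<tau> D) t = Gint \<tau> D t - conv k D t" .
qed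

definition X :: "real \<Rightarrow> (real \<Rightarrow> complex^'r^'r) \<Rightarrow> real \<Rightarrow> complex^'r^'r" where
  "X \<tau> \<phi> t = \<phi> t + Gint \<tau> (cutoff {0..\<tau>} \<phi>) t"

lemma reg_X: "\<tau> \<in> {0..T} \<Longrightarrow> reg \<tau> \<phi> \<Longrightarrow> reg \<tau> (X \<tau> \<phi>)"
  unfolding X_def[abs_def] by (intro reg_add Kop_Gint)

lemma X_eq:
  assumes "\<tau> \<in> {0..T}" "reg \<tau> \<phi>"
  shows "X \<tau> \<phi> t = \<phi> t + Kop \<tau> (X \<tau> \<phi>) t"
  unfolding X_def[abs_def] using assms by (simp add: Kop_add Kop_Gint)

lemma X_unique:
  assumes \<tau>: "\<tau> \<in> {0..T}" and "reg \<tau> \<phi>" "reg \<tau> y"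
    and y: "\<And>t. t \<in> {0..\<tau>} \<Longrightarrow> y t = \<phi> t + Kop \<tau> y t" and t: "t \<in> {0..\<tau>}"
  shows "y t = X \<tau> \<phi> t"
proof -
  have "y t - X \<tau> \<phi> t = 0"
  proof (rule uniq[OF \<tau> _ _ t])
    show "reg \<tau> (\<lambda>t. y t - X \<tau> \<phi> t)" by (intro reg_diff reg_X assms)
    show "y t - X \<tau> \<phi> t = Kop \<tau> (\<lambda>t. y t - X \<tau> \<phi> t) t" if "t \<in> {0..\<tau>}" for t
      using y[OF that] X_eq[OF \<tau> assms(2), of t]
      by (simp add: Kop_diff[OF assms(3) reg_X[OF \<tau> assms(2)]])
  qed
  then show ?thesis by simp
qed

lemma X_unique_all:
  assumes \<tau>: "\<tau> \<in> {0..T}" and "reg \<tau> \<phi>" "reg \<tau> y" and y: "\<And>t. y t = \<phi> t + Kop \<tau> y t"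
  shows "y t = X \<tau> \<phi> t"
proof -
  have "Kop \<tau> y = Kop \<tau> (X \<tau> \<phi>)" by (rule Kop_cong) (rule X_unique[OF \<tau> assms(2,3) y])
  then show ?thesis using y[of t] X_eq[OF \<tau> assms(2), of t] by simp
qed

text \<open>The resolvent equation with the factors in the other order. A column of
  \<open>gam\<close> solves the equation with right side \<open>k (t - v)\<close>, hence equals its
  image under 1 plus the resolvent operator, and this image is written with a row.\<close>

lemma gam_row:
  assumes \<tau>: "\<tau> \<in> {0..T}"
  shows "gam \<tau> t v = k (t - v) + (LINT s|lborel. gam \<tau> t s ** cutoff {0..\<tau>} (\<lambda>s. k (s - v)) s)"
  using X_unique_all[OF \<tau> reg_k_shift reg_gam[OF \<tau>] gam_eq[OF \<tau>], of t v]
  by (simp add: X_def Gint_def)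

section \<open>Continuity of the solutions and dependence on the interval length\<close>

lemma X_continuous:
  assumes "\<tau> \<in> {0..T}" "continuous_on UNIV \<phi>"
  shows "continuous_on S (X \<tau> \<phi>)"
proof -
  have r: "reg \<tau> \<phi>" using assms(2) by (auto intro: lcs_cutoff_continuous continuous_on_subset)
  have "continuous_on S (\<lambda>t. \<phi> t + Kop \<tau> (X \<tau> \<phi>) t)"
    by (intro continuous_on_add Kop_continuous reg_X assms r) (auto intro: continuous_on_subset[OF assms(2)])
  then show ?thesis using X_eq[OF assms(1) r] by simp
qed

text \<open>Subtracting the equations for the two lengths leaves, on \<open>[0, \<tau>]\<close>, an
  equation with inhomogeneity \<open>conv k\<close> of the signed piece of
  \<open>X \<tau>' \<phi>\<close> between the endpoints. By \<open>Kop_Gint\<close> this is what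
  \<open>Gint \<tau>\<close> solves.\<close>

lemma X_difference:
  assumes \<tau>: "\<tau> \<in> {0..T}" "\<tau>' \<in> {0..T}" and \<phi>: "continuous_on UNIV \<phi>"
  shows "X \<tau>' \<phi> t - X \<tau> \<phi> t = Gint \<tau> (\<lambda>v. cutoff {0..\<tau>'} (X \<tau>' \<phi>) v - cutoff {0..\<tau>} (X \<tau>' \<phi>) v) t"
proof -
  let ?D = "\<lambda>v. cutoff {0..\<tau>'} (X \<tau>' \<phi>) v - cutoff {0..\<tau>} (X \<tau>' \<phi>) v"
  have r: "reg \<tau> \<phi>" "reg \<tau>' \<phi>" using \<phi> by (auto intro!: lcs_cutoff_continuous continuous_on_subset[OF \<phi>])
  have rX: "reg \<tau> (X \<tau> \<phi>)" "reg \<tau>' (X \<tau>' \<phi>)" "reg \<tau> (X \<tau>' \<phi>)"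
    using \<tau> \<phi> by (auto intro!: lcs_cutoff_continuous X_continuous)
  have D: "lcs ?D" using rX by (intro lcs_diff)
  have "X \<tau>' \<phi> t - X \<tau> \<phi> t - Gint \<tau> ?D t = 0"
  proof (rule uniq_all[OF \<tau>(1)])
    show "reg \<tau> (\<lambda>t. X \<tau>' \<phi> t - X \<tau> \<phi> t - Gint \<tau> ?D t)"
      by (intro reg_diff rX Kop_Gint \<tau> D)
    show "X \<tau>' \<phi> t - X \<tau> \<phi> t - Gint \<tau> ?D t = Kop \<tau> (\<lambda>t. X \<tau>' \<phi> t - X \<tau> \<phi> t - Gint \<tau> ?D t) t" for t
    proof -
      have "conv k ?D t = Kop \<tau>' (X \<tau>' \<phi>) t - Kop \<tau> (X \<tau>' \<phi>) t"
        using rX by (simp add: conv_diff k_bcs)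
      then show ?thesis
        using X_eq[OF \<tau>(1) r(1), of t] X_eq[OF \<tau>(2) r(2), of t] rX
        by (simp add: Kop_diff reg_diff Kop_Gint[OF \<tau>(1) D])
    qed
  qed
  then show ?thesis by simp
qed

text \<open>A bound for the solutions that is uniform in \<open>\<tau>'\<close> is part of the task:
  \<open>X_difference\<close> estimates the change by the maximum \<open>B'\<close> of the new
  solution itself, and for short steps that term is absorbed on the left, giving at most twice the
  old bound.\<close>

lemma X_lipschitz:
  assumes \<tau>: "\<tau> \<in> {0..T}" and \<phi>: "continuous_on UNIV \<phi>"
  obtains L \<delta> where "L \<ge> 0" "\<delta> > 0" "\<And>\<tau>' t. \<tau>' \<in> {0..T} \<Longrightarrow> \<bar>\<tau>' - \<tau>\<bar> < \<delta> \<Longrightarrow> t \<in> {0..T} \<Longrightarrow>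
      norm (X \<tau>' \<phi> t - X \<tau> \<phi> t) \<le> L * \<bar>\<tau>' - \<tau>\<bar>"
proof -
  obtain G where G: "G \<ge> 0" "\<And>t' s. t' \<in> {-T..T} \<Longrightarrow> s \<in> {-T..T} \<Longrightarrow> norm (gam \<tau> t' s) \<le> G"
    using gam_bounded[OF \<tau>] by blast
  have "bounded (X \<tau> \<phi> ` {0..T})"
    by (intro compact_imp_bounded compact_continuous_image X_continuous \<tau> \<phi> compact_Icc)
  then obtain B where B: "B > 0" "\<And>t. t \<in> {0..T} \<Longrightarrow> norm (X \<tau> \<phi> t) \<le> B"
    unfolding bounded_pos by auto
  \<comment> \<open>Chosen so that \<open>G * \<delta>\<close> is at most one half, which permits
    the absorption.\<close>
  define \<delta> where "\<delta> = 1 / (2 * (G + 1))"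
  show ?thesis
  proof (rule that[of "G * (2 * B)" \<delta>])
    fix \<tau>' t assume \<tau>': "\<tau>' \<in> {0..T}" "\<bar>\<tau>' - \<tau>\<bar> < \<delta>" and t: "t \<in> {0..T}"
    obtain m where m: "m \<in> {0..T}" "\<And>t. t \<in> {0..T} \<Longrightarrow> norm (X \<tau>' \<phi> t) \<le> norm (X \<tau>' \<phi> m)"
      using continuous_attains_sup[of "{0..T}" "\<lambda>t. norm (X \<tau>' \<phi> t)"] T
        continuous_on_norm[OF X_continuous[OF \<tau>'(1) \<phi>]] by auto
    define B' where "B' = norm (X \<tau>' \<phi> m)"
    have le: "norm (X \<tau>' \<phi> t - X \<tau> \<phi> t) \<le> G * B' * \<bar>\<tau>' - \<tau>\<bar>" if t: "t \<in> {0..T}" for t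
    proof -
      let ?D = "\<lambda>v. cutoff {0..\<tau>'} (X \<tau>' \<phi>) v - cutoff {0..\<tau>} (X \<tau>' \<phi>) v"
      have D: "lcs ?D" using \<tau> \<tau>' \<phi> by (intro lcs_diff lcs_cutoff_continuous X_continuous) auto
      let ?J = "{min \<tau> \<tau>'..max \<tau> \<tau>'}"
      have "norm (Gint \<tau> ?D t) \<le> (LINT v|lborel. norm (gam \<tau> t v ** ?D v))"
        unfolding Gint_def by (rule integral_norm_bound)
      also have "\<dots> \<le> (LINT v|lborel. G * B' * indicator ?J v)"
      proof (rule integral_mono)
        show "integrable lborel (\<lambda>v. norm (gam \<tau> t v ** ?D v))" using Gint_integrable[OF \<tau> D] by simp
        show "norm (gam \<tau> t v ** ?D v) \<le> G * B' * indicator ?J v" for v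
        proof (cases "v \<in> {0..T} \<and> v \<in> ?J")
          case True
          have "norm (?D v) \<le> B'" using m(2)[of v] True by (auto simp: cutoff_def B'_def)
          then have "norm (gam \<tau> t v) * norm (?D v) \<le> G * B'"
            using t True T G(1) by (intro mult_mono G) auto
          then show ?thesis using True norm_matrix_mult_le[of "gam \<tau> t v" "?D v"] by simp
        next
          case False
          then have "?D v = 0" using \<tau> \<tau>' by (auto simp: cutoff_def)
          then show ?thesis using G(1) by (simp add: B'_def)
        qed
      qed simp
      also have "\<dots> = G * B' * \<bar>\<tau>' - \<tau>\<bar>" by (simp add: max_def min_def abs_if)
      finally show ?thesis using X_difference[OF \<tau> \<tau>'(1) \<phi>, of t] by simp
    qed
    have "B' \<le> norm (X \<tau> \<phi> m) + norm (X \<tau>' \<phi> m - X \<tau> \<phi> m)"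
      unfolding B'_def using norm_triangle_sub by blast
    also have "\<dots> \<le> B + G * B' * \<bar>\<tau>' - \<tau>\<bar>" by (intro add_mono B le m)
    also have "G * B' * \<bar>\<tau>' - \<tau>\<bar> \<le> G * B' * \<delta>"
      using \<tau>'(2) G(1) by (intro mult_left_mono) (auto simp: B'_def)
    also have "G * B' * \<delta> \<le> B' / 2"
    proof -
      have "G * \<delta> \<le> 1 / 2" using G(1) by (simp add: \<delta>_def field_simps)
      then have "B' * (G * \<delta>) \<le> B' * (1 / 2)" by (intro mult_left_mono) (auto simp: B'_def)
      then show ?thesis by (simp add: mult_ac)
    qed
    finally have "B' \<le> 2 * B" by simp
    then have "G * B' * \<bar>\<tau>' - \<tau>\<bar> \<le> G * (2 * B) * \<bar>\<tau>' - \<tau>\<bar>"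
      using G(1) by (intro mult_right_mono mult_left_mono) auto
    then show "norm (X \<tau>' \<phi> t - X \<tau> \<phi> t) \<le> G * (2 * B) * \<bar>\<tau>' - \<tau>\<bar>" using le[OF t] by simp
  qed (use G B in \<open>auto simp: \<delta>_def\<close>)
qed

lemma X_origin_continuous:
  assumes \<phi>: "continuous_on UNIV \<phi>"
  shows "continuous_on {0..T} (\<lambda>\<tau>. X \<tau> \<phi> 0)"
  unfolding continuous_on_iff
proof (intro ballI allI impI)
  fix \<tau> e :: real assume \<tau>: "\<tau> \<in> {0..T}" and e: "e > 0"
  obtain L \<delta> where L: "L \<ge> 0" "\<delta> > 0" "\<And>\<tau>' t. \<tau>' \<in> {0..T} \<Longrightarrow> \<bar>\<tau>' - \<tau>\<bar> < \<delta> \<Longrightarrow> t \<in> {0..T} \<Longrightarrow>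
      norm (X \<tau>' \<phi> t - X \<tau> \<phi> t) \<le> L * \<bar>\<tau>' - \<tau>\<bar>" using X_lipschitz[OF \<tau> \<phi>] by blast
  show "\<exists>d>0. \<forall>\<tau>'\<in>{0..T}. dist \<tau>' \<tau> < d \<longrightarrow> dist (X \<tau>' \<phi> 0) (X \<tau> \<phi> 0) < e"
  proof (intro exI[of _ "min \<delta> (e / (L + 1))"] conjI ballI impI)
    fix \<tau>' assume \<tau>': "\<tau>' \<in> {0..T}" "dist \<tau>' \<tau> < min \<delta> (e / (L + 1))"
    have "norm (X \<tau>' \<phi> 0 - X \<tau> \<phi> 0) \<le> L * \<bar>\<tau>' - \<tau>\<bar>"
      using \<tau>' T by (intro L) (auto simp: dist_real_def)
    also have "\<dots> \<le> (L + 1) * \<bar>\<tau>' - \<tau>\<bar>" by (intro mult_right_mono) auto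
    also have "\<dots> < (L + 1) * (e / (L + 1))"
      using \<tau>' L(1) by (intro mult_strict_left_mono) (auto simp: dist_real_def)
    also have "\<dots> = e" using L(1) by simp
    finally show "dist (X \<tau>' \<phi> 0) (X \<tau> \<phi> 0) < e" by (simp add: dist_norm)
  qed (use L e in auto)
qed

text \<open>By \<open>X_difference\<close> the increment is the integral of
  \<open>gam \<tau> 0 v\<close> times the new solution between the endpoints. Up to the Lipschitz
  error the new solution may be replaced by the old one, and the resulting integrand is continuous
  at \<open>\<tau>\<close>. Positivity of \<open>\<tau>\<close> keeps \<open>v\<close> away from the
  jump of \<open>gam \<tau> 0\<close> at 0.\<close>

lemma X_origin_derivative:
  assumes \<tau>: "0 < \<tau>" "\<tau> \<le> T" and \<phi>: "continuous_on UNIV \<phi>"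
  shows "((\<lambda>\<tau>. X \<tau> \<phi> 0) has_vector_derivative gam \<tau> 0 \<tau> ** X \<tau> \<phi> \<tau>) (at \<tau> within {0..T})"
proof -
  have \<tau>T: "\<tau> \<in> {0..T}" using \<tau> by simp
  define A where "A = gam \<tau> 0 \<tau> ** X \<tau> \<phi> \<tau>"
  obtain G where G: "G \<ge> 0" "\<And>t' s. t' \<in> {-T..T} \<Longrightarrow> s \<in> {-T..T} \<Longrightarrow> norm (gam \<tau> t' s) \<le> G"
    using gam_bounded[OF \<tau>T] by blast
  obtain L \<delta> where L: "L \<ge> 0" "\<delta> > 0" "\<And>\<tau>' t. \<tau>' \<in> {0..T} \<Longrightarrow> \<bar>\<tau>' - \<tau>\<bar> < \<delta> \<Longrightarrow> t \<in> {0..T} \<Longrightarrow>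
      norm (X \<tau>' \<phi> t - X \<tau> \<phi> t) \<le> L * \<bar>\<tau>' - \<tau>\<bar>" using X_lipschitz[OF \<tau>T \<phi>] by blast
  have "continuous_on {0<..T} (\<lambda>v. gam \<tau> 0 v ** X \<tau> \<phi> v)"
  proof (intro mm.continuous_on X_continuous \<tau>T \<phi>)
    have "continuous_on {0<..T} (\<lambda>v. k (- v))"
      by (rule continuous_on_compose2[OF k_left]) (auto intro!: continuous_intros)
    moreover have "continuous_on {0<..T} (\<lambda>v. rho \<tau> 0 v)"
    proof -
      have "continuous_on {0<..T} (\<lambda>v. (0 :: real, v))"
        by (intro continuous_on_Pair continuous_on_id continuous_on_const)
      from continuous_on_compose2[OF rho_continuous[OF \<tau>T, of UNIV] this] show ?thesis by simp
    qed
    ultimately show "continuous_on {0<..T} (gam \<tau> 0)"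
      unfolding gam_def[abs_def] by (auto intro: continuous_on_add)
  qed
  note cont = this[unfolded continuous_on_iff, rule_format, of \<tau>]
  have "((\<lambda>\<tau>. X \<tau> \<phi> 0) has_derivative (\<lambda>h. h *\<^sub>R A)) (at \<tau> within {0..T})"
    unfolding has_derivative_within_alt
  proof (intro conjI allI impI)
    show "bounded_linear (\<lambda>h. h *\<^sub>R A)" by (rule bounded_linear_scaleR_left)
    fix e :: real assume e: "e > 0"
    obtain d where d: "d > 0" "\<And>v. v \<in> {0<..T} \<Longrightarrow> dist v \<tau> < d \<Longrightarrow>
        dist (gam \<tau> 0 v ** X \<tau> \<phi> v) (gam \<tau> 0 \<tau> ** X \<tau> \<phi> \<tau>) < e / 2"
      using cont[of "e / 2"] \<tau> e by auto
    \<comment> \<open>The bounds give, in order, the Lipschitz estimate, continuity of the integrand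
      at \<open>\<tau>\<close>, an integration interval inside the positive axis, and a Lipschitz
      error of at most \<open>e / 2\<close>; the summand 1 avoids division by 0.\<close>
    define d' where "d' = min (min \<delta> d) (min \<tau> (e / (2 * (G * L + 1))))"
    have GL: "G * L \<ge> 0" using G(1) L(1) by simp
    show "\<exists>d>0. \<forall>\<tau>'\<in>{0..T}. norm (\<tau>' - \<tau>) < d \<longrightarrow>
        norm (X \<tau>' \<phi> 0 - X \<tau> \<phi> 0 - (\<tau>' - \<tau>) *\<^sub>R A) \<le> e * norm (\<tau>' - \<tau>)"
    proof (intro exI[of _ d'] conjI ballI impI)
      show "d' > 0" unfolding d'_def using L d \<tau> e GL by simp
      fix \<tau>' assume \<tau>': "\<tau>' \<in> {0..T}" "norm (\<tau>' - \<tau>) < d'"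
      have near: "\<bar>\<tau>' - \<tau>\<bar> < \<delta>" "\<bar>\<tau>' - \<tau>\<bar> < d" "\<bar>\<tau>' - \<tau>\<bar> < \<tau>" "\<bar>\<tau>' - \<tau>\<bar> < e / (2 * (G * L + 1))"
        using \<tau>'(2) by (auto simp: d'_def)
      let ?D = "\<lambda>v. cutoff {0..\<tau>'} (X \<tau>' \<phi>) v - cutoff {0..\<tau>} (X \<tau>' \<phi>) v"
      let ?A = "\<lambda>v. (indicator {0..\<tau>'} v - indicator {0..\<tau>} v) *\<^sub>R A"
      let ?J = "{min \<tau> \<tau>'..max \<tau> \<tau>'}"
      have D: "lcs ?D" using \<tau>T \<tau>' \<phi> by (intro lcs_diff lcs_cutoff_continuous X_continuous) auto
      have iA: "integrable lborel ?A" "(LINT v|lborel. ?A v) = (\<tau>' - \<tau>) *\<^sub>R A"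
        using \<tau>T \<tau>' by (auto simp: scaleR_diff_left)
      have close: "norm (gam \<tau> 0 v ** X \<tau>' \<phi> v - A) \<le> e" if v: "v \<in> ?J" for v
      proof -
        have v': "v \<in> {0<..T}" "dist v \<tau> < d" "v \<in> {0..T}"
          using v near \<tau>T \<tau>' by (auto simp: dist_real_def min_def max_def split: if_splits)
        have "gam \<tau> 0 v ** X \<tau>' \<phi> v - A
            = gam \<tau> 0 v ** (X \<tau>' \<phi> v - X \<tau> \<phi> v) + (gam \<tau> 0 v ** X \<tau> \<phi> v - A)"
          by (simp add: mm.diff_right)
        also have "norm \<dots> \<le> G * (L * \<bar>\<tau>' - \<tau>\<bar>) + e / 2"
        proof (intro order_trans[OF norm_triangle_ineq] add_mono order_trans[OF norm_matrix_mult_le] mult_mono)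
          show "norm (gam \<tau> 0 v) \<le> G" using v' T by (intro G) auto
          show "norm (X \<tau>' \<phi> v - X \<tau> \<phi> v) \<le> L * \<bar>\<tau>' - \<tau>\<bar>" by (intro L \<tau>' near v')
          show "norm (gam \<tau> 0 v ** X \<tau> \<phi> v - A) \<le> e / 2"
            using d(2)[OF v'(1,2)] by (simp add: A_def dist_norm)
        qed (use G in auto)
        also have "G * (L * \<bar>\<tau>' - \<tau>\<bar>) \<le> e / 2"
        proof -
          have "G * (L * \<bar>\<tau>' - \<tau>\<bar>) \<le> (G * L + 1) * \<bar>\<tau>' - \<tau>\<bar>" by (simp add: algebra_simps)
          also have "\<dots> \<le> (G * L + 1) * (e / (2 * (G * L + 1)))"
            using near(4) GL by (intro mult_left_mono) auto
          also have "\<dots> = e / 2" using GL by (simp add: field_simps)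
          finally show ?thesis .
        qed
        finally show ?thesis by simp
      qed
      have eq: "X \<tau>' \<phi> 0 - X \<tau> \<phi> 0 - (\<tau>' - \<tau>) *\<^sub>R A = (LINT v|lborel. gam \<tau> 0 v ** ?D v - ?A v)"
        unfolding X_difference[OF \<tau>T \<tau>'(1) \<phi>] Gint_def
        using Gint_integrable[OF \<tau>T D] iA by simp
      have "norm (X \<tau>' \<phi> 0 - X \<tau> \<phi> 0 - (\<tau>' - \<tau>) *\<^sub>R A) \<le> (LINT v|lborel. norm (gam \<tau> 0 v ** ?D v - ?A v))"
        unfolding eq by (rule integral_norm_bound)
      also have "\<dots> \<le> (LINT v|lborel. e * indicator ?J v)"
      proof (rule integral_mono)
        show "integrable lborel (\<lambda>v. norm (gam \<tau> 0 v ** ?D v - ?A v))"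
          using Gint_integrable[OF \<tau>T D] iA by simp
        show "norm (gam \<tau> 0 v ** ?D v - ?A v) \<le> e * indicator ?J v" for v
        proof -
          define c :: real where "c = indicator {0..\<tau>'} v - indicator {0..\<tau>} v"
          have "?D v = c *\<^sub>R X \<tau>' \<phi> v" by (auto simp: cutoff_def c_def indicator_def)
          then have eq: "gam \<tau> 0 v ** ?D v - ?A v = c *\<^sub>R (gam \<tau> 0 v ** X \<tau>' \<phi> v - A)"
            by (simp add: c_def[symmetric] mm.scaleR_right scaleR_diff_right)
          show ?thesis
          proof (cases "v \<in> ?J")
            case True
            have "\<bar>c\<bar> \<le> 1" by (auto simp: c_def indicator_def)
            then have "\<bar>c\<bar> * norm (gam \<tau> 0 v ** X \<tau>' \<phi> v - A) \<le> 1 * e"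
              using close[OF True] by (intro mult_mono) auto
            then show ?thesis using True eq by simp
          next
            case False
            then have "c = 0" using \<tau>T \<tau>' by (auto simp: c_def indicator_def)
            then show ?thesis using e eq by simp
          qed
        qed
      qed simp
      also have "\<dots> = e * norm (\<tau>' - \<tau>)" by (simp add: max_def min_def abs_if)
      finally show "norm (X \<tau>' \<phi> 0 - X \<tau> \<phi> 0 - (\<tau>' - \<tau>) *\<^sub>R A) \<le> e * norm (\<tau>' - \<tau>)" .
    qed
  qed
  then show ?thesis by (simp add: has_vector_derivative_def A_def)
qed

end

text \<open>The substitution of \<open>\<tau> - v\<close> for \<open>v\<close> maps the interval to
  itself and reverses the sign of every lag, so it exchanges the two endpoints at the price of
  reflecting the kernel.\<close>

lemma Kop_reflect:
  "conv (\<lambda>x. k (- x)) (cutoff {0..\<tau>} (\<lambda>v. x (\<tau> - v))) t = conv k (cutoff {0..\<tau>} x) (\<tau> - t)"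
  unfolding conv_def
  by (subst lborel_integral_real_affine[of "-1" _ \<tau>])
    (auto simp: cutoff_def algebra_simps intro!: Bochner_Integration.integral_cong)

lemma (in jump_kernel) mirror: "jump_kernel T (\<lambda>x. k (- x))"
proof
  show "0 < T" by (rule T)
  show "bcs (\<lambda>x. k (- x))" by (rule bcs_mirror[OF k_bcs])
  show "T < \<bar>x\<bar> \<Longrightarrow> k (- x) = 0" for x by (rule k_out) simp
  show "isCont (\<lambda>x. k (- x)) x" if "x \<notin> {0, T, -T}" for x
    by (rule isCont_o2[of _ uminus]) (use that k_cont in \<open>auto simp: minus_equation_iff[of x]\<close>)
  show "continuous_on {-T..<0} (\<lambda>x. k (- x))"
    by (rule continuous_on_compose2[OF k_right]) (auto intro!: continuous_intros)
  show "continuous_on {0<..T} (\<lambda>x. k (- x))"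
    by (rule continuous_on_compose2[OF k_left]) (auto intro!: continuous_intros)
  have flip: "continuous_on {0..\<tau>} (\<lambda>v. x (\<tau> - v))" if "continuous_on {0..\<tau>} x"
    for \<tau> and x :: "real \<Rightarrow> complex^'r^'r"
    by (rule continuous_on_compose2[OF that]) (auto intro!: continuous_intros)
  fix \<tau> assume \<tau>: "\<tau> \<in> {0..T}"
  obtain C where C: "\<forall>x B. continuous_on {0..\<tau>} x \<longrightarrow>
      (\<forall>t\<in>{0..\<tau>}. norm (x t - Kop \<tau> x t) \<le> B) \<longrightarrow> (\<forall>t\<in>{0..\<tau>}. norm (x t) \<le> C * B)"
    using apriori[OF \<tau>] by blast
  show "\<exists>C. \<forall>x B. continuous_on {0..\<tau>} x \<longrightarrow>
      (\<forall>t\<in>{0..\<tau>}. norm (x t - conv (\<lambda>x. k (- x)) (cutoff {0..\<tau>} x) t :: complex^'r^'r) \<le> B) \<longrightarrow>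
      (\<forall>t\<in>{0..\<tau>}. norm (x t) \<le> C * B)"
  proof (intro exI[of _ C] allI impI ballI)
    fix x B t assume x: "continuous_on {0..\<tau>} x"
      "\<forall>t\<in>{0..\<tau>}. norm (x t - conv (\<lambda>x. k (- x)) (cutoff {0..\<tau>} x) t :: complex^'r^'r) \<le> B"
      and t: "t \<in> {0..\<tau>}"
    have "norm (x (\<tau> - s) - Kop \<tau> (\<lambda>v. x (\<tau> - v)) s) \<le> B" if "s \<in> {0..\<tau>}" for s
      using x(2)[rule_format, of "\<tau> - s"] that Kop_reflect[of k \<tau> "\<lambda>v. x (\<tau> - v)" "\<tau> - s"] by simp
    then have "norm (x (\<tau> - (\<tau> - t))) \<le> C * B"
      using t by (intro C[rule_format, OF flip[OF x(1)], of B "\<tau> - t"]) auto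
    then show "norm (x t) \<le> C * B" by simp
  qed
  fix \<phi> :: "real \<Rightarrow> complex^'r^'r" assume \<phi>: "continuous_on {0..\<tau>} \<phi>"
  obtain x where x: "continuous_on {0..\<tau>} x" "\<And>t. t \<in> {0..\<tau>} \<Longrightarrow> x t = \<phi> (\<tau> - t) + Kop \<tau> x t"
    using solvable[OF \<tau> flip[OF \<phi>]] by blast
  show "\<exists>x :: real \<Rightarrow> complex^'r^'r. continuous_on {0..\<tau>} x \<and>
      (\<forall>t\<in>{0..\<tau>}. x t = \<phi> t + conv (\<lambda>x. k (- x)) (cutoff {0..\<tau>} x) t)"
    using flip[OF x(1)] x(2)[of "\<tau> - _"]
    by (intro exI[of _ "\<lambda>v. x (\<tau> - v)"]) (auto simp: Kop_reflect)
qed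

text \<open>Measurability is asked of \<open>h\<close> alone, since it survives a change of one
  value. This absorbs the value of an accelerant at 0, which enters a convolution at a single
  point.\<close>

lemma integral_cong_except:
  fixes h :: "real \<Rightarrow> 'v::{banach, second_countable_topology}"
  assumes [measurable]: "h \<in> borel_measurable borel" and eq: "\<And>s. s \<noteq> t \<Longrightarrow> g s = h s"
  shows "(LINT s|lborel. g s) = (LINT s|lborel. h s)"
proof (rule integral_cong_AE)
  have "g = (\<lambda>s. if s = t then g t else h s)" using eq by auto
  also have "\<dots> \<in> borel_measurable lborel" by measurable
  finally show "g \<in> borel_measurable lborel" .
  show "AE s in lborel. g s = h s"
    using AE_lborel_singleton[of t] by eventually_elim (rule eq)
qed simp

section \<open>Accelerants\<close>

text \<open>The values of an accelerant at \<open>0\<close> and outside \<open>[-T, T]\<close> are arbitrary, possibly making it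
  non-measurable, and are replaced by \<open>0\<close>.\<close>

definition punctured :: "real \<Rightarrow> (real \<Rightarrow> complex^'r^'r) \<Rightarrow> real \<Rightarrow> complex^'r^'r" where
  "punctured T k = cutoff ({-T..T} - {0}) k"

lemma continuous_extension_right:
  fixes k :: "real \<Rightarrow> 'v::real_normed_vector"
  assumes "continuous_on {0<..T} k" "(k \<longlongrightarrow> l) (at_right 0)" "T > 0"
  shows "continuous_on {0..T} (\<lambda>x. if x = 0 then l else k x)"
  unfolding continuous_on_eq_continuous_within
proof
  fix x assume x: "x \<in> {0..T}"
  show "continuous (at x within {0..T}) (\<lambda>x. if x = 0 then l else k x)"
  proof (cases "x = 0")
    case True
    have "((\<lambda>x. if x = 0 then l else k x) \<longlongrightarrow> l) (at_right 0)"
      by (rule Lim_transform_eventually[OF assms(2)])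
        (auto simp: eventually_at_filter intro!: always_eventually)
    then show ?thesis
      using True assms(3) by (simp add: continuous_within at_within_Icc_at_right)
  next
    case False
    then have "x \<in> {0<..T}" using x by auto
    then have "continuous (at x within {0<..T}) k"
      using assms(1) by (simp add: continuous_on_eq_continuous_within)
    moreover have "at x within {0..T} = at x within {0<..T}"
      by (rule at_within_nhd[of _ "{0<..}"]) (use \<open>x \<in> {0<..T}\<close> in auto)
    ultimately have "continuous (at x within {0..T}) k" by simp
    then show ?thesis
      unfolding continuous_within
      by (rule Lim_transform_eventually[THEN tendsto_eq_rhs])
        (use False \<open>x \<in> {0<..T}\<close> in \<open>auto simp: eventually_at intro!: exI[of _ x]\<close>)
  qed
qed

lemma continuous_extension_left:
  fixes k :: "real \<Rightarrow> 'v::real_normed_vector"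
  assumes "continuous_on {-T..<0} k" "(k \<longlongrightarrow> l) (at_left 0)" "T > 0"
  shows "continuous_on {-T..0} (\<lambda>x. if x = 0 then l else k x)"
proof -
  have "continuous_on {0<..T} (\<lambda>x. k (- x))"
    by (rule continuous_on_compose2[OF assms(1)]) (auto intro!: continuous_intros)
  moreover have "((\<lambda>x. k (- x)) \<longlongrightarrow> l) (at_right 0)"
    using assms(2) by (simp add: filterlim_at_left_to_right)
  ultimately have "continuous_on {0..T} (\<lambda>x. if x = 0 then l else k (- x))"
    by (rule continuous_extension_right[OF _ _ assms(3)])
  then have "continuous_on {-T..0} (\<lambda>x. (\<lambda>x. if x = 0 then l else k (- x)) (- x))"
    by (rule continuous_on_compose2) (auto intro!: continuous_intros)
  then show ?thesis by (simp cong: if_cong)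
qed

section \<open>From vector equations to matrix equations, column by column\<close>

lemma column_mult: "column j (A ** B) = A *v column j B"
  by (simp add: column_def matrix_matrix_mult_def matrix_vector_mult_def vec_eq_iff)

lemma bounded_linear_column: "bounded_linear (column j :: complex^'n^'m \<Rightarrow> complex^'m)"
  unfolding column_def by (intro bounded_linearI' ) (auto simp: vec_eq_iff)

lemma column_add: "column j (A + B) = column j A + column j B"
  and column_diff: "column j (A - B) = column j A - (column j B :: complex^'m)"
  and column_zero [simp]: "column j 0 = 0"
  by (simp_all add: column_def vec_eq_iff)

lemma cutoff_column: "cutoff S (\<lambda>s. column j (x s)) = (\<lambda>s. column j (cutoff S x s))"
  for x :: "real \<Rightarrow> complex^'n^'m"
  by (auto simp: cutoff_def)

lemma norm_column_le: "norm (column j A) \<le> norm A" for A :: "complex^'n^'m"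
proof (rule power2_le_imp_le)
  have "(norm (column j A))\<^sup>2 = (\<Sum>i\<in>UNIV. (norm (A $ i $ j))\<^sup>2)"
    by (simp add: norm_vec_def L2_set_def sum_nonneg column_def)
  also have "\<dots> \<le> (norm A)\<^sup>2"
    unfolding norm_matrix_sq by (intro sum_mono member_le_sum) auto
  finally show "(norm (column j A))\<^sup>2 \<le> (norm A)\<^sup>2" .
qed simp

lemma norm_le_sum_column:
  fixes A :: "complex^'n^'m"
  shows "norm A \<le> (\<Sum>j\<in>UNIV. norm (column j A))"
proof -
  have "(norm A)\<^sup>2 = (\<Sum>j\<in>UNIV. (norm (column j A))\<^sup>2)"
    unfolding norm_matrix_sq by (subst sum.swap) (simp add: norm_vec_def L2_set_def sum_nonneg column_def)
  then have "norm A = L2_set (\<lambda>j. norm (column j A)) UNIV"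
    unfolding L2_set_def by (metis norm_ge_zero real_sqrt_unique)
  also have "\<dots> \<le> (\<Sum>j\<in>UNIV. norm (column j A))" by (rule L2_set_le_sum) simp
  finally show ?thesis .
qed

lemma punctured_bcs:
  assumes T: "T > 0" and acc: "accelerant T k"
  shows "bcs (punctured T k)"
proof -
  have c: "continuous_on {-T..<0} k" "continuous_on {0<..T} k" using acc by (auto simp: accelerant_def)
  obtain l where l: "(k \<longlongrightarrow> l) (at_left 0)" using acc by (auto simp: accelerant_def)
  obtain r where r: "(k \<longlongrightarrow> r) (at_right 0)" using acc by (auto simp: accelerant_def)
  obtain B1 where B1: "\<And>x. x \<in> {-T..0} \<Longrightarrow> norm (if x = 0 then l else k x) \<le> B1"
    using compact_imp_bounded[OF compact_continuous_image[OF continuous_extension_left[OF c(1) l T] compact_Icc]]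
    unfolding bounded_iff by blast
  obtain B2 where B2: "\<And>x. x \<in> {0..T} \<Longrightarrow> norm (if x = 0 then r else k x) \<le> B2"
    using compact_imp_bounded[OF compact_continuous_image[OF continuous_extension_right[OF c(2) r T] compact_Icc]]
    unfolding bounded_iff by blast
  define S where "S = max T (max \<bar>B1\<bar> \<bar>B2\<bar>)"
  have "norm (punctured T k x) \<le> S \<and> (S < \<bar>x\<bar> \<longrightarrow> punctured T k x = 0)" for x
    using B1[of x] B2[of x] T by (cases "x < 0") (auto simp: punctured_def cutoff_def S_def le_max_iff_disj)
  moreover have "punctured T k = (\<lambda>x. cutoff {-T..<0} k x + cutoff {0<..T} k x)"
    by (auto simp: punctured_def cutoff_def)
  moreover have "cutoff {-T..<0} k \<in> borel_measurable borel" "cutoff {0<..T} k \<in> borel_measurable borel"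
    unfolding cutoff_eq_indicator using c by (auto intro!: borel_measurable_continuous_on_indicator)
  ultimately show ?thesis unfolding bcs_def by auto
qed

text \<open>Links the vector operator of the accelerant condition with matrix convolution by the
  punctured kernel. On the interval all lags have modulus at most \<open>T\<close>, and lag 0 occurs
  only for \<open>s = t\<close>.\<close>

lemma T_op_column:
  fixes k x :: "real \<Rightarrow> complex^'r^'r"
  assumes acc: "bcs (punctured T k)" and \<tau>: "0 \<le> \<tau>" "\<tau> \<le> T" and x: "lcs (cutoff {0..\<tau>} x)"
    and t: "t \<in> {0..\<tau>}"
  shows "T_op k \<tau> (\<lambda>s. column j (x s)) t = column j (x t - conv (punctured T k) (cutoff {0..\<tau>} x) t)"
proof -
  note bl = bounded_linear_column[of j]
  note [measurable] = bcs_measurable[OF acc] lcs_measurable[OF x]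
  have col: "column j \<in> borel_measurable (borel :: (complex^'r^'r) measure)"
    by (intro borel_measurable_continuous_onI linear_continuous_on bl)
  have "column j (conv (punctured T k) (cutoff {0..\<tau>} x) t)
      = (LINT s|lborel. column j (punctured T k (t - s) ** cutoff {0..\<tau>} x s))"
    unfolding conv_def by (rule integral_bounded_linear[OF bl conv_integrand[OF acc lcs_integrable[OF x]], symmetric])
  also have "\<dots> = (LINT s:{0..\<tau>}|lborel. k (t - s) *v column j (x s))"
    unfolding set_lebesgue_integral_def
  proof (rule integral_cong_except[symmetric])
    show "(\<lambda>s. column j (punctured T k (t - s) ** cutoff {0..\<tau>} x s)) \<in> borel_measurable borel"
      by (rule measurable_compose[OF _ col]) measurable
    show "indicator {0..\<tau>} s *\<^sub>R (k (t - s) *v column j (x s))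
        = column j (punctured T k (t - s) ** cutoff {0..\<tau>} x s)" if "s \<noteq> t" for s
    proof (cases "s \<in> {0..\<tau>}")
      case True
      then have "t - s \<in> {-T..T} - {0}" using t \<tau> that by auto
      then show ?thesis using True by (simp add: punctured_def cutoff_def column_mult)
    qed (auto simp: cutoff_def)
  qed
  finally show ?thesis
    by (simp add: T_op_def column_diff)
qed

text \<open>The bounded inverse controls the integral norm of each column by the defect, and one
  application of the bounded kernel upgrades this to a supremum bound. For existence the columns are
  solved separately, and inserting the solution into the equation once more yields a continuous
  representative.\<close>

lemma accelerant_jump_kernel:
  fixes k :: "real \<Rightarrow> complex^'r^'r"
  assumes T: "T > 0" and acc: "accelerant T k"
  shows "jump_kernel T (punctured T k)"
proof
  let ?k = "punctured T k"
  have c: "continuous_on {-T..<0} k" "continuous_on {0<..T} k" using acc by (auto simp: accelerant_def)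
  show "0 < T" by (rule T)
  show bcs: "bcs ?k" by (rule punctured_bcs[OF T acc])
  show "T < \<bar>x\<bar> \<Longrightarrow> ?k x = 0" for x by (auto simp: punctured_def cutoff_def)
  show left: "continuous_on {-T..<0} ?k"
    by (rule continuous_on_eq[OF c(1)]) (use T in \<open>auto simp: punctured_def cutoff_def\<close>)
  show right: "continuous_on {0<..T} ?k"
    by (rule continuous_on_eq[OF c(2)]) (use T in \<open>auto simp: punctured_def cutoff_def\<close>)
  show "isCont ?k x" if "x \<notin> {0, T, -T}" for x
  proof -
    have "continuous_on {..<-T} ?k" "continuous_on {T<..} ?k"
      by (rule continuous_on_eq[OF continuous_on_const[of _ 0]]; auto simp: punctured_def cutoff_def)+
    moreover have "continuous_on {-T<..<0} ?k" "continuous_on {0<..<T} ?k"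
      by (rule continuous_on_subset[OF left] continuous_on_subset[OF right]; auto)+
    moreover have "x < -T \<or> T < x \<or> (-T < x \<and> x < 0) \<or> (0 < x \<and> x < T)" using that by auto
    ultimately show ?thesis by (auto simp: continuous_on_eq_continuous_at)
  qed
  obtain M where M: "M \<ge> 0" "\<And>x. norm (?k x) \<le> M" using bcs by (rule bcsE) blast
  \<comment> \<open>The accelerant condition concerns positive lengths; at length 0 the integral
    operator vanishes and both claims are immediate.\<close>
  have zero: "conv ?k (cutoff {0} x) 0 = 0" for x :: "real \<Rightarrow> complex^'r^'r"
    by (rule conv_zero) (auto simp: cutoff_def)
  note bl = bounded_linear_column
  fix \<tau> assume \<tau>: "\<tau> \<in> {0..T}"
  show "\<exists>C. \<forall>x B. continuous_on {0..\<tau>} x \<longrightarrow>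
      (\<forall>t\<in>{0..\<tau>}. norm (x t - conv ?k (cutoff {0..\<tau>} x) t :: complex^'r^'r) \<le> B) \<longrightarrow>
      (\<forall>t\<in>{0..\<tau>}. norm (x t) \<le> C * B)"
  proof (cases "\<tau> = 0")
    case True
    then show ?thesis by (intro exI[of _ 1]) (auto simp: zero)
  next
    case False
    then have "0 < \<tau> \<and> \<tau> \<le> T" using \<tau> by auto
    then obtain R where R: "L1_inverse {0..\<tau>} (T_op k \<tau>) R"
      using acc unfolding accelerant_def L1_invertible_def by blast
    then obtain C where C: "\<And>f. f \<in> L1 {0..\<tau>} \<Longrightarrow> L1_norm {0..\<tau>} (R f) \<le> C * L1_norm {0..\<tau>} f"
      unfolding L1_inverse_def bounded_L1_operator_def by blast
    \<comment> \<open>The summand 1 accounts for the defect itself; the rest is the kernel bound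
      times the integral norm of \<open>x\<close>, estimated by the sum over its columns.\<close>
    define C' where "C' = 1 + M * (real CARD('r) * (\<bar>C\<bar> * \<tau>))"
    show ?thesis
    proof (intro exI[of _ C'] allI impI ballI)
      fix x B t assume x: "continuous_on {0..\<tau>} x"
        and B: "\<forall>t\<in>{0..\<tau>}. norm (x t - conv ?k (cutoff {0..\<tau>} x) t :: complex^'r^'r) \<le> B"
        and t: "t \<in> {0..\<tau>}"
      have B0: "B \<ge> 0" using order_trans[OF norm_ge_zero B[rule_format, OF t]] .
      have lx: "lcs (cutoff {0..\<tau>} x)" by (rule lcs_cutoff_continuous[OF x])
      have col: "L1_norm {0..\<tau>} (\<lambda>s. column j (x s)) \<le> \<bar>C\<bar> * (B * \<tau>)" for j
      proof -
        define f where "f = (\<lambda>s. column j (x s))"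
        have f: "f \<in> L1 {0..\<tau>}"
          unfolding L1_def set_integrable_iff_cutoff f_def cutoff_column mem_Collect_eq
          by (rule integrable_bounded_linear[OF bl lcs_integrable[OF lx]])
        have Tf: "T_op k \<tau> f \<in> L1 {0..\<tau>}"
          using R f unfolding L1_inverse_def bounded_L1_operator_def by blast
        have "L1_norm {0..\<tau>} f = L1_norm {0..\<tau>} (R (T_op k \<tau> f))"
        proof -
          have RTf: "R (T_op k \<tau> f) \<in> L1 {0..\<tau>}"
            using R Tf unfolding L1_inverse_def bounded_L1_operator_def by blast
          have "AE s in lborel. norm (cutoff {0..\<tau>} f s) = norm (cutoff {0..\<tau>} (R (T_op k \<tau> f)) s)"
          proof -
            have "AE s\<in>{0..\<tau>} in lborel. R (T_op k \<tau> f) s = f s"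
              using R f unfolding L1_inverse_def by blast
            then show ?thesis by eventually_elim (auto simp: cutoff_def)
          qed
          then show ?thesis
            unfolding L1_norm_eq using f RTf
            by (intro integral_cong_AE) (auto simp: L1_def set_integrable_iff_cutoff)
        qed
        also have "\<dots> \<le> C * L1_norm {0..\<tau>} (T_op k \<tau> f)" by (rule C[OF Tf])
        also have "\<dots> \<le> \<bar>C\<bar> * L1_norm {0..\<tau>} (T_op k \<tau> f)"
          by (intro mult_right_mono) (auto simp: L1_norm_eq)
        also have "L1_norm {0..\<tau>} (T_op k \<tau> f) \<le> (LINT s|lborel. B * indicator {0..\<tau>} s)"
          unfolding L1_norm_eq
        proof (rule integral_mono)
          show "integrable lborel (\<lambda>s. norm (cutoff {0..\<tau>} (T_op k \<tau> f) s))"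
            using Tf by (simp add: L1_def set_integrable_iff_cutoff)
          show "norm (cutoff {0..\<tau>} (T_op k \<tau> f) s) \<le> B * indicator {0..\<tau>} s" for s
          proof (cases "s \<in> {0..\<tau>}")
            case True
            have "norm (T_op k \<tau> f s) \<le> norm (x s - conv ?k (cutoff {0..\<tau>} x) s)"
              unfolding f_def using T_op_column[OF bcs _ _ lx True] \<tau> by (simp add: norm_column_le)
            then show ?thesis using B True by (force simp: cutoff_def)
          qed (auto simp: cutoff_def)
        qed (use \<tau> in simp)
        finally show ?thesis using \<tau> by (simp add: f_def mult_left_mono)
      qed
      have "(LINT s|lborel. norm (cutoff {0..\<tau>} x s)) \<le> (LINT s|lborel. (\<Sum>j\<in>UNIV. norm (cutoff {0..\<tau>} (\<lambda>s. column j (x s)) s)))"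
      proof (rule integral_mono)
        show "norm (cutoff {0..\<tau>} x s) \<le> (\<Sum>j\<in>UNIV. norm (cutoff {0..\<tau>} (\<lambda>s. column j (x s)) s))" for s
          unfolding cutoff_column by (rule norm_le_sum_column)
        show "integrable lborel (\<lambda>s. \<Sum>j\<in>UNIV. norm (cutoff {0..\<tau>} (\<lambda>s. column j (x s)) s))"
          unfolding cutoff_column
          by (intro Bochner_Integration.integrable_sum integrable_norm integrable_bounded_linear[OF bl lcs_integrable[OF lx]])
      qed (use lcs_integrable[OF lx] in simp)
      also have "\<dots> = (\<Sum>j\<in>UNIV. L1_norm {0..\<tau>} (\<lambda>s. column j (x s)))"
        unfolding L1_norm_eq
      proof (rule Bochner_Integration.integral_sum)
        show "integrable lborel (\<lambda>s. norm (cutoff {0..\<tau>} (\<lambda>s. column j (x s)) s))" for j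
          unfolding cutoff_column by (intro integrable_norm integrable_bounded_linear[OF bl lcs_integrable[OF lx]])
      qed
      also have "\<dots> \<le> (\<Sum>j\<in>(UNIV :: 'r set). \<bar>C\<bar> * (B * \<tau>))" by (intro sum_mono col)
      finally have I: "(LINT s|lborel. norm (cutoff {0..\<tau>} x s)) \<le> real CARD('r) * (\<bar>C\<bar> * (B * \<tau>))" by simp
      have "norm (conv ?k (cutoff {0..\<tau>} x) t) \<le> M * (LINT s|lborel. norm (cutoff {0..\<tau>} x s))"
        by (rule conv_norm_le[OF bcs lcs_integrable[OF lx] _ M(2)]) (use lcs_integrable[OF lx] in auto)
      also have "\<dots> \<le> M * (real CARD('r) * (\<bar>C\<bar> * (B * \<tau>)))" by (intro mult_left_mono I M)
      finally have "norm (conv ?k (cutoff {0..\<tau>} x) t) \<le> M * (real CARD('r) * (\<bar>C\<bar> * (B * \<tau>)))" .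
      moreover have "norm (x t) \<le> norm (x t - conv ?k (cutoff {0..\<tau>} x) t) + norm (conv ?k (cutoff {0..\<tau>} x) t)"
        using norm_triangle_ineq[of "x t - conv ?k (cutoff {0..\<tau>} x) t" "conv ?k (cutoff {0..\<tau>} x) t"] by simp
      ultimately show "norm (x t) \<le> C' * B"
        using B[rule_format, OF t] by (simp add: C'_def algebra_simps)
    qed
  qed
  fix \<phi> :: "real \<Rightarrow> complex^'r^'r" assume \<phi>: "continuous_on {0..\<tau>} \<phi>"
  show "\<exists>x :: real \<Rightarrow> complex^'r^'r. continuous_on {0..\<tau>} x \<and>
      (\<forall>t\<in>{0..\<tau>}. x t = \<phi> t + conv ?k (cutoff {0..\<tau>} x) t)"
  proof (cases "\<tau> = 0")
    case True
    then show ?thesis using \<phi> by (intro exI[of _ \<phi>]) (auto simp: zero)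
  next
    case False
    then have "0 < \<tau> \<and> \<tau> \<le> T" using \<tau> by auto
    then obtain R where R: "L1_inverse {0..\<tau>} (T_op k \<tau>) R"
      using acc unfolding accelerant_def L1_invertible_def by blast
    have l\<phi>: "lcs (cutoff {0..\<tau>} \<phi>)" by (rule lcs_cutoff_continuous[OF \<phi>])
    define \<phi>c where "\<phi>c j = (\<lambda>s. column j (\<phi> s))" for j
    have \<phi>c: "\<phi>c j \<in> L1 {0..\<tau>}" for j
      unfolding L1_def set_integrable_iff_cutoff \<phi>c_def cutoff_column mem_Collect_eq
      by (rule integrable_bounded_linear[OF bl lcs_integrable[OF l\<phi>]])
    define f where "f j = R (\<phi>c j)" for j
    have f: "f j \<in> L1 {0..\<tau>}" for j
      using R \<phi>c unfolding f_def L1_inverse_def bounded_L1_operator_def by blast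
    define Y where "Y s = (\<chi> i j. f j s $ i)" for s
    have colY: "column j (Y s) = f j s" for j s by (simp add: Y_def column_def vec_eq_iff)
    have Y: "lcs (cutoff {0..\<tau>} Y)"
    proof -
      let ?L = "\<lambda>j v. (\<chi> i j'. if j' = j then v $ i else 0) :: complex^'r^'r"
      have L: "bounded_linear (?L j)" for j :: 'r
        by (intro bounded_linearI') (auto simp: vec_eq_iff)
      have "cutoff {0..\<tau>} Y = (\<lambda>s. \<Sum>j\<in>UNIV. ?L j (cutoff {0..\<tau>} (f j) s))"
        by (auto simp: cutoff_def Y_def vec_eq_iff fun_eq_iff if_distrib cong: if_cong)
      moreover have "integrable lborel (\<lambda>s. \<Sum>j\<in>UNIV. ?L j (cutoff {0..\<tau>} (f j) s))"
        using f unfolding L1_def set_integrable_iff_cutoff mem_Collect_eq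
        by (intro Bochner_Integration.integrable_sum integrable_bounded_linear[OF L]) auto
      ultimately have "integrable lborel (cutoff {0..\<tau>} Y)" by simp
      moreover have "\<forall>s. \<tau> < \<bar>s\<bar> \<longrightarrow> cutoff {0..\<tau>} Y s = 0" by (auto simp: cutoff_def)
      ultimately show ?thesis unfolding lcs_def by blast
    qed
    \<comment> \<open>The right-hand side of the equation is continuous although \<open>Y\<close> is
      only integrable, and it agrees with \<open>Y\<close> almost everywhere.\<close>
    define x where "x t = \<phi> t + conv ?k (cutoff {0..\<tau>} Y) t" for t
    have cx: "continuous_on {0..\<tau>} x"
      unfolding x_def using \<open>\<And>x. x \<notin> {0, T, -T} \<Longrightarrow> isCont ?k x\<close>
      by (intro continuous_on_add \<phi> conv_continuous[OF bcs _ _ Y, of "{0, T, -T}"]) auto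
    have lx: "lcs (cutoff {0..\<tau>} x)" by (rule lcs_cutoff_continuous[OF cx])
    have col: "AE t\<in>{0..\<tau>} in lborel. column j (x t) = f j t" for j
    proof -
      have "AE t\<in>{0..\<tau>} in lborel. T_op k \<tau> (R (\<phi>c j)) t = \<phi>c j t"
        using R \<phi>c unfolding L1_inverse_def by blast
      then show ?thesis
      proof eventually_elim
        case (elim t)
        show ?case
        proof
          assume t: "t \<in> {0..\<tau>}"
          have "column j (Y t - conv ?k (cutoff {0..\<tau>} Y) t) = \<phi>c j t"
            using T_op_column[OF bcs _ _ Y t, of j] elim t \<tau> by (simp add: colY f_def)
          then show "column j (x t) = f j t"
            by (simp add: x_def \<phi>c_def colY column_add
                column_diff algebra_simps)
        qed
      qed
    qed
    have "AE t in lborel. cutoff {0..\<tau>} x t = cutoff {0..\<tau>} Y t"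
    proof -
      have "AE t in lborel. \<forall>j\<in>UNIV. t \<in> {0..\<tau>} \<longrightarrow> column j (x t) = f j t"
        using col by (subst AE_finite_all) auto
      then show ?thesis
      proof eventually_elim
        case (elim t)
        show ?case
        proof (cases "t \<in> {0..\<tau>}")
          case True
          then have "\<forall>j. column j (x t) = column j (Y t)" using elim by (simp add: colY)
          then have "x t = Y t" by (auto simp: column_def vec_eq_iff)
          then show ?thesis by (simp add: cutoff_def)
        qed (auto simp: cutoff_def)
      qed
    qed
    then have "conv ?k (cutoff {0..\<tau>} x) = conv ?k (cutoff {0..\<tau>} Y)"
      by (intro ext conv_cong_AE) (use bcs_measurable[OF bcs] lcs_measurable[OF lx] lcs_measurable[OF Y] in auto)
    then show ?thesis using cx by (intro exI[of _ x]) (simp add: x_def)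
  qed
qed

section \<open>The Krein system satisfied by the resolvent\<close>

definition wave :: "complex \<Rightarrow> real \<Rightarrow> complex^'r^'r" where
  "wave c t = cscale (exp (c * of_real t)) (mat 1)"

lemma wave_continuous: "continuous_on S (wave c)"
  unfolding wave_def[abs_def] by (intro cscale.continuous_on continuous_intros)

lemma wave_diff: "wave c (\<tau> - v) = cscale (exp (c * of_real \<tau>)) (wave (- c) v)"
  by (simp add: wave_def exp_add[symmetric] algebra_simps)

lemma (in jump_kernel) reg_wave: "reg \<tau> (wave c)"
  by (intro lcs_cutoff_continuous wave_continuous)

lemma (in jump_kernel) X_cscale:
  assumes "\<tau> \<in> {0..T}" "reg \<tau> \<phi>"
  shows "X \<tau> (\<lambda>t. cscale \<alpha> (\<phi> t)) t = cscale \<alpha> (X \<tau> \<phi> t)"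
proof -
  have "cutoff {0..\<tau>} (\<lambda>t. cscale \<alpha> (\<phi> t)) = (\<lambda>s. cscale \<alpha> (cutoff {0..\<tau>} \<phi> s))"
    by (auto simp: cutoff_def)
  then have "Gint \<tau> (cutoff {0..\<tau>} (\<lambda>t. cscale \<alpha> (\<phi> t))) t = cscale \<alpha> (Gint \<tau> (cutoff {0..\<tau>} \<phi>) t)"
    unfolding Gint_def
    by (simp add: cscale_mult_right
        integral_bounded_linear[OF cscale.bounded_linear_right Gint_integrable[OF assms]])
  then show ?thesis by (simp add: X_def cscale.add_right)
qed

locale hermitian_kernel = jump_kernel T k
  for T :: real and k :: "real \<Rightarrow> complex^'r^'r" +
  assumes herm: "\<And>x. k (- x) = ctrans (k x)"
begin

interpretation M: jump_kernel T "\<lambda>x. k (- x)"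
  by (rule mirror)

lemma X_reflect:
  assumes \<tau>: "\<tau> \<in> {0..T}" and \<phi>: "continuous_on UNIV \<phi>" and t: "t \<in> {0..\<tau>}"
  shows "M.X \<tau> (\<lambda>v. \<phi> (\<tau> - v)) t = X \<tau> \<phi> (\<tau> - t)"
proof (rule M.X_unique[OF \<tau> _ _ _ t, symmetric])
  have flip: "continuous_on S (\<lambda>v. \<psi> (\<tau> - v))" if "continuous_on UNIV \<psi>" for S and \<psi> :: "real \<Rightarrow> complex^'r^'r"
    by (rule continuous_on_compose2[OF that]) (auto intro!: continuous_intros)
  show "reg \<tau> (\<lambda>v. \<phi> (\<tau> - v))" by (intro lcs_cutoff_continuous flip \<phi>)
  show "reg \<tau> (\<lambda>t. X \<tau> \<phi> (\<tau> - t))" by (intro lcs_cutoff_continuous flip X_continuous \<tau> \<phi>)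
  have r: "reg \<tau> \<phi>" using \<phi> by (auto intro: lcs_cutoff_continuous continuous_on_subset)
  show "X \<tau> \<phi> (\<tau> - t) = \<phi> (\<tau> - t) + conv (\<lambda>x. k (- x)) (cutoff {0..\<tau>} (\<lambda>t. X \<tau> \<phi> (\<tau> - t))) t" for t
    using X_eq[OF \<tau> r, of "\<tau> - t"] by (simp add: Kop_reflect)
qed

text \<open>Row 0 of the reflected resolvent, reversed and conjugated, solves the equation that
  determines the column \<open>gam \<tau> _ \<tau>\<close>: \<open>gam_row\<close> supplies the
  equation and hermitian symmetry restores the kernel. Consequently the two endpoint equations have
  mutually adjoint coefficients.\<close>

lemma gam_mirror:
  assumes \<tau>: "\<tau> \<in> {0..T}"
  shows "M.gam \<tau> 0 \<tau> = ctrans (gam \<tau> 0 \<tau>)"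
proof -
  define y where "y w = ctrans (M.gam \<tau> 0 (\<tau> - w))" for w
  have y: "y = (\<lambda>w. k (w - \<tau>) + ctrans (M.rho \<tau> 0 (\<tau> - w)))"
    by (auto simp: y_def M.gam_def ctrans_add herm[symmetric])
  have c: "continuous_on S (\<lambda>w. ctrans (M.rho \<tau> 0 (\<tau> - w)))" for S
  proof -
    have "continuous_on S (\<lambda>w. (0 :: real, \<tau> - w))" by (intro continuous_intros)
    from continuous_on_compose2[OF M.rho_continuous[OF \<tau>, of UNIV] this]
    show ?thesis by (intro bounded_linear.continuous_on[OF bounded_linear_ctrans]) simp
  qed
  have reg_y: "reg \<tau> y" unfolding y by (intro reg_add reg_k_shift lcs_cutoff_continuous c)
  have eq: "y t = k (t - \<tau>) + Kop \<tau> y t" for t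
  proof -
    have int: "integrable lborel (\<lambda>s. M.gam \<tau> 0 s ** cutoff {0..\<tau>} (\<lambda>s. k (- (s - (\<tau> - t)))) s)"
      by (intro M.Gint_integrable \<tau> M.reg_k_shift)
    have "y t = ctrans (k (\<tau> - t)) +
        ctrans (LINT s|lborel. M.gam \<tau> 0 s ** cutoff {0..\<tau>} (\<lambda>s. k (- (s - (\<tau> - t)))) s)"
      unfolding y_def using M.gam_row[OF \<tau>, of 0 "\<tau> - t"]
      by (simp add: ctrans_add)
    also have "ctrans (LINT s|lborel. M.gam \<tau> 0 s ** cutoff {0..\<tau>} (\<lambda>s. k (- (s - (\<tau> - t)))) s)
        = (LINT s|lborel. ctrans (M.gam \<tau> 0 s ** cutoff {0..\<tau>} (\<lambda>s. k (- (s - (\<tau> - t)))) s))"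
      by (rule integral_bounded_linear[OF bounded_linear_ctrans int, symmetric])
    also have "\<dots> = (LINT w|lborel. ctrans (M.gam \<tau> 0 (\<tau> - w) ** cutoff {0..\<tau>} (\<lambda>s. k (- (s - (\<tau> - t)))) (\<tau> - w)))"
      by (subst lborel_integral_real_affine[of "-1" _ \<tau>]) auto
    also have "\<dots> = Kop \<tau> y t"
      unfolding conv_def
    proof (rule Bochner_Integration.integral_cong[OF refl])
      fix w
      have "ctrans (cutoff {0..\<tau>} (\<lambda>s. k (- (s - (\<tau> - t)))) (\<tau> - w)) = (if w \<in> {0..\<tau>} then k (t - w) else 0)"
        using herm[of "w - t"] by (auto simp: cutoff_def)
      then show "ctrans (M.gam \<tau> 0 (\<tau> - w) ** cutoff {0..\<tau>} (\<lambda>s. k (- (s - (\<tau> - t)))) (\<tau> - w))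
          = k (t - w) ** cutoff {0..\<tau>} y w"
        by (simp add: ctrans_mult cutoff_def[of _ y] y_def)
    qed
    finally show ?thesis using herm[of "\<tau> - t"] by simp
  qed
  have "y 0 = gam \<tau> 0 \<tau>"
    using X_unique_all[OF \<tau> reg_k_shift reg_y eq, of 0]
      X_unique_all[OF \<tau> reg_k_shift reg_gam[OF \<tau>] gam_eq[OF \<tau>], of 0 \<tau>] by simp
  then have "ctrans (M.gam \<tau> 0 \<tau>) = gam \<tau> 0 \<tau>" by (simp add: y_def)
  then show ?thesis by (metis ctrans_ctrans)
qed

text \<open>For \<open>c = - \<i> z\<close> these are \<open>F\<^sup>\<sharp> z\<close> and \<open>G\<^sup>\<sharp> z\<close> for the interval \<open>[0, \<tau>]\<close>.\<close>

definition lend :: "complex \<Rightarrow> real \<Rightarrow> complex^'r^'r" where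
  "lend c \<tau> = X \<tau> (wave c) 0"

definition rend :: "complex \<Rightarrow> real \<Rightarrow> complex^'r^'r" where
  "rend c \<tau> = M.X \<tau> (wave (- c)) 0"

lemma lend_continuous: "continuous_on {0..T} (lend c)"
  unfolding lend_def[abs_def] by (intro X_origin_continuous wave_continuous)

lemma rend_continuous: "continuous_on {0..T} (rend c)"
  unfolding rend_def[abs_def] by (intro M.X_origin_continuous wave_continuous)

text \<open>Reflection turns an exponential into the opposite exponential times a scalar and the
  right endpoint into the origin, so the derivative at the origin suffices for both ends.\<close>

lemma X_wave_end:
  assumes "\<tau> \<in> {0..T}"
  shows "X \<tau> (wave c) \<tau> = cscale (exp (c * of_real \<tau>)) (rend c \<tau>)"
  using X_reflect[OF assms wave_continuous[of UNIV c], of 0] assms M.X_cscale[OF assms M.reg_wave, of _ "- c" 0]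
  by (simp add: wave_diff rend_def)

lemma MX_wave_end:
  assumes "\<tau> \<in> {0..T}"
  shows "M.X \<tau> (wave (- c)) \<tau> = cscale (exp (- c * of_real \<tau>)) (lend c \<tau>)"
proof -
  have "cscale (exp (c * of_real \<tau>)) (M.X \<tau> (wave (- c)) \<tau>) = lend c \<tau>"
    using X_reflect[OF assms wave_continuous[of UNIV c], of \<tau>] assms M.X_cscale[OF assms M.reg_wave, of _ "- c" \<tau>]
    by (simp add: wave_diff lend_def)
  then have "cscale (exp (- c * of_real \<tau>)) (lend c \<tau>)
      = cscale (exp (- c * of_real \<tau>)) (cscale (exp (c * of_real \<tau>)) (M.X \<tau> (wave (- c)) \<tau>))" by simp
  also have "\<dots> = M.X \<tau> (wave (- c)) \<tau>" by (simp only: cscale_cscale exp_add[symmetric]) simp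
  finally show ?thesis by simp
qed

lemma lend_derivative:
  assumes "0 < \<tau>" "\<tau> \<le> T"
  shows "(lend c has_vector_derivative cscale (exp (c * of_real \<tau>)) (gam \<tau> 0 \<tau> ** rend c \<tau>))
    (at \<tau> within {0..T})"
  using X_origin_derivative[OF assms wave_continuous, of c] X_wave_end[of \<tau> c] assms
  by (simp add: lend_def[abs_def] cscale_mult_right)

lemma rend_derivative:
  assumes "0 < \<tau>" "\<tau> \<le> T"
  shows "(rend c has_vector_derivative cscale (exp (- c * of_real \<tau>)) (ctrans (gam \<tau> 0 \<tau>) ** lend c \<tau>))
    (at \<tau> within {0..T})"
  using M.X_origin_derivative[OF assms wave_continuous, of "- c"] MX_wave_end[of \<tau> c] assms gam_mirror[of \<tau>]
  by (simp add: rend_def[abs_def] cscale_mult_right)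

lemma end_0: "lend c 0 = mat 1" "rend c 0 = mat 1"
proof -
  have z: "(LINT s|lborel. A s ** cutoff {0} \<phi> s) = 0" for A \<phi> :: "real \<Rightarrow> complex^'r^'r"
    by (rule integral_eq_zero_AE, use AE_lborel_singleton[of 0] in eventually_elim) (simp add: cutoff_def)
  show "lend c 0 = mat 1" "rend c 0 = mat 1"
    by (simp_all add: lend_def rend_def X_def M.X_def Gint_def M.Gint_def z wave_def)
qed

end

text \<open>Energy estimate: the derivative of \<open>P \<bullet> P + Q \<bullet> Q\<close> is at
  most \<open>2 * C\<close> times this quantity, so the weighted energy \<open>E\<close> cannot
  grow. Derivatives are asked in the open interval only, as the endpoint functions of the resolvent
  are differentiated for positive lengths.\<close>

lemma coupled_ode_zero:
  fixes P Q :: "real \<Rightarrow> 'v::euclidean_space"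
  assumes T: "T > 0" and c: "continuous_on {0..T} P" "continuous_on {0..T} Q" "P 0 = 0" "Q 0 = 0"
    and P: "\<And>\<tau>. 0 < \<tau> \<Longrightarrow> \<tau> < T \<Longrightarrow> (P has_vector_derivative P' \<tau>) (at \<tau>)"
    and Q: "\<And>\<tau>. 0 < \<tau> \<Longrightarrow> \<tau> < T \<Longrightarrow> (Q has_vector_derivative Q' \<tau>) (at \<tau>)"
    and le: "\<And>\<tau>. 0 < \<tau> \<Longrightarrow> \<tau> < T \<Longrightarrow> norm (P' \<tau>) \<le> C * norm (Q \<tau>)"
      "\<And>\<tau>. 0 < \<tau> \<Longrightarrow> \<tau> < T \<Longrightarrow> norm (Q' \<tau>) \<le> C * norm (P \<tau>)"
    and t: "t \<in> {0..T}"
  shows "P t = 0" "Q t = 0"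
proof -
  define E where "E \<tau> = exp (- 2 * C * \<tau>) * (P \<tau> \<bullet> P \<tau> + Q \<tau> \<bullet> Q \<tau>)" for \<tau>
  have "E t \<le> E 0"
  proof (cases "t = 0")
    case False
    show ?thesis
    proof (rule DERIV_nonpos_imp_decreasing_open[of 0 t E])
      show "0 \<le> t" using t by simp
      show "continuous_on {0..t} E"
        unfolding E_def using t by (intro continuous_intros continuous_on_subset[OF c(1)] continuous_on_subset[OF c(2)]) auto
      fix \<tau> assume "0 < \<tau>" "\<tau> < t"
      then have \<tau>: "0 < \<tau>" "\<tau> < T" using t by auto
      have "((\<lambda>\<tau>. P \<tau> \<bullet> P \<tau> + Q \<tau> \<bullet> Q \<tau>) has_vector_derivative
          (P \<tau> \<bullet> P' \<tau> + P' \<tau> \<bullet> P \<tau>) + (Q \<tau> \<bullet> Q' \<tau> + Q' \<tau> \<bullet> Q \<tau>)) (at \<tau>)"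
        by (intro has_vector_derivative_add bounded_bilinear.has_vector_derivative[OF bounded_bilinear_inner] P Q \<tau>)
      then have d: "((\<lambda>\<tau>. P \<tau> \<bullet> P \<tau> + Q \<tau> \<bullet> Q \<tau>) has_real_derivative 2 * (P \<tau> \<bullet> P' \<tau> + Q \<tau> \<bullet> Q' \<tau>)) (at \<tau>)"
        by (simp add: has_real_derivative_iff_has_vector_derivative inner_commute algebra_simps)
      have "(E has_real_derivative exp (- 2 * C * \<tau>) * (2 * (P \<tau> \<bullet> P' \<tau> + Q \<tau> \<bullet> Q' \<tau>))
          + (- 2 * C * exp (- 2 * C * \<tau>)) * (P \<tau> \<bullet> P \<tau> + Q \<tau> \<bullet> Q \<tau>)) (at \<tau>)"
        unfolding E_def[abs_def] by (rule derivative_eq_intros d refl | simp add: algebra_simps)+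
      moreover have "exp (- 2 * C * \<tau>) * (2 * (P \<tau> \<bullet> P' \<tau> + Q \<tau> \<bullet> Q' \<tau>))
          + (- 2 * C * exp (- 2 * C * \<tau>)) * (P \<tau> \<bullet> P \<tau> + Q \<tau> \<bullet> Q \<tau>) \<le> 0"
      proof -
        have "P \<tau> \<bullet> P' \<tau> \<le> norm (P \<tau>) * norm (P' \<tau>)" by (rule norm_cauchy_schwarz)
        also have "\<dots> \<le> norm (P \<tau>) * (C * norm (Q \<tau>))" by (intro mult_left_mono le \<tau>) simp
        finally have 1: "P \<tau> \<bullet> P' \<tau> \<le> C * (norm (P \<tau>) * norm (Q \<tau>))" by (simp add: mult_ac)
        have "Q \<tau> \<bullet> Q' \<tau> \<le> norm (Q \<tau>) * norm (Q' \<tau>)" by (rule norm_cauchy_schwarz)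
        also have "\<dots> \<le> norm (Q \<tau>) * (C * norm (P \<tau>))" by (intro mult_left_mono le \<tau>) simp
        finally have 2: "Q \<tau> \<bullet> Q' \<tau> \<le> C * (norm (P \<tau>) * norm (Q \<tau>))" by (simp add: mult_ac)
        have C: "C * (2 * (norm (P \<tau>) * norm (Q \<tau>))) \<le> C * (P \<tau> \<bullet> P \<tau> + Q \<tau> \<bullet> Q \<tau>)"
        proof (cases "C \<ge> 0")
          case True
          have "2 * (norm (P \<tau>) * norm (Q \<tau>)) \<le> (norm (P \<tau>))\<^sup>2 + (norm (Q \<tau>))\<^sup>2"
            using sum_squares_bound[of "norm (P \<tau>)" "norm (Q \<tau>)"] by (simp add: mult.assoc)
          then show ?thesis using True by (simp add: mult_left_mono dot_square_norm)
        next
          \<comment> \<open>For negative \<open>C\<close> the assumed bounds force \<open>P\<close>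
            and \<open>Q\<close> to vanish at this point.\<close>
          case False
          have "C * norm (Q \<tau>) \<ge> 0" "C * norm (P \<tau>) \<ge> 0"
            using le[OF \<tau>] norm_ge_zero[of "P' \<tau>"] norm_ge_zero[of "Q' \<tau>"] by linarith+
          then have "P \<tau> = 0" "Q \<tau> = 0" using False by (auto simp: zero_le_mult_iff)
          then show ?thesis by simp
        qed
        have "2 * (P \<tau> \<bullet> P' \<tau> + Q \<tau> \<bullet> Q' \<tau>) \<le> 2 * C * (P \<tau> \<bullet> P \<tau> + Q \<tau> \<bullet> Q \<tau>)"
          using 1 2 C by (simp add: algebra_simps)
        then have "exp (- 2 * C * \<tau>) * (2 * (P \<tau> \<bullet> P' \<tau> + Q \<tau> \<bullet> Q' \<tau>))
            \<le> exp (- 2 * C * \<tau>) * (2 * C * (P \<tau> \<bullet> P \<tau> + Q \<tau> \<bullet> Q \<tau>))" by (intro mult_left_mono) auto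
        then show ?thesis by (simp add: algebra_simps)
      qed
      ultimately show "\<exists>y. (E has_real_derivative y) (at \<tau>) \<and> y \<le> 0" by blast
    qed
  qed simp
  then have "exp (- 2 * C * t) * (P t \<bullet> P t + Q t \<bullet> Q t) \<le> 0" by (simp add: E_def c)
  then have "P t \<bullet> P t + Q t \<bullet> Q t \<le> 0" by (simp add: mult_le_0_iff)
  then have "P t \<bullet> P t = 0" "Q t \<bullet> Q t = 0"
    using inner_ge_zero[of "P t"] inner_ge_zero[of "Q t"] by linarith+
  then show "P t = 0" "Q t = 0" by simp_all
qed

section \<open>The matrizant\<close>

lemma sum_UNIV_Plus: "(\<Sum>i\<in>UNIV. f i) = (\<Sum>i\<in>UNIV. f (Inl i)) + (\<Sum>j\<in>UNIV. f (Inr j))"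
  for f :: "'a::finite + 'b::finite \<Rightarrow> 'c::comm_monoid_add"
  unfolding UNIV_Plus_UNIV[symmetric] by (subst sum.Plus) auto

lemma block_col_decompose:
  fixes A :: "complex^'k^'n" and B :: "complex^'k^'m"
  shows "block_col A B = block_col (mat 1) 0 ** A + block_col 0 (mat 1) ** B"
proof -
  have "block_col A B $ i $ j = (block_col (mat 1) 0 ** A + block_col 0 (mat 1) ** B) $ i $ j" for i j
    by (cases i) (simp_all add: block_col_def matrix_matrix_mult_def mat_def if_distrib[of "\<lambda>x. x * _"] cong: if_cong)
  then show ?thesis by (simp add: vec_eq_iff)
qed

lemma block2_mult_block_col:
  "block2 A B C D ** block_col P Q = block_col (A ** P + B ** Q) (C ** P + D ** Q)"
proof -
  have "(block2 A B C D ** block_col P Q) $ i $ j = block_col (A ** P + B ** Q) (C ** P + D ** Q) $ i $ j" for i j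
    by (cases i) (simp_all add: block2_def block_col_def block_row_def matrix_matrix_mult_def sum_UNIV_Plus)
  then show ?thesis by (simp add: vec_eq_iff)
qed

lemma block_row_mult_block_col:
  "block_row A B ** block_col P Q = A ** P + B ** Q"
  by (simp add: vec_eq_iff block_col_def block_row_def matrix_matrix_mult_def sum_UNIV_Plus)

locale krein_system =
  fixes T :: real and a :: "real \<Rightarrow> complex^'r^'r"
    and U :: "real \<Rightarrow> complex \<Rightarrow> complex^('r + 'r)^('r + 'r)"
  assumes T: "T > 0" and a_cont: "continuous_on {0..T} a" and U: "matrizant T a U"
begin

definition Y1 :: "complex \<Rightarrow> real \<Rightarrow> complex^'r^'r" where
  "Y1 z \<tau> = block_row (mat 1) (mat 1) ** U \<tau> z ** block_col (mat 1) 0"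

definition Y2 :: "complex \<Rightarrow> real \<Rightarrow> complex^'r^'r" where
  "Y2 z \<tau> = block_row (mat 1) (mat 1) ** U \<tau> z ** block_col 0 (mat 1)"

lemma Y_0: "Y1 z 0 = mat 1" "Y2 z 0 = mat 1"
  using U by (simp_all add: matrizant_def Y1_def Y2_def block_row_mult_block_col)

lemma Y_derivative:
  assumes \<tau>: "\<tau> \<in> {0..T}"
  shows "(Y1 z has_vector_derivative cscale (\<i> * z) (Y1 z \<tau>) + Y2 z \<tau> ** ctrans (a \<tau>)) (at \<tau> within {0..T})"
    and "(Y2 z has_vector_derivative Y1 z \<tau> ** a \<tau>) (at \<tau> within {0..T})"
proof -
  define L where "L = cscale (\<i> * z) (block2 (mat 1) 0 0 0) + block2 0 (a \<tau>) (ctrans (a \<tau>)) 0"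
  have dU: "((\<lambda>\<tau>. U \<tau> z) has_vector_derivative U \<tau> z ** L) (at \<tau> within {0..T})"
    using U \<tau> by (simp add: matrizant_def L_def)
  have bl: "bounded_linear (\<lambda>V. block_row (mat 1) (mat 1) ** V ** R)"
    for R :: "complex^'r^('r + 'r)"
    by (rule bounded_linear_compose[OF mm.bounded_linear_left mm.bounded_linear_right])
  have split: "block_row (mat 1) (mat 1) ** U \<tau> z ** block_col A B = Y1 z \<tau> ** A + Y2 z \<tau> ** B" for A B
    unfolding block_col_decompose[of A B] by (simp add: Y1_def Y2_def mm.add_right matrix_mul_assoc)
  have 1: "L ** block_col (mat 1) 0 = block_col (cscale (\<i> * z) (mat 1)) (ctrans (a \<tau>))"
    unfolding L_def mm.add_left cscale_mult_left block2_mult_block_col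
    by (auto simp: vec_eq_iff block_col_def split: sum.splits)
  have 2: "L ** block_col 0 (mat 1) = block_col (a \<tau>) 0"
    unfolding L_def mm.add_left cscale_mult_left block2_mult_block_col
    by (auto simp: vec_eq_iff block_col_def split: sum.splits)
  have "((\<lambda>\<tau>. block_row (mat 1) (mat 1) ** U \<tau> z ** R) has_vector_derivative
      block_row (mat 1) (mat 1) ** U \<tau> z ** (L ** R)) (at \<tau> within {0..T})" for R :: "complex^'r^('r + 'r)"
    using bounded_linear.has_vector_derivative[OF bl[of R] dU] by (simp add: matrix_mul_assoc)
  from this[of "block_col (mat 1) 0"] this[of "block_col 0 (mat 1)"]
  show "(Y1 z has_vector_derivative cscale (\<i> * z) (Y1 z \<tau>) + Y2 z \<tau> ** ctrans (a \<tau>)) (at \<tau> within {0..T})"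
    "(Y2 z has_vector_derivative Y1 z \<tau> ** a \<tau>) (at \<tau> within {0..T})"
    unfolding 1 2 split by (simp_all add: Y1_def[abs_def] Y2_def[abs_def] cscale_mult_right)
qed

lemma Y_continuous: "continuous_on {0..T} (Y1 z)" "continuous_on {0..T} (Y2 z)"
  using Y_derivative has_vector_derivative_continuous
  unfolding continuous_on_eq_continuous_within by blast+

text \<open>In the derivative of \<open>H\<close> the terms containing the potential cancel in
  pairs, and those containing the spectral parameter cancel because it is real. At 0 both blocks are
  the identity.\<close>

lemma Y_conserved: "Y1 (of_real s) T ** ctrans (Y1 (of_real s) T) = Y2 (of_real s) T ** ctrans (Y2 (of_real s) T)"
proof -
  define z where "z = complex_of_real s"
  define H where "H \<tau> = Y1 z \<tau> ** ctrans (Y1 z \<tau>) - Y2 z \<tau> ** ctrans (Y2 z \<tau>)" for \<tau>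
  have "(H has_vector_derivative 0) (at \<tau> within {0..T})" if \<tau>: "\<tau> \<in> {0..T}" for \<tau>
  proof -
    note d = Y_derivative[OF \<tau>, of z]
    note dc = bounded_linear.has_vector_derivative[OF bounded_linear_ctrans d(1)]
      bounded_linear.has_vector_derivative[OF bounded_linear_ctrans d(2)]
    have "(H has_vector_derivative
        (Y1 z \<tau> ** ctrans (cscale (\<i> * z) (Y1 z \<tau>) + Y2 z \<tau> ** ctrans (a \<tau>))
          + (cscale (\<i> * z) (Y1 z \<tau>) + Y2 z \<tau> ** ctrans (a \<tau>)) ** ctrans (Y1 z \<tau>))
        - (Y2 z \<tau> ** ctrans (Y1 z \<tau> ** a \<tau>) + (Y1 z \<tau> ** a \<tau>) ** ctrans (Y2 z \<tau>))) (at \<tau> within {0..T})"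
      unfolding H_def[abs_def] by (intro has_vector_derivative_diff mm.has_vector_derivative d dc)
    moreover have "cscale (- (\<i> * z)) A + cscale (\<i> * z) A = 0" for A :: "complex^'r^'r"
      by (simp add: vec_eq_iff)
    ultimately show ?thesis
      by (simp add: ctrans_add ctrans_cscale ctrans_mult
          mm.add_left mm.add_right cscale_mult_left cscale_mult_right matrix_mul_assoc z_def algebra_simps)
  qed
  then obtain c where "\<And>\<tau>. \<tau> \<in> {0..T} \<Longrightarrow> H \<tau> = c"
    using has_vector_derivative_zero_constant[of "{0..T}" H] by (metis convex_real_interval(5))
  then have "H T = H 0" using T by simp
  then show ?thesis by (simp add: H_def Y_0 z_def)
qed

end

section \<open>Representation of the matrizant\<close>

locale krein_accelerant = krein_system T a U + hermitian_kernel T k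
  for T :: real and a k :: "real \<Rightarrow> complex^'r^'r"
    and U :: "real \<Rightarrow> complex \<Rightarrow> complex^('r + 'r)^('r + 'r)" +
  assumes a_gam: "\<And>\<tau>. 0 < \<tau> \<Longrightarrow> \<tau> \<le> T \<Longrightarrow> a \<tau> = gam \<tau> 0 \<tau>"
begin

text \<open>The exponential factor removes the diagonal term of the Krein system. The differences of
  the two sides then satisfy a linear homogeneous system with zero initial values.\<close>

lemma Y_ends:
  "cscale (exp (\<i> * z * of_real T)) (Y1 (- z) T) = ctrans (lend (- (\<i> * cnj z)) T)"
  "Y2 (- z) T = ctrans (rend (- (\<i> * cnj z)) T)"
proof -
  define c where "c = - (\<i> * cnj z)"
  have cnj_c: "cnj (exp (c * of_real \<tau>)) = exp (\<i> * z * of_real \<tau>)"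
    "cnj (exp (- c * of_real \<tau>)) = exp (- (\<i> * z * of_real \<tau>))" for \<tau>
    by (simp_all add: c_def exp_cnj)
  define P where "P \<tau> = cscale (exp (\<i> * z * of_real \<tau>)) (Y1 (- z) \<tau>) - ctrans (lend c \<tau>)" for \<tau>
  define Q where "Q \<tau> = Y2 (- z) \<tau> - ctrans (rend c \<tau>)" for \<tau>
  note ctrans_cont = bounded_linear.continuous_on[OF bounded_linear_ctrans]
  have cP: "continuous_on {0..T} P"
    unfolding P_def by (intro continuous_intros cscale.continuous_on Y_continuous ctrans_cont lend_continuous)
  have cQ: "continuous_on {0..T} Q"
    unfolding Q_def by (intro continuous_intros Y_continuous ctrans_cont rend_continuous)
  obtain A where A: "\<And>\<tau>. \<tau> \<in> {0..T} \<Longrightarrow> norm (a \<tau>) \<le> A"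
    using compact_imp_bounded[OF compact_continuous_image[OF a_cont compact_Icc]] unfolding bounded_iff by blast
  \<comment> \<open>The first factor bounds both \<open>exp (\<i> * z * of_real \<tau>)\<close> and
    its inverse on the interval, the second one bounds the potential.\<close>
  define C where "C = exp (norm z * T) * A"
  define P' where "P' \<tau> = cscale (exp (\<i> * z * of_real \<tau>)) (Q \<tau> ** ctrans (a \<tau>))" for \<tau>
  define Q' where "Q' \<tau> = cscale (exp (- (\<i> * z * of_real \<tau>))) (P \<tau> ** a \<tau>)" for \<tau>
  have at: "at \<tau> within {0..T} = at \<tau>" if "0 < \<tau>" "\<tau> < T" for \<tau>
    using that by (intro at_within_interior) auto
  have dexp: "((\<lambda>\<tau>. exp (\<i> * z * of_real \<tau>)) has_vector_derivative \<i> * z * exp (\<i> * z * of_real \<tau>)) (at \<tau> within {0..T})" for \<tau>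
  proof (rule has_vector_derivative_real_field)
    show "((\<lambda>x. exp (\<i> * z * x)) has_field_derivative \<i> * z * exp (\<i> * z * of_real \<tau>)) (at (of_real \<tau>))"
      by (auto intro!: derivative_eq_intros)
  qed
  have dP: "(P has_vector_derivative P' \<tau>) (at \<tau>)" if \<tau>: "0 < \<tau>" "\<tau> < T" for \<tau>
  proof -
    have \<tau>T: "\<tau> \<in> {0..T}" "\<tau> \<le> T" using \<tau> by auto
    have "(P has_vector_derivative
        (cscale (exp (\<i> * z * of_real \<tau>)) (cscale (\<i> * (- z)) (Y1 (- z) \<tau>) + Y2 (- z) \<tau> ** ctrans (a \<tau>))
          + cscale (\<i> * z * exp (\<i> * z * of_real \<tau>)) (Y1 (- z) \<tau>))
        - ctrans (cscale (exp (c * of_real \<tau>)) (gam \<tau> 0 \<tau> ** rend c \<tau>))) (at \<tau> within {0..T})"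
      unfolding P_def[abs_def]
      by (intro has_vector_derivative_diff cscale.has_vector_derivative dexp Y_derivative \<tau>T
          bounded_linear.has_vector_derivative[OF bounded_linear_ctrans] lend_derivative \<tau>)
    moreover have "cscale e (cscale (\<i> * (- z)) B + D) + cscale (\<i> * z * e) B = cscale e D"
      for B D :: "complex^'r^'r" and e
      by (simp add: vec_eq_iff algebra_simps)
    ultimately show ?thesis
      unfolding P'_def Q_def at[OF \<tau>] ctrans_cscale cnj_c a_gam[OF \<tau>(1) \<tau>T(2)]
      by (simp only: cscale.diff_right mm.diff_left ctrans_mult)
  qed
  have dQ: "(Q has_vector_derivative Q' \<tau>) (at \<tau>)" if \<tau>: "0 < \<tau>" "\<tau> < T" for \<tau>
  proof -
    have \<tau>T: "\<tau> \<in> {0..T}" "\<tau> \<le> T" using \<tau> by auto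
    have "(Q has_vector_derivative Y1 (- z) \<tau> ** a \<tau>
        - ctrans (cscale (exp (- c * of_real \<tau>)) (ctrans (gam \<tau> 0 \<tau>) ** lend c \<tau>))) (at \<tau> within {0..T})"
      unfolding Q_def[abs_def]
      by (intro has_vector_derivative_diff Y_derivative \<tau>T
          bounded_linear.has_vector_derivative[OF bounded_linear_ctrans] rend_derivative \<tau>)
    moreover have "cscale (exp (- (\<i> * z * of_real \<tau>))) (cscale (exp (\<i> * z * of_real \<tau>)) B) = B" for B :: "complex^'r^'r"
      by (simp only: cscale_cscale exp_add[symmetric]) simp
    ultimately show ?thesis
      unfolding Q'_def P_def at[OF \<tau>] ctrans_cscale cnj_c a_gam[OF \<tau>(1) \<tau>T(2)]
      by (simp add: cscale.diff_right mm.diff_left cscale_mult_left ctrans_mult)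
  qed
  have e: "norm (exp (\<i> * z * of_real \<tau>)) \<le> exp (norm z * T)" "norm (exp (- (\<i> * z * of_real \<tau>))) \<le> exp (norm z * T)"
    if \<tau>: "0 < \<tau>" "\<tau> < T" for \<tau>
  proof -
    have L: "norm (exp w) \<le> exp (norm z * T)" if "norm w \<le> norm z * \<tau>" for w
    proof -
      have "norm (exp w) \<le> exp (norm w)" by (rule norm_exp)
      also have "norm w \<le> norm z * T" using that mult_left_mono[of \<tau> T "norm z"] \<tau> by simp
      finally show ?thesis by simp
    qed
    show "norm (exp (\<i> * z * of_real \<tau>)) \<le> exp (norm z * T)" "norm (exp (- (\<i> * z * of_real \<tau>))) \<le> exp (norm z * T)"
      by (rule L, use \<tau> in \<open>simp add: norm_mult\<close>)+
  qed
  have nP: "norm (P' \<tau>) \<le> C * norm (Q \<tau>)" if \<tau>: "0 < \<tau>" "\<tau> < T" for \<tau>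
  proof -
    have "norm (P' \<tau>) \<le> exp (norm z * T) * (norm (Q \<tau>) * A)"
      unfolding P'_def norm_cscale
      using A[of \<tau>] \<tau> norm_matrix_mult_le[of "Q \<tau>" "ctrans (a \<tau>)"] mult_left_mono[of "norm (a \<tau>)" A "norm (Q \<tau>)"]
      by (intro mult_mono e \<tau>) auto
    then show ?thesis by (simp add: C_def mult_ac)
  qed
  have nQ: "norm (Q' \<tau>) \<le> C * norm (P \<tau>)" if \<tau>: "0 < \<tau>" "\<tau> < T" for \<tau>
  proof -
    have "norm (Q' \<tau>) \<le> exp (norm z * T) * (norm (P \<tau>) * A)"
      unfolding Q'_def norm_cscale
      using A[of \<tau>] \<tau> norm_matrix_mult_le[of "P \<tau>" "a \<tau>"] mult_left_mono[of "norm (a \<tau>)" A "norm (P \<tau>)"]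
      by (intro mult_mono e \<tau>) auto
    then show ?thesis by (simp add: C_def mult_ac)
  qed
  have T0: "T \<in> {0..T}" using T by simp
  have "P T = 0" "Q T = 0"
    by (rule coupled_ode_zero[OF T cP cQ _ _ dP dQ nP nQ T0]; simp add: P_def Q_def Y_0 end_0)+
  then show "cscale (exp (\<i> * z * of_real T)) (Y1 (- z) T) = ctrans (lend (- (\<i> * cnj z)) T)"
    "Y2 (- z) T = ctrans (rend (- (\<i> * cnj z)) T)"
    by (simp_all add: P_def Q_def c_def)
qed

end

text \<open>At the origin the solution integrates the exponential against row 0 of the resolvent.
  The condition on \<open>h\<close> for positive \<open>s\<close> only lets \<open>h\<close> be
  continuous up to 0, where the row itself may jump.\<close>

lemma (in jump_kernel) ctrans_X_wave:
  assumes h: "h \<in> borel_measurable borel" "\<And>s. 0 < s \<Longrightarrow> s \<le> T \<Longrightarrow> ctrans (h s) = gam T 0 s"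
    "\<And>s. s \<notin> {0..T} \<Longrightarrow> h s = 0"
  shows "ctrans (X T (wave c) 0) = mat 1 + (LINT s|lborel. cscale (exp (cnj c * of_real s)) (h s))"
proof -
  have int: "integrable lborel (\<lambda>s. gam T 0 s ** cutoff {0..T} (wave c) s)"
    using T by (intro Gint_integrable reg_wave) simp
  have "ctrans (X T (wave c) 0) = mat 1 + ctrans (LINT s|lborel. gam T 0 s ** cutoff {0..T} (wave c) s)"
    by (simp add: X_def Gint_def wave_def ctrans_add)
  also have "ctrans (LINT s|lborel. gam T 0 s ** cutoff {0..T} (wave c) s)
      = (LINT s|lborel. ctrans (gam T 0 s ** cutoff {0..T} (wave c) s))"
    by (rule integral_bounded_linear[OF bounded_linear_ctrans int, symmetric])
  also have "\<dots> = (LINT s|lborel. cscale (exp (cnj c * of_real s)) (h s))"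
  proof (rule integral_cong_except)
    show "(\<lambda>s. cscale (exp (cnj c * of_real s)) (h s)) \<in> borel_measurable borel" using h(1) by measurable
    show "ctrans (gam T 0 s ** cutoff {0..T} (wave c) s) = cscale (exp (cnj c * of_real s)) (h s)"
      if "s \<noteq> 0" for s
    proof (cases "s \<in> {0..T}")
      case True
      then have "gam T 0 s = ctrans (h s)" using h(2) that by simp
      then show ?thesis using True
        by (simp add: cutoff_def wave_def cscale_mult_right ctrans_cscale exp_cnj)
    qed (auto simp: h(3) cutoff_def)
  qed
  finally show ?thesis .
qed

text \<open>This is \<open>gam_row\<close> for row 0 at \<open>v = - x\<close>, shifted so that the
  integral becomes a convolution.\<close>

lemma (in jump_kernel) row_conv:
  assumes bz: "\<And>s. 0 < s \<Longrightarrow> s \<le> T \<Longrightarrow> b (- s) = gam T 0 s" "\<And>u. u \<notin> {-T..0} \<Longrightarrow> b u = 0"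
    and x: "- T \<le> x" "x < 0" and b: "bcs b"
  shows "b x - k x - conv b k x = 0"
proof -
  have TT: "T \<in> {0..T}" using T by simp
  have "conv b k x = (LINT s|lborel. b (- s) ** k (s + x))"
    unfolding conv_def by (subst lborel_integral_real_affine[of 1 _ x]) (auto simp: algebra_simps)
  also have "\<dots> = (LINT s|lborel. gam T 0 s ** cutoff {0..T} (\<lambda>s. k (s - (- x))) s)"
  proof (rule integral_cong_except[symmetric])
    show "(\<lambda>s. b (- s) ** k (s + x)) \<in> borel_measurable borel"
      using bcs_measurable[OF b] bcs_measurable[OF k_bcs] by measurable
    show "gam T 0 s ** cutoff {0..T} (\<lambda>s. k (s - (- x))) s = b (- s) ** k (s + x)" if "s \<noteq> 0" for s
      using that bz(1)[of s] bz(2)[of "- s"] by (cases "s \<in> {0..T}") (auto simp: cutoff_def)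
  qed
  finally show ?thesis using gam_row[OF TT, of 0 "- x"] bz(1)[of "- x"] x by simp
qed

section \<open>Transforms of convolution kernels\<close>

definition fourier :: "(real \<Rightarrow> complex^'n^'m) \<Rightarrow> real \<Rightarrow> complex^'n^'m" where
  "fourier c t = (LINT s|lborel. cscale (exp (\<i> * of_real (t * s))) (c s))"

lemma fourier_integrable:
  assumes "bcs c" shows "integrable lborel (\<lambda>s. cscale (exp (\<i> * of_real (t * s))) (c s))"
proof -
  obtain S where S: "S \<ge> 0" "\<And>x. norm (c x) \<le> S" "\<And>x. S < \<bar>x\<bar> \<Longrightarrow> c x = 0" using assms by (rule bcsE) blast
  note [measurable] = bcs_measurable[OF assms]
  show ?thesis
    by (rule integrable_bounded_compact[of _ S S]) (use S in auto)
qed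

text \<open>Exponentials are eigenfunctions of convolution. A kernel of reach \<open>T\<close> looks
  no further than \<open>R\<close> from points with \<open>\<bar>u\<bar> + T \<le> R\<close>, so
  truncated, hence integrable, exponentials can be used.\<close>

lemma Dop_wave:
  assumes c: "bcs c" "\<And>x. T < \<bar>x\<bar> \<Longrightarrow> c x = 0"
    and \<phi>: "\<And>x. \<bar>x\<bar> \<le> R \<Longrightarrow> \<phi> x = cscale (exp (- \<i> * of_real (t * x))) A" and u: "\<bar>u\<bar> + T \<le> R" and T: "T \<ge> 0"
  shows "Dop c \<phi> u = cscale (exp (- \<i> * of_real (t * u))) ((mat 1 + fourier c t) ** A)"
proof -
  have "conv c \<phi> u = (LINT v|lborel. c v ** \<phi> (u - v))"
    unfolding conv_def by (subst lborel_integral_real_affine[of "-1" _ u]) auto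
  also have "\<dots> = (LINT v|lborel. cscale (exp (- \<i> * of_real (t * u))) (cscale (exp (\<i> * of_real (t * v))) (c v) ** A))"
  proof (rule Bochner_Integration.integral_cong[OF refl])
    fix v
    show "c v ** \<phi> (u - v) = cscale (exp (- \<i> * of_real (t * u))) (cscale (exp (\<i> * of_real (t * v))) (c v) ** A)"
    proof (cases "T < \<bar>v\<bar>")
      case True
      then show ?thesis by (simp add: c)
    next
      case False
      then have "\<bar>u - v\<bar> \<le> R" using u by linarith
      moreover have "exp (- \<i> * of_real (t * (u - v))) = exp (- \<i> * of_real (t * u)) * exp (\<i> * of_real (t * v))"
        by (simp add: exp_add[symmetric] algebra_simps)
      ultimately show ?thesis by (simp add: \<phi> cscale_mult_left cscale_mult_right)
    qed
  qed
  also have "\<dots> = cscale (exp (- \<i> * of_real (t * u))) (fourier c t ** A)"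
    unfolding fourier_def
    using integral_bounded_linear[OF mm.bounded_linear_left fourier_integrable[OF c(1)], of t A]
      integral_bounded_linear[OF cscale.bounded_linear_right
        integrable_bounded_linear[OF mm.bounded_linear_left fourier_integrable[OF c(1)]], of "exp (- \<i> * of_real (t * u))" t A]
    by simp
  finally show ?thesis using \<phi>[of u] u T by (simp add: Dop_def mm.add_left cscale.add_right)
qed

text \<open>The convolution theorem obtained from \<open>Dop_Dop\<close> by evaluating both sides at
  0 on a truncated exponential. The truncation at \<open>2 * T\<close> leaves room for two
  successive factors of reach \<open>T\<close>.\<close>

lemma fourier_conv:
  fixes c c' :: "real \<Rightarrow> complex^'r^'r"
  assumes c: "bcs c" "bcs c'" and T: "T > 0"
    and supp: "\<And>x. T < \<bar>x\<bar> \<Longrightarrow> c x = 0" "\<And>x. T < \<bar>x\<bar> \<Longrightarrow> c' x = 0" "\<And>x. T < \<bar>x\<bar> \<Longrightarrow> conv c c' x = 0"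
  shows "mat 1 + fourier (\<lambda>x. c x + c' x + conv c c' x) t = (mat 1 + fourier c t) ** (mat 1 + fourier c' t)"
proof -
  define \<phi> :: "real \<Rightarrow> complex^'r^'r" where "\<phi> = cutoff {-2*T..2*T} (wave (- \<i> * of_real t))"
  have l: "lcs \<phi>" unfolding \<phi>_def by (intro lcs_cutoff_continuous wave_continuous)
  have \<phi>: "\<phi> x = cscale (exp (- \<i> * of_real (t * x))) (mat 1)" if "\<bar>x\<bar> \<le> 2 * T" for x
    using that by (auto simp: \<phi>_def cutoff_def wave_def mult.assoc)
  have 1: "Dop c' \<phi> x = cscale (exp (- \<i> * of_real (t * x))) ((mat 1 + fourier c' t) ** mat 1)" if "\<bar>x\<bar> \<le> T" for x
    by (rule Dop_wave[OF c(2) supp(2) \<phi>]) (use that T in auto)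
  have "Dop c (Dop c' \<phi>) 0 = cscale (exp (- \<i> * of_real (t * 0))) ((mat 1 + fourier c t) ** ((mat 1 + fourier c' t) ** mat 1))"
    by (rule Dop_wave[OF c(1) supp(1) 1]) (use T in auto)
  moreover have "Dop (\<lambda>x. c x + c' x + conv c c' x) \<phi> 0
      = cscale (exp (- \<i> * of_real (t * 0))) ((mat 1 + fourier (\<lambda>x. c x + c' x + conv c c' x) t) ** mat 1)"
    by (rule Dop_wave[where T = T, OF _ _ \<phi>]) (use T c supp in \<open>auto intro!: bcs_add bcs_conv bcs_imp_lcs\<close>)
  ultimately show ?thesis using Dop_Dop[OF c l] by simp
qed

lemma fourier_unique_matrix:
  fixes h :: "real \<Rightarrow> complex^'n^'m"
  assumes h: "bcs h" "\<And>x. x \<notin> {-L..L} \<Longrightarrow> h x = 0" and L: "L > 0"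
    and cont: "\<And>x. x \<in> {-L..L} \<Longrightarrow> x \<noteq> 0 \<Longrightarrow> continuous (at x within {-L..L}) h"
    and zero: "\<And>t. fourier h t = 0" and x: "x \<noteq> 0"
  shows "h x = 0"
proof -
  obtain S where S: "\<And>x. norm (h x) \<le> S" using h(1) by (rule bcsE) blast
  have "h x $ i $ j = 0" for i j
  proof (rule fourier_unique[OF _ _ _ L _ _ x])
    have bl: "bounded_linear (\<lambda>A :: complex^'n^'m. A $ i $ j)"
      by (rule bounded_linear_compose[OF bounded_linear_vec_nth bounded_linear_vec_nth])
    have le: "norm (A $ i $ j) \<le> norm A" for A :: "complex^'n^'m"
      using Finite_Cartesian_Product.norm_nth_le[of "A $ i" j] Finite_Cartesian_Product.norm_nth_le[of A i] by linarith
    show "norm (h x $ i $ j) \<le> S" for x using le[of "h x"] S[of x] by linarith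
    show "(\<lambda>x. h x $ i $ j) \<in> borel_measurable borel"
      using borel_measurable_continuous_on[OF linear_continuous_on[OF bl] bcs_measurable[OF h(1)]] by simp
    show "h x $ i $ j = 0" if "x \<notin> {-L..L}" for x using h(2)[OF that] by simp
    show "continuous (at x within {-L..L}) (\<lambda>x. h x $ i $ j)" if "x \<in> {-L..L}" "x \<noteq> 0" for x
      by (rule bounded_linear.continuous[OF bl cont[OF that]])
    show "(LINT x|lborel. h x $ i $ j * exp (\<i> * of_real (t * x))) = 0" for t
      using integral_bounded_linear[OF bl fourier_integrable[OF h(1), of t]] zero[of t]
      by (simp add: fourier_def mult.commute)
  qed
  then show ?thesis by (simp add: vec_eq_iff)
qed

lemma bcs_cutoff_continuous:
  fixes f :: "real \<Rightarrow> complex^'n^'m"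
  assumes "continuous_on {a..b} f" shows "bcs (cutoff {a..b} f)"
proof -
  obtain B where B: "\<And>x. x \<in> {a..b} \<Longrightarrow> norm (f x) \<le> B"
    using compact_imp_bounded[OF compact_continuous_image[OF assms compact_Icc]] unfolding bounded_iff by blast
  define S where "S = max \<bar>B\<bar> (max \<bar>a\<bar> \<bar>b\<bar>)"
  have "norm (cutoff {a..b} f x) \<le> S \<and> (S < \<bar>x\<bar> \<longrightarrow> cutoff {a..b} f x = 0)" for x
    using B[of x] by (auto simp: cutoff_def S_def)
  moreover have "cutoff {a..b} f \<in> borel_measurable borel"
    unfolding cutoff_eq_indicator using assms by (auto intro!: borel_measurable_continuous_on_indicator)
  ultimately show ?thesis unfolding bcs_def by blast
qed

lemma continuous_within_local:
  assumes "open S" "x \<in> S" "x \<in> J" "continuous_on (S \<inter> J) \<phi>"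
  shows "continuous (at x within J) \<phi>"
proof -
  have "continuous (at x within S \<inter> J) \<phi>" using assms by (simp add: continuous_on_eq_continuous_within)
  moreover have "at x within J = at x within S \<inter> J" by (rule at_within_nhd[of _ S]) (use assms in auto)
  ultimately show ?thesis by simp
qed

text \<open>Continuity is relative to \<open>[-T, T]\<close>, so a jump of the zero extension at the
  outer endpoint is not seen; the cut at 0 is the one to avoid.\<close>

lemma cutoff_continuous_off_zero:
  fixes f :: "real \<Rightarrow> 'v::real_normed_vector"
  assumes "x \<in> {-T..T}" "x \<noteq> 0"
  shows "continuous_on {0..T} f \<Longrightarrow> continuous (at x within {-T..T}) (cutoff {0..T} f)"
    and "continuous_on {-T..0} f \<Longrightarrow> continuous (at x within {-T..T}) (cutoff {-T..0} f)"
proof -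
  define S where "S = (if 0 < x then {0<..} else {..<0 :: real})"
  have S: "open S" "x \<in> S" using assms by (auto simp: S_def)
  have z: "continuous_on (S \<inter> {-T..T}) \<phi>" if "\<And>y. y \<in> S \<inter> {-T..T} \<Longrightarrow> \<phi> y = 0" for \<phi> :: "real \<Rightarrow> 'v"
    by (rule continuous_on_eq[OF continuous_on_const[of _ 0]]) (simp add: that)
  show "continuous (at x within {-T..T}) (cutoff {0..T} f)" if f: "continuous_on {0..T} f"
  proof (rule continuous_within_local[OF S assms(1)], cases "0 < x")
    case True
    then show "continuous_on (S \<inter> {-T..T}) (cutoff {0..T} f)"
      by (intro continuous_on_eq[OF continuous_on_subset[OF f]]) (auto simp: S_def cutoff_def)
  next
    case False
    then show "continuous_on (S \<inter> {-T..T}) (cutoff {0..T} f)"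
      by (intro z) (auto simp: S_def cutoff_def)
  qed
  show "continuous (at x within {-T..T}) (cutoff {-T..0} f)" if f: "continuous_on {-T..0} f"
  proof (rule continuous_within_local[OF S assms(1)], cases "0 < x")
    case False
    then show "continuous_on (S \<inter> {-T..T}) (cutoff {-T..0} f)"
      by (intro continuous_on_eq[OF continuous_on_subset[OF f]]) (auto simp: S_def cutoff_def)
  next
    case True
    then show "continuous_on (S \<inter> {-T..T}) (cutoff {-T..0} f)"
      by (intro z) (auto simp: S_def cutoff_def)
  qed
qed

lemma cutoff_isCont:
  fixes f :: "real \<Rightarrow> 'v::real_normed_vector"
  assumes "continuous_on {a..b} f" "x \<notin> {a, b}"
  shows "isCont (cutoff {a..b} f) x"
proof -
  have "continuous_on {a<..<b} (cutoff {a..b} f)"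
    by (rule continuous_on_eq[OF continuous_on_subset[OF assms(1)]]) (auto simp: cutoff_def)
  moreover have "continuous_on {..<a} (cutoff {a..b} f)" "continuous_on {b<..} (cutoff {a..b} f)"
    by (rule continuous_on_eq[OF continuous_on_const[of _ 0]]; auto simp: cutoff_def)+
  moreover have "x \<in> {a<..<b} \<or> x < a \<or> b < x" using assms(2) by auto
  ultimately show ?thesis by (auto simp: continuous_on_eq_continuous_at)
qed

lemma punctured_herm:
  assumes "accelerant T k" shows "punctured T k (- x) = ctrans (punctured T k x)"
proof (cases "x \<in> {-T..T} - {0}")
  case True
  then have "k (- x) = ctrans (k x)" using assms by (simp add: accelerant_def)
  then show ?thesis using True by (simp add: punctured_def cutoff_def)
next
  case False
  then show ?thesis
    by (auto simp: punctured_def cutoff_def)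
qed

text \<open>The given column of the resolvent kernel satisfies the equation of the punctured kernel
  except at \<open>t = \<tau>\<close>, where \<open>k 0\<close> enters. Redefining it by its own
  equation changes that single value, so uniqueness identifies it with \<open>gam\<close> at
  0.\<close>

lemma potential_eq_gam:
  fixes k a :: "real \<Rightarrow> complex^'r^'r"
  assumes T: "T > 0" and acc: "accelerant T k" and pot: "potential T k a" and \<tau>: "0 < \<tau>" "\<tau> \<le> T"
  shows "a \<tau> = jump_kernel.gam (punctured T k) \<tau> 0 \<tau>"
proof -
  interpret K: jump_kernel T "punctured T k" by (rule accelerant_jump_kernel[OF T acc])
  have \<tau>T: "\<tau> \<in> {0..T}" and \<tau>\<tau>: "\<tau> \<in> {0..\<tau>}" using \<tau> by auto
  obtain \<gamma> where \<gamma>: "resolvent_kernel k \<tau> \<gamma>" "a \<tau> = \<gamma> 0 \<tau>"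
    using pot bspec[of "{0<..T}" _ \<tau>] \<tau> unfolding potential_def by (metis greaterThanAtMost_iff)
  define y0 where "y0 = (\<lambda>v. \<gamma> v \<tau>)"
  have y0: "K.reg \<tau> y0" using \<gamma>(1) \<tau>\<tau> unfolding resolvent_kernel_def y0_def L1_iff_lcs by blast
  define y where "y t = punctured T k (t - \<tau>) + K.Kop \<tau> y0 t" for t
  have y: "K.reg \<tau> y"
    unfolding y_def by (intro K.reg_add K.reg_k_shift lcs_cutoff_continuous K.Kop_continuous y0)
  have eq: "y0 t = y t" if t: "t \<in> {0..\<tau>}" "t \<noteq> \<tau>" for t
  proof -
    have "(LINT v:{0..\<tau>}|lborel. k (t - v) ** \<gamma> v \<tau>) = K.Kop \<tau> y0 t"
      unfolding conv_def set_lebesgue_integral_def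
    proof (rule integral_cong_except)
      show "(\<lambda>s. punctured T k (t - s) ** cutoff {0..\<tau>} y0 s) \<in> borel_measurable borel"
        using bcs_measurable[OF K.k_bcs] lcs_measurable[OF y0] by measurable
      show "indicator {0..\<tau>} s *\<^sub>R (k (t - s) ** \<gamma> s \<tau>) = punctured T k (t - s) ** cutoff {0..\<tau>} y0 s"
        if "s \<noteq> t" for s
        using that t \<tau> by (auto simp: cutoff_def punctured_def y0_def indicator_def)
    qed
    moreover have "\<gamma> t \<tau> - (LINT v:{0..\<tau>}|lborel. k (t - v) ** \<gamma> v \<tau>) = k (t - \<tau>)"
      using \<gamma>(1) \<tau>\<tau> t unfolding resolvent_kernel_def by blast
    moreover have "k (t - \<tau>) = punctured T k (t - \<tau>)" using t \<tau> by (auto simp: punctured_def cutoff_def)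
    ultimately show ?thesis by (simp add: y_def y0_def algebra_simps)
  qed
  have "K.Kop \<tau> y = K.Kop \<tau> y0"
  proof (intro ext conv_cong_AE)
    show "AE s in lborel. cutoff {0..\<tau>} y s = cutoff {0..\<tau>} y0 s"
      using AE_lborel_singleton[of \<tau>] by eventually_elim (use eq in \<open>auto simp: cutoff_def\<close>)
  qed (use bcs_measurable[OF K.k_bcs] lcs_measurable[OF y] lcs_measurable[OF y0] in auto)
  then have "y t = punctured T k (t - \<tau>) + K.Kop \<tau> y t" for t by (simp add: y_def)
  from K.X_unique_all[OF \<tau>T K.reg_k_shift y this, of 0]
    K.X_unique_all[OF \<tau>T K.reg_k_shift K.reg_gam[OF \<tau>T] K.gam_eq[OF \<tau>T], of 0 \<tau>]
  have "y 0 = K.gam \<tau> 0 \<tau>" by simp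
  then show ?thesis using eq[of 0] \<tau> \<gamma>(2) by (simp add: y0_def)
qed

lemma holomorphic_fourier_integral:
  fixes f :: "real \<Rightarrow> complex"
  assumes f: "continuous_on {a..b} f"
  shows "(\<lambda>z. LINT x:{a..b}|lborel. exp (\<i> * z * of_real x) * f x) holomorphic_on UNIV"
proof -
  have c: "continuous_on {a..b} (\<lambda>x. exp (\<i> * z * of_real x) * f x)" for z
    by (intro continuous_intros f)
  have "(LINT x:{a..b}|lborel. exp (\<i> * z * of_real x) * f x) = integral (cbox a b) (\<lambda>x. exp (\<i> * z * of_real x) * f x)" for z
    using set_borel_integral_eq_integral(2)[OF borel_integrable_atLeastAtMost'[OF c]] by simp
  moreover have "(\<lambda>z. integral (cbox a b) (\<lambda>x. exp (\<i> * z * of_real x) * f x)) holomorphic_on UNIV"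
  proof (rule leibniz_rule_holomorphic[where fx = "\<lambda>z x. \<i> * of_real x * exp (\<i> * z * of_real x) * f x"])
    show "((\<lambda>z. exp (\<i> * z * of_real t) * f t) has_field_derivative \<i> * of_real t * exp (\<i> * z * of_real t) * f t) (at z within UNIV)" for z t
      by (auto intro!: derivative_eq_intros)
    show "(\<lambda>x. exp (\<i> * z * of_real x) * f x) integrable_on cbox a b" for z
      using c by (simp add: integrable_continuous_interval)
    have "continuous_on (UNIV \<times> {a..b}) (\<lambda>p. f (snd p))"
      by (rule continuous_on_compose2[OF f]) (auto intro!: continuous_intros)
    then show "continuous_on (UNIV \<times> cbox a b) (\<lambda>(z, x). \<i> * of_real x * exp (\<i> * z * of_real x) * f x)"
      unfolding split_beta by (auto intro!: continuous_intros)
  qed simp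
  ultimately show ?thesis by simp
qed

section \<open>Recovering the accelerant\<close>

lemma set_integral_cscale_cutoff:
  "(LINT x:S|lborel. cscale (e x) (f x)) = (LINT x|lborel. cscale (e x) (cutoff S f x))"
  unfolding set_integral_eq_cutoff
  by (rule Bochner_Integration.integral_cong) (auto simp: cutoff_def)

lemma ctrans_fourier_transform:
  assumes "bcs c"
  shows "ctrans (LINT x|lborel. cscale (exp (\<i> * cnj z * of_real x)) (c x))
    = (LINT x|lborel. cscale (exp (\<i> * z * of_real x)) (ctrans (c (- x))))"
proof -
  obtain S where S: "S \<ge> 0" "\<And>x. norm (c x) \<le> S" "\<And>x. S < \<bar>x\<bar> \<Longrightarrow> c x = 0" using assms by (rule bcsE) blast
  note [measurable] = bcs_measurable[OF assms]
  have int: "integrable lborel (\<lambda>x. cscale (exp (\<i> * cnj z * of_real x)) (c x))"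
  proof (rule integrable_bounded_compact[of _ "exp (norm z * S) * S" S])
    show "norm (cscale (exp (\<i> * cnj z * of_real x)) (c x)) \<le> exp (norm z * S) * S" for x
    proof (cases "S < \<bar>x\<bar>")
      case False
      have "norm (exp (\<i> * cnj z * of_real x)) \<le> exp (norm (\<i> * cnj z * of_real x))" by (rule norm_exp)
      also have "\<dots> \<le> exp (norm z * S)" using False by (simp add: norm_mult mult_left_mono)
      finally show ?thesis unfolding norm_cscale using S by (intro mult_mono) auto
    qed (use S in simp)
  qed (use S in auto)
  have "ctrans (LINT x|lborel. cscale (exp (\<i> * cnj z * of_real x)) (c x))
      = (LINT x|lborel. ctrans (cscale (exp (\<i> * cnj z * of_real x)) (c x)))"
    by (rule integral_bounded_linear[OF bounded_linear_ctrans int, symmetric])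
  also have "\<dots> = (LINT x|lborel. cscale (exp (\<i> * z * of_real x)) (ctrans (c (- x))))"
    by (subst lborel_integral_real_affine[of "-1" _ 0]) (simp_all add: ctrans_cscale exp_cnj)
  finally show ?thesis .
qed

text \<open>Everything that depends on the accelerant is collected here for fixed \<open>F\<close>
  and \<open>G\<close>, which depend on \<open>T\<close> and \<open>U\<close> alone. It can
  therefore be applied both to \<open>k\<close> and to any other accelerant with the same
  potential.\<close>

lemma krein_data:
  fixes T :: real and k a :: "real \<Rightarrow> complex^'r^'r"
    and U :: "real \<Rightarrow> complex \<Rightarrow> complex^('r + 'r)^('r + 'r)"
    and F G :: "complex \<Rightarrow> complex^'r^'r"
  assumes T: "T > 0" and acc: "accelerant T k" and pot: "potential T k a" and U: "matrizant T a U"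
    and F: "\<And>z. F z = cscale (exp (\<i> * z * complex_of_real T))
                   (block_row (mat 1) (mat 1) ** U T (- z) ** block_col (mat 1) 0)"
    and G: "\<And>z. G z = block_row (mat 1) (mat 1) ** U T (- z) ** block_col 0 (mat 1)"
  obtains f g where "continuous_on {0..T} f" "continuous_on {-T..0} g"
    "\<And>z. F z = mat 1 + (LINT x|lborel. cscale (exp (\<i> * z * complex_of_real x)) (cutoff {0..T} f x))"
    "\<And>z. G z = mat 1 + (LINT x|lborel. cscale (exp (\<i> * z * complex_of_real x)) (cutoff {-T..0} g x))"
    "resultant_data T (cutoff {0..T} f) (cutoff {-T..0} g) (\<lambda>u. ctrans (cutoff {0..T} f (- u)))
      (\<lambda>u. ctrans (cutoff {-T..0} g (- u))) (\<lambda>x. - punctured T k x) {-T..<0} {0..T}"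
proof -
  define \<kappa> where "\<kappa> = punctured T k"
  interpret K: jump_kernel T \<kappa> unfolding \<kappa>_def by (rule accelerant_jump_kernel[OF T acc])
  have herm: "\<kappa> (- x) = ctrans (\<kappa> x)" for x unfolding \<kappa>_def by (rule punctured_herm[OF acc])
  interpret A: krein_accelerant T a \<kappa> U
  proof
    show "continuous_on {0..T} a" using pot by (simp add: potential_def)
    show "a \<tau> = K.gam \<tau> 0 \<tau>" if "0 < \<tau>" "\<tau> \<le> T" for \<tau>
      unfolding \<kappa>_def by (rule potential_eq_gam[OF T acc pot that])
  qed (use T U herm in auto)
  interpret M: jump_kernel T "\<lambda>x. \<kappa> (- x)" by (rule K.mirror)
  have TT: "T \<in> {0..T}" using T by simp
  obtain l where l: "(k \<longlongrightarrow> l) (at_left 0)" using acc by (auto simp: accelerant_def)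
  obtain r where r: "(k \<longlongrightarrow> r) (at_right 0)" using acc by (auto simp: accelerant_def)
  have kc: "continuous_on {-T..<0} k" "continuous_on {0<..T} k" using acc by (auto simp: accelerant_def)
  \<comment> \<open>The accelerant completed by its right limit at 0, plus the continuous part of
    the resolvent row. Because of \<open>k (- x) = ctrans (k x)\<close>, its adjoint is that row at
    positive points. The definition of \<open>g\<close> uses the reflected kernel and the left
    limit.\<close>
  define f where "f x = (if x = 0 then r else k x) + ctrans (K.rho T 0 x)" for x
  define g where "g x = (if x = 0 then l else k x) + ctrans (M.rho T 0 (- x))" for x
  have rho: "continuous_on S (\<lambda>x. ctrans (K.rho T 0 x))" for S
  proof -
    have "continuous_on S (\<lambda>v. (0 :: real, v))" by (intro continuous_on_Pair continuous_on_id continuous_on_const)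
    from continuous_on_compose2[OF K.rho_continuous[OF TT, of UNIV] this]
    show ?thesis by (intro bounded_linear.continuous_on[OF bounded_linear_ctrans]) simp
  qed
  have rho': "continuous_on S (\<lambda>x. ctrans (M.rho T 0 (- x)))" for S
  proof -
    have "continuous_on S (\<lambda>v. (0 :: real, - v))"
      by (intro continuous_on_Pair continuous_on_minus continuous_on_id continuous_on_const)
    from continuous_on_compose2[OF M.rho_continuous[OF TT, of UNIV] this]
    show ?thesis by (intro bounded_linear.continuous_on[OF bounded_linear_ctrans]) simp
  qed
  have fc: "continuous_on {0..T} f"
    unfolding f_def by (intro continuous_on_add continuous_extension_right kc r T rho)
  have gc: "continuous_on {-T..0} g"
    unfolding g_def by (intro continuous_on_add continuous_extension_left kc l T rho')
  define fz where "fz = cutoff {0..T} f"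
  define gz where "gz = cutoff {-T..0} g"
  have fb: "bcs fz" "bcs gz" unfolding fz_def gz_def by (intro bcs_cutoff_continuous fc gc)+
  have f_gam: "ctrans (fz s) = K.gam T 0 s" if "0 < s" "s \<le> T" for s
    unfolding K.gam_def fz_def f_def
    using that herm[of s] by (simp add: cutoff_def \<kappa>_def punctured_def ctrans_add)
  have g_gam: "ctrans (gz (- s)) = M.gam T 0 s" if "0 < s" "s \<le> T" for s
    unfolding M.gam_def gz_def g_def
    using that herm[of "- s"] by (simp add: cutoff_def \<kappa>_def punctured_def ctrans_add)
  have fz_out: "fz s = 0" if "s \<notin> {0..T}" for s using that unfolding fz_def cutoff_def by auto
  have gz_out: "gz s = 0" if "s \<notin> {-T..0}" for s using that unfolding gz_def cutoff_def by auto
  have Feq: "F z = mat 1 + (LINT x|lborel. cscale (exp (\<i> * z * complex_of_real x)) (fz x))" for z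
  proof -
    have "F z = ctrans (K.X T (wave (- (\<i> * cnj z))) 0)"
      unfolding F using A.Y_ends(1)[of z] by (simp add: A.Y1_def A.lend_def)
    then show ?thesis
      using K.ctrans_X_wave[OF bcs_measurable[OF fb(1)] f_gam fz_out, of "- (\<i> * cnj z)"] by simp
  qed
  have Geq: "G z = mat 1 + (LINT x|lborel. cscale (exp (\<i> * z * complex_of_real x)) (gz x))" for z
  proof -
    have "G z = ctrans (M.X T (wave (\<i> * cnj z)) 0)"
      unfolding G using A.Y_ends(2)[of z] by (simp add: A.Y2_def A.rend_def)
    also have "\<dots> = mat 1 + (LINT s|lborel. cscale (exp (- (\<i> * z * complex_of_real s))) (gz (- s)))"
    proof -
      have "gz (- s) = 0" if "s \<notin> {0..T}" for s by (rule gz_out) (use that in auto)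
      from M.ctrans_X_wave[OF bcs_measurable[OF bcs_mirror[OF fb(2)]] g_gam this, of "\<i> * cnj z"]
      show ?thesis by simp
    qed
    also have "(LINT s|lborel. cscale (exp (- (\<i> * z * complex_of_real s))) (gz (- s)))
        = (LINT x|lborel. cscale (exp (\<i> * z * complex_of_real x)) (gz x))"
      by (subst lborel_integral_real_affine[of "-1" _ 0]) auto
    finally show ?thesis .
  qed
  define b where "b u = ctrans (fz (- u))" for u
  define d where "d u = ctrans (gz (- u))" for u
  have bb: "bcs b" "bcs d" unfolding b_def d_def by (intro bcs_ctrans bcs_mirror fb)+
  have b_out: "b u = 0" if "u \<notin> {-T..0}" for u
  proof -
    have "- u \<notin> {0..T}" using that by auto
    then show ?thesis by (simp add: b_def fz_out)
  qed
  have d_out: "d u = 0" if "u \<notin> {0..T}" for u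
  proof -
    have "- u \<notin> {-T..0}" using that by auto
    then show ?thesis by (simp add: d_def gz_out)
  qed
  have bk: "b x - \<kappa> x - conv b \<kappa> x = 0" if "-T \<le> x" "x < 0" for x
    by (rule K.row_conv[OF _ b_out that bb(1)]) (simp add: b_def f_gam)
  have dk: "d x - \<kappa> x - conv d \<kappa> x = 0" if "0 < x" "x \<le> T" for x
  proof -
    have "d (- (- x)) - \<kappa> (- (- x)) - conv (\<lambda>x. d (- x)) (\<lambda>x. \<kappa> (- x)) (- x) = 0"
    proof (rule M.row_conv)
      show "d (- (- s)) = M.gam T 0 s" if "0 < s" "s \<le> T" for s using that by (simp add: d_def g_gam)
      show "d (- u) = 0" if "u \<notin> {-T..0}" for u by (rule d_out) (use that in auto)
    qed (use that bb(2) in \<open>auto intro: bcs_mirror\<close>)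
    then show ?thesis by (simp add: conv_mirror)
  qed
  have star: "ctrans (conv c \<kappa> u) = conv \<kappa> (\<lambda>x. ctrans (c (- x))) (- u)" if "bcs c" for c u
    using conv_ctrans[OF that bcs_imp_lcs[OF K.k_bcs], of u] by (simp add: herm)
  \<comment> \<open>The column equations are the adjoints of the row equations for \<open>b\<close>
    and \<open>d\<close>; hermitian symmetry of the kernel keeps \<open>\<kappa>\<close> in
    place.\<close>
  have kf: "\<kappa> x - fz x + conv \<kappa> fz x = 0" if "0 < x" "x \<le> T" for x
  proof -
    have "ctrans (b (- x) - \<kappa> (- x) - conv b \<kappa> (- x)) = 0"
      using bk[of "- x"] that by simp
    then show ?thesis
      unfolding ctrans_diff star[OF bb(1)] by (simp add: b_def herm[of x] algebra_simps)
  qed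
  have kg: "\<kappa> x - gz x + conv \<kappa> gz x = 0" if "-T \<le> x" "x < 0" for x
  proof -
    have "ctrans (d (- x) - \<kappa> (- x) - conv d \<kappa> (- x)) = 0"
      using dk[of "- x"] that by simp
    then show ?thesis
      unfolding ctrans_diff star[OF bb(2)] by (simp add: d_def herm[of x] algebra_simps)
  qed
  have b_cut: "b = cutoff {-T..0} (\<lambda>u. ctrans (f (- u)))"
    by (auto simp: b_def fz_def cutoff_def)
  have d_cut: "d = cutoff {0..T} (\<lambda>u. ctrans (g (- u)))"
    by (auto simp: d_def gz_def cutoff_def)
  have cf: "continuous_on {-T..0} (\<lambda>u. ctrans (f (- u)))"
    by (intro bounded_linear.continuous_on[OF bounded_linear_ctrans] continuous_on_compose2[OF fc])
      (auto intro!: continuous_intros)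
  have cg: "continuous_on {0..T} (\<lambda>u. ctrans (g (- u)))"
    by (intro bounded_linear.continuous_on[OF bounded_linear_ctrans] continuous_on_compose2[OF gc])
      (auto intro!: continuous_intros)
  \<comment> \<open>The difference of the kernels of \<open>F\<close> times its adjoint and
    \<open>G\<close> times its adjoint. Its transform vanishes by the conservation law, and within
    \<open>[-T, T]\<close> it can be discontinuous at 0 only.\<close>
  define h where "h x = (fz x + b x + conv fz b x) - (gz x + d x + conv gz d x)" for x
  have conv_out: "conv fz b x = 0" "conv gz d x = 0" if "x \<notin> {-T..T}" for x
  proof -
    show "conv fz b x = 0"
    proof (rule conv_zero)
      show "fz (x - s) = 0 \<or> b s = 0" for s
        using fz_out[of "x - s"] b_out[of s] that by (cases "s \<in> {-T..0}") auto
    qed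
    show "conv gz d x = 0"
    proof (rule conv_zero)
      show "gz (x - s) = 0 \<or> d s = 0" for s
        using gz_out[of "x - s"] d_out[of s] that by (cases "s \<in> {0..T}") auto
    qed
  qed
  have hb: "bcs (\<lambda>x. fz x + b x + conv fz b x)" "bcs (\<lambda>x. gz x + d x + conv gz d x)"
    using fb bb by (auto intro!: bcs_add bcs_conv bcs_imp_lcs)
  have h_zero: "h x = 0" if x: "x \<noteq> 0" for x
  proof (rule fourier_unique_matrix[OF _ _ T _ _ x])
    show "bcs h" unfolding h_def diff_conv_add_uminus by (rule bcs_add[OF hb(1) bcs_minus[OF hb(2)]])
    show "h x = 0" if "x \<notin> {-T..T}" for x
      using conv_out[OF that] fz_out[of x] gz_out[of x] b_out[of x] d_out[of x] that by (auto simp: h_def)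
    show "continuous (at x within {-T..T}) h" if x: "x \<in> {-T..T}" "x \<noteq> 0" for x
    proof -
      have "continuous (at x within {-T..T}) (conv fz b)" "continuous (at x within {-T..T}) (conv gz d)"
        using conv_continuous[OF fb(1) _ _ bcs_imp_lcs[OF bb(1)], of "{0, T}" "{-T..T}"]
          conv_continuous[OF fb(2) _ _ bcs_imp_lcs[OF bb(2)], of "{-T, 0}" "{-T..T}"]
          cutoff_isCont[OF fc] cutoff_isCont[OF gc] x
        by (auto simp: fz_def gz_def continuous_on_eq_continuous_within)
      moreover have "continuous (at x within {-T..T}) fz" "continuous (at x within {-T..T}) d"
        unfolding fz_def d_cut by (intro cutoff_continuous_off_zero(1) x fc cg)+
      moreover have "continuous (at x within {-T..T}) gz" "continuous (at x within {-T..T}) b"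
        unfolding gz_def b_cut by (intro cutoff_continuous_off_zero(2) x gc cf)+
      ultimately show ?thesis unfolding h_def by (intro continuous_intros)
    qed
    show "fourier h t = 0" for t
    proof -
      have four: "F (of_real t) = mat 1 + fourier fz t" "G (of_real t) = mat 1 + fourier gz t"
        unfolding Feq Geq fourier_def by (simp_all add: mult.assoc)
      have out: "fz x = 0" "gz x = 0" "b x = 0" "d x = 0" "conv fz b x = 0" "conv gz d x = 0"
        if "T < \<bar>x\<bar>" for x
        using that T by (auto intro!: fz_out gz_out b_out d_out conv_out)
      have star_four: "mat 1 + fourier (\<lambda>x. ctrans (c (- x))) t = ctrans (mat 1 + fourier c t)"
        if "bcs c" for c :: "real \<Rightarrow> complex^'r^'r"
        using ctrans_fourier_transform[OF that, of "of_real t"]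
        by (simp add: fourier_def ctrans_add mult.assoc)
      have "mat 1 + fourier (\<lambda>x. fz x + b x + conv fz b x) t = F (of_real t) ** ctrans (F (of_real t))"
        using fourier_conv[OF fb(1) bb(1) T out(1,3,5), of t] star_four[OF fb(1)]
        by (simp add: four b_def[abs_def])
      also have "\<dots> = G (of_real t) ** ctrans (G (of_real t))"
      proof -
        \<comment> \<open>For real \<open>t\<close> the factor
          \<open>exp (\<i> * of_real t * of_real T)\<close> in \<open>F\<close> has modulus 1 and
          drops out of the product with the adjoint.\<close>
        have "cnj (exp (\<i> * of_real t * of_real T)) * exp (\<i> * of_real t * of_real T) = 1"
          by (simp only: exp_cnj exp_add[symmetric]) simp
        then show ?thesis
          using A.Y_conserved[of "- t"] unfolding F G A.Y1_def A.Y2_def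
          by (simp add: ctrans_cscale cscale_mult_left cscale_mult_right)
      qed
      also have "\<dots> = mat 1 + fourier (\<lambda>x. gz x + d x + conv gz d x) t"
        using fourier_conv[OF fb(2) bb(2) T out(2,4,6), of t] star_four[OF fb(2)]
        by (simp add: four d_def[abs_def])
      finally have "fourier (\<lambda>x. fz x + b x + conv fz b x) t = fourier (\<lambda>x. gz x + d x + conv gz d x) t" by simp
      moreover have "fourier h t = fourier (\<lambda>x. fz x + b x + conv fz b x) t - fourier (\<lambda>x. gz x + d x + conv gz d x) t"
        unfolding fourier_def h_def cscale.diff_right
        by (intro Bochner_Integration.integral_diff fourier_integrable hb)
      ultimately show ?thesis by simp
    qed
  qed
  have "resultant_data T fz gz b d (\<lambda>x. - \<kappa> x) {-T..<0} {0..T}"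
  proof
    show "bcs fz" "bcs gz" "bcs b" "bcs d" by fact+
    show "bcs (\<lambda>x. - \<kappa> x)" by (rule bcs_minus[OF K.k_bcs])
    show "0 \<le> x \<and> x \<le> T" if "fz x \<noteq> 0" for x using fz_out[of x] that by auto
    show "0 \<le> x \<and> x \<le> T" if "d x \<noteq> 0" for x using d_out[of x] that by auto
    show "-T \<le> x \<and> x \<le> 0" if "gz x \<noteq> 0" for x using gz_out[of x] that by auto
    show "-T \<le> x \<and> x \<le> 0" if "b x \<noteq> 0" for x using b_out[of x] that by auto
    show "{-T..<0} \<union> {0..T} = {-T..T}" using T by auto
    show "d x + - \<kappa> x + conv d (\<lambda>x. - \<kappa> x) x = 0" if "0 < x" "x \<le> T" for x
      using dk[OF that] by (simp add: conv_minus_right)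
    show "b x + - \<kappa> x + conv b (\<lambda>x. - \<kappa> x) x = 0" if "-T \<le> x" "x < 0" for x
      using bk[OF that] by (simp add: conv_minus_right)
    show "- \<kappa> x + fz x + conv (\<lambda>x. - \<kappa> x) fz x = 0" if "0 < x" "x \<le> T" for x
      using kf[OF that] by (simp add: conv_minus_left algebra_simps)
    show "- \<kappa> x + gz x + conv (\<lambda>x. - \<kappa> x) gz x = 0" if "-T \<le> x" "x < 0" for x
      using kg[OF that] by (simp add: conv_minus_left algebra_simps)
    show "AE x in lborel. fz x + b x + conv fz b x = gz x + d x + conv gz d x"
      using AE_lborel_singleton[of 0] by eventually_elim (use h_zero in \<open>simp add: h_def\<close>)
  qed (use T in auto)
  then show ?thesis
    using that[of f g] fc gc Feq Geq unfolding fz_def gz_def b_def[abs_def] d_def[abs_def] \<kappa>_def by blast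
qed

lemma fourier_transform_unique:
  fixes f f' :: "real \<Rightarrow> complex^'r^'r"
  assumes T: "T > 0" and ab: "(a = 0 \<and> b = T) \<or> (a = -T \<and> b = 0)"
    and f: "continuous_on {a..b} f" "continuous_on {a..b} f'"
    and eq: "\<And>z. mat 1 + (LINT x|lborel. cscale (exp (\<i> * z * complex_of_real x)) (cutoff {a..b} f x))
      = mat 1 + (LINT x|lborel. cscale (exp (\<i> * z * complex_of_real x)) (cutoff {a..b} f' x))"
    and x: "x \<noteq> 0"
  shows "cutoff {a..b} f x = cutoff {a..b} f' x"
proof -
  note fb = bcs_cutoff_continuous[OF f(1)] bcs_cutoff_continuous[OF f(2)]
  have "cutoff {a..b} f x - cutoff {a..b} f' x = 0"
  proof (rule fourier_unique_matrix[OF _ _ T _ _ x])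
    show "bcs (\<lambda>x. cutoff {a..b} f x - cutoff {a..b} f' x)" using bcs_add[OF fb(1) bcs_minus[OF fb(2)]] by simp
    show "cutoff {a..b} f x - cutoff {a..b} f' x = 0" if "x \<notin> {-T..T}" for x
      using that ab T by (auto simp: cutoff_def)
    show "continuous (at x within {-T..T}) (\<lambda>x. cutoff {a..b} f x - cutoff {a..b} f' x)"
      if "x \<in> {-T..T}" "x \<noteq> 0" for x
      using cutoff_continuous_off_zero[OF that, of f] cutoff_continuous_off_zero[OF that, of f'] ab f
      by (auto intro!: continuous_diff)
    show "fourier (\<lambda>x. cutoff {a..b} f x - cutoff {a..b} f' x) t = 0" for t
    proof -
      have "fourier (\<lambda>x. cutoff {a..b} f x - cutoff {a..b} f' x) t = fourier (cutoff {a..b} f) t - fourier (cutoff {a..b} f') t"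
        unfolding fourier_def cscale.diff_right by (intro Bochner_Integration.integral_diff fourier_integrable fb)
      then show ?thesis using eq[of "of_real t"] by (simp add: fourier_def mult.assoc)
    qed
  qed
  then show ?thesis by simp
qed

text \<open>A difference that is nonzero at \<open>x\<close> stays nonzero on a piece of
  \<open>I\<close> near \<open>x\<close>. The assumption on intervals gives this piece positive
  length, also at an endpoint of a half-open \<open>I\<close>.\<close>

lemma AE_eq_continuous:
  fixes f g :: "real \<Rightarrow> 'v::real_normed_vector"
  assumes ae: "AE x in lborel. x \<in> I \<longrightarrow> f x = g x" and c: "continuous_on I f" "continuous_on I g"
    and I: "\<And>e. e > 0 \<Longrightarrow> \<exists>u v. u < v \<and> {u..v} \<subseteq> I \<inter> ball x e" and x: "x \<in> I"
  shows "f x = g x"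
proof (rule ccontr)
  assume ne: "f x \<noteq> g x"
  have "continuous_on I (\<lambda>x. f x - g x)" by (intro continuous_intros c)
  then obtain e where e: "e > 0" "\<And>y. y \<in> I \<Longrightarrow> dist y x < e \<Longrightarrow> dist (f y - g y) (f x - g x) < norm (f x - g x)"
    unfolding continuous_on_iff using x ne by (metis right_minus_eq zero_less_norm_iff)
  obtain u v where uv: "u < v" "{u..v} \<subseteq> I \<inter> ball x e" using I[OF e(1)] by blast
  have "AE y in lborel. y \<notin> {u..v}"
    using ae
  proof eventually_elim
    case (elim y)
    show ?case
    proof
      assume y: "y \<in> {u..v}"
      then have "y \<in> I" "dist y x < e" using uv(2) by (auto simp: dist_commute)
      then show False using elim e(2)[of y] by (simp add: dist_norm norm_minus_commute)
    qed
  qed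
  then have "emeasure lborel {u..v} = 0" by (subst (asm) AE_iff_measurable[of "{u..v}"]) auto
  then show False using uv(1) by simp
qed

theorem theorem1p3:
  fixes T :: real
    and k a :: "real \<Rightarrow> complex^'r^'r"
    and U :: "real \<Rightarrow> complex \<Rightarrow> complex^('r + 'r)^('r + 'r)"
    and F G :: "complex \<Rightarrow> complex^'r^'r"
  assumes "T > 0"
    and "accelerant T k"
    and "potential T k a"
    and "matrizant T a U"
    and F: "\<And>z. F z = cscale (exp (\<i> * z * complex_of_real T))
                   (block_row (mat 1) (mat 1) ** U T (- z) ** block_col (mat 1) 0)"
    and G: "\<And>z. G z = block_row (mat 1) (mat 1) ** U T (- z) ** block_col 0 (mat 1)"
  shows "(\<forall>k'. accelerant T k' \<and> potential T k' a \<longrightarrow> (\<forall>t\<in>{-T..T} - {0}. k' t = k t))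
    \<and> (\<forall>i j. (\<lambda>z. F z $ i $ j) holomorphic_on UNIV)
    \<and> (\<forall>i j. (\<lambda>z. G z $ i $ j) holomorphic_on UNIV)
    \<and> (\<exists>f g. continuous_on {0..T} f \<and> continuous_on {-T..0} g
        \<and> (\<forall>z. F z = mat 1 + (LINT x:{0..T}|lborel. cscale (exp (\<i> * z * complex_of_real x)) (f x)))
        \<and> (\<forall>z. G z = mat 1 + (LINT x:{-T..0}|lborel. cscale (exp (\<i> * z * complex_of_real x)) (g x)))
        \<and> (let b = (\<lambda>u. if u \<in> {-T..0} then ctrans (f (- u)) else 0);
               d = (\<lambda>u. if u \<in> {0..T} then ctrans (g (- u)) else 0);
               q = (\<lambda>x. if x < 0 then ctrans (f (- x)) else ctrans (g (- x)))
           in resultant_kernels T (sharp F) (sharp G) b d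
            \<and> (\<exists>Rinv. L1_inverse {-T..T} (resultant T b d) Rinv
                 \<and> (AE x\<in>{-T..T} in lborel. k x = Rinv q x))))"
proof -
  note T = assms(1) and acc = assms(2) and pot = assms(3) and U = assms(4)
  obtain f g where fg: "continuous_on {0..T} f" "continuous_on {-T..0} g"
    and Fz: "\<And>z. F z = mat 1 + (LINT x|lborel. cscale (exp (\<i> * z * complex_of_real x)) (cutoff {0..T} f x))"
    and Gz: "\<And>z. G z = mat 1 + (LINT x|lborel. cscale (exp (\<i> * z * complex_of_real x)) (cutoff {-T..0} g x))"
    and res: "resultant_data T (cutoff {0..T} f) (cutoff {-T..0} g) (\<lambda>u. ctrans (cutoff {0..T} f (- u)))
      (\<lambda>u. ctrans (cutoff {-T..0} g (- u))) (\<lambda>x. - punctured T k x) {-T..<0} {0..T}"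
    using krein_data[OF T acc pot U F G] by blast
  define b where "b = (\<lambda>u. if u \<in> {-T..0} then ctrans (f (- u)) else 0)"
  define d where "d = (\<lambda>u. if u \<in> {0..T} then ctrans (g (- u)) else 0)"
  define q where "q = (\<lambda>x. if x < 0 then ctrans (f (- x)) else ctrans (g (- x)))"
  have b_eq: "(\<lambda>u. ctrans (cutoff {0..T} f (- u))) = b"
    by (auto simp: b_def cutoff_def)
  have d_eq: "(\<lambda>u. ctrans (cutoff {-T..0} g (- u))) = d"
    by (auto simp: d_def cutoff_def)
  define \<kappa> where "\<kappa> = punctured T k"
  interpret R: resultant_data T "cutoff {0..T} f" "cutoff {-T..0} g" b d "\<lambda>x. - \<kappa> x" "{-T..<0}" "{0..T}"
    using res unfolding b_eq d_eq \<kappa>_def .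
  have l\<kappa>: "lcs (punctured T k')" if "accelerant T k'" for k' :: "real \<Rightarrow> complex^'r^'r"
    by (intro bcs_imp_lcs punctured_bcs T that)
  have out\<kappa>: "punctured T k' x = 0" if "x \<notin> {-T..T}" for k' :: "real \<Rightarrow> complex^'r^'r" and x
    using that by (auto simp: punctured_def cutoff_def)
  have I: "{-T..T} \<in> sets borel" by simp
  have q_eq: "cutoff {-T..T} q x = (if x < 0 then b x else d x)" for x
    using T by (auto simp: q_def b_def d_def cutoff_def)
  have lq: "lcs (cutoff {-T..T} q)"
  proof -
    have "cutoff {-T..T} q = (\<lambda>x. cutoff {..<0} b x + cutoff {0..} d x)"
      unfolding fun_eq_iff q_eq by (auto simp: cutoff_def)
    moreover have "lcs (\<lambda>x. cutoff {..<0} b x + cutoff {0..} d x)"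
      using R.bcs(3,4) by (intro lcs_add lcs_cutoff bcs_imp_lcs) auto
    ultimately show ?thesis by simp
  qed
  \<comment> \<open>Any accelerant with potential \<open>a\<close> comes with kernels of the same
    \<open>F\<close> and \<open>G\<close>. By uniqueness of transforms these agree with
    \<open>f\<close> and \<open>g\<close> away from 0, so the row equations of \<open>k'\<close> say
    that the operator built from \<open>k\<close> maps \<open>k'\<close> to
    \<open>q\<close>.\<close>
  have solves: "AE x in lborel. R.inv_op (cutoff {-T..T} q) x = punctured T k' x"
    if k': "accelerant T k'" "potential T k' a" for k' :: "real \<Rightarrow> complex^'r^'r"
  proof -
    obtain f' g' where fg': "continuous_on {0..T} f'" "continuous_on {-T..0} g'"
      and Fz': "\<And>z. F z = mat 1 + (LINT x|lborel. cscale (exp (\<i> * z * complex_of_real x)) (cutoff {0..T} f' x))"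
      and Gz': "\<And>z. G z = mat 1 + (LINT x|lborel. cscale (exp (\<i> * z * complex_of_real x)) (cutoff {-T..0} g' x))"
      and res': "resultant_data T (cutoff {0..T} f') (cutoff {-T..0} g') (\<lambda>u. ctrans (cutoff {0..T} f' (- u)))
        (\<lambda>u. ctrans (cutoff {-T..0} g' (- u))) (\<lambda>x. - punctured T k' x) {-T..<0} {0..T}"
      using krein_data[OF T k' U F G] by blast
    define b' where "b' = (\<lambda>u. ctrans (cutoff {0..T} f' (- u)))"
    define d' where "d' = (\<lambda>u. ctrans (cutoff {-T..0} g' (- u)))"
    interpret R': resultant_data T "cutoff {0..T} f'" "cutoff {-T..0} g'" b' d' "\<lambda>x. - punctured T k' x" "{-T..<0}" "{0..T}"
      using res' unfolding b'_def d'_def .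
    have ff: "cutoff {0..T} f' x = cutoff {0..T} f x" if "x \<noteq> 0" for x
      by (rule fourier_transform_unique[OF T _ fg'(1) fg(1) _ that]) (use Fz Fz' in auto)
    have gg: "cutoff {-T..0} g' x = cutoff {-T..0} g x" if "x \<noteq> 0" for x
      by (rule fourier_transform_unique[OF T _ fg'(2) fg(2) _ that]) (use Gz Gz' in auto)
    have bb: "b' u = b u" "d' u = d u" if "u \<noteq> 0" for u
      using ff[of "- u"] gg[of "- u"] that fun_cong[OF b_eq, of u] fun_cong[OF d_eq, of u] by (auto simp: b'_def d'_def)
    \<comment> \<open>The kernels differ at most at 0, which affects a convolution integrand at one
      point.\<close>
    have convs: "conv b' (punctured T k') x = conv b (punctured T k') x"
      "conv d' (punctured T k') x = conv d (punctured T k') x" for x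
    proof -
      note [measurable] = bcs_measurable[OF R.bcs(3)] bcs_measurable[OF R.bcs(4)] lcs_measurable[OF l\<kappa>[OF k'(1)]]
      show "conv b' (punctured T k') x = conv b (punctured T k') x"
        unfolding conv_def by (rule integral_cong_except[of _ x]) (use bb in auto)
      show "conv d' (punctured T k') x = conv d (punctured T k') x"
        unfolding conv_def by (rule integral_cong_except[of _ x]) (use bb in auto)
    qed
    show ?thesis
    proof (rule R.resultant_inverse(2)[OF refl refl lq l\<kappa>[OF k'(1)] out\<kappa>])
      show "AE x\<in>{-T..T} in lborel. resultant T b d (punctured T k') x = cutoff {-T..T} q x"
        unfolding AE_inside_iff
      proof (intro AE_I2 impI)
        fix x assume x: "x \<in> {-T<..<T} \<and> x \<noteq> 0"
        have cut: "cutoff {-T..T} (punctured T k') = punctured T k'"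
          using out\<kappa> by (auto simp: cutoff_def fun_eq_iff)
        show "resultant T b d (punctured T k') x = cutoff {-T..T} q x"
        proof (cases "x < 0")
          case True
          then show ?thesis
            using R'.bn[of x] x bb(1)[of x] resultant_eq[of x T b d "punctured T k'"]
            by (simp add: q_eq cut Dop_def conv_minus_right convs algebra_simps)
        next
          case False
          then show ?thesis
            using R'.dn[of x] x bb(2)[of x] resultant_eq[of x T b d "punctured T k'"]
            by (simp add: q_eq cut Dop_def conv_minus_right convs algebra_simps)
        qed
      qed
    qed auto
  qed
  have unique: "k' t = k t" if k': "accelerant T k'" "potential T k' a" and t: "t \<in> {-T..T} - {0}"
    for k' :: "real \<Rightarrow> complex^'r^'r" and t
  proof -
    have ae: "AE x in lborel. punctured T k' x = punctured T k x"
      using solves[OF k'] solves[OF acc pot] by eventually_elim simp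
    have c: "continuous_on {-T..<0} k" "continuous_on {0<..T} k"
      "continuous_on {-T..<0} k'" "continuous_on {0<..T} k'"
      using acc k'(1) by (auto simp: accelerant_def)
    show ?thesis
    proof (cases "t < 0")
      case True
      show ?thesis
      proof (rule AE_eq_continuous[OF _ c(3,1)])
        show "AE x in lborel. x \<in> {-T..<0} \<longrightarrow> k' x = k x"
          using ae by eventually_elim (use T in \<open>auto simp: punctured_def cutoff_def\<close>)
        \<comment> \<open>The interval extends from \<open>t\<close> towards 0, since
          \<open>t\<close> may be the endpoint \<open>-T\<close>; half the distance to 0 keeps it
          inside.\<close>
        show "\<exists>u v. u < v \<and> {u..v} \<subseteq> {-T..<0} \<inter> ball t e" if "e > 0" for e
          using that True t
          by (intro exI[of _ t] exI[of _ "t + min (e / 2) (- t / 2)"])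
            (auto simp: dist_real_def min_def)
      qed (use True t in auto)
    next
      case False
      show ?thesis
      proof (rule AE_eq_continuous[OF _ c(4,2)])
        show "AE x in lborel. x \<in> {0<..T} \<longrightarrow> k' x = k x"
          using ae by eventually_elim (use T in \<open>auto simp: punctured_def cutoff_def\<close>)
        show "\<exists>u v. u < v \<and> {u..v} \<subseteq> {0<..T} \<inter> ball t e" if "e > 0" for e
          using that False t
          by (intro exI[of _ "t - min (e / 2) (t / 2)"] exI[of _ t]) (auto simp: dist_real_def min_def)
      qed (use False t in auto)
    qed
  qed
  have holo: "(\<lambda>z. H z $ i $ j) holomorphic_on UNIV"
    if H: "\<And>z. H z = mat 1 + (LINT x:{u..v}|lborel. cscale (exp (\<i> * z * complex_of_real x)) (\<phi> x))"
      and \<phi>: "continuous_on {u..v} \<phi>"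
    for H :: "complex \<Rightarrow> complex^'r^'r" and \<phi> u v i j
  proof -
    have bl: "bounded_linear (\<lambda>A :: complex^'r^'r. A $ i $ j)"
      by (rule bounded_linear_compose[OF bounded_linear_vec_nth bounded_linear_vec_nth])
    have "H z $ i $ j = mat 1 $ i $ j + (LINT x:{u..v}|lborel. exp (\<i> * z * complex_of_real x) * \<phi> x $ i $ j)" for z
    proof -
      have "set_integrable lborel {u..v} (\<lambda>x. cscale (exp (\<i> * z * complex_of_real x)) (\<phi> x))"
        by (rule borel_integrable_atLeastAtMost') (intro cscale.continuous_on continuous_intros \<phi>)
      from integral_bounded_linear[OF bl this[unfolded set_integrable_def]]
      show ?thesis unfolding H set_lebesgue_integral_def by simp
    qed
    moreover have "continuous_on {u..v} (\<lambda>x. \<phi> x $ i $ j)" by (intro continuous_intros \<phi>)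
    ultimately show ?thesis by (auto intro!: holomorphic_intros holomorphic_fourier_integral)
  qed
  have Fset: "F z = mat 1 + (LINT x:{0..T}|lborel. cscale (exp (\<i> * z * complex_of_real x)) (f x))"
    and Gset: "G z = mat 1 + (LINT x:{-T..0}|lborel. cscale (exp (\<i> * z * complex_of_real x)) (g x))" for z
    unfolding set_integral_cscale_cutoff by (rule Fz, rule Gz)
  have kernels: "resultant_kernels T (sharp F) (sharp G) b d"
  proof -
    have cb: "cutoff {-T..0} b = b" "cutoff {0..T} d = d" by (auto simp: b_def d_def cutoff_def)
    have "b \<in> L1 {-T..0}" "d \<in> L1 {0..T}"
      using bcs_imp_lcs[OF R.bcs(3)] bcs_imp_lcs[OF R.bcs(4)] by (simp_all add: L1_iff_lcs cb)
    moreover have "sharp F z = mat 1 + (LINT u:{-T..0}|lborel. cscale (exp (\<i> * z * complex_of_real u)) (b u))" for z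
      unfolding set_integral_cscale_cutoff cb sharp_def Fz ctrans_add
        ctrans_fourier_transform[OF R.bcs(1)] by (simp add: fun_cong[OF b_eq])
    moreover have "sharp G z = mat 1 + (LINT u:{0..T}|lborel. cscale (exp (\<i> * z * complex_of_real u)) (d u))" for z
      unfolding set_integral_cscale_cutoff cb sharp_def Gz ctrans_add
        ctrans_fourier_transform[OF R.bcs(2)] by (simp add: fun_cong[OF d_eq])
    ultimately show ?thesis unfolding resultant_kernels_def by (auto simp: b_def d_def)
  qed
  have inverse: "\<exists>Rinv. L1_inverse {-T..T} (resultant T b d) Rinv \<and> (AE x\<in>{-T..T} in lborel. k x = Rinv q x)"
  proof (intro exI conjI)
    show "L1_inverse {-T..T} (resultant T b d) (\<lambda>\<phi>. R.inv_op (cutoff {-T..T} \<phi>))"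
      by (rule R.resultant_inverse(1)) auto
    show "AE x\<in>{-T..T} in lborel. k x = R.inv_op (cutoff {-T..T} q) x"
      using solves[OF acc pot] AE_lborel_singleton[of 0]
      by eventually_elim (auto simp: punctured_def cutoff_def)
  qed
  show ?thesis
    using unique holo[OF Fset fg(1)] holo[OF Gset fg(2)] fg Fset Gset kernels inverse
    unfolding Let_def b_def d_def q_def by blast
qed

end
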